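(* Suppose that $G\in\mathbb{G}$ with $\|G-1\|_{\mathcal{B}(H^1_0)}\le 1$. Then there exists a curve $\delta(t)=e^{tX}$ ($t\in[0,1]$), with $X\in\Gamma$, such that $\delta(1)=G$, which has minimal length $L_2$ among all curves in $\mathbb{G}$ joining $1$ and $G$, and in particular $d_2(1,G)=\|X\|_{\mathcal{B}(L^2)}$.
   Context: Let $\Omega\subset\mathbb{R}^n$ be open, $L^2=L^2(\Omega,dx)$ the complex Lebesgue space with its usual inner product $\langle\cdot,\cdot\rangle$, and $H^1_0=H^1_0(\Omega)$ the closure in the Sobolev norm of the complex-valued $C^\infty$ functions with compact support in $\Omega$, a Hilbert space with inner product $[f,g]=\int_\Omega f\bar g\,dx+\int_\Omega\nabla f\cdot\nabla\bar g\,dx$. $\mathcal{B}(\cdot)$ denotes bounded operators with the operator norm, and $Gl(H^1_0)$ the invertible operators in $\mathcal{B}(H^1_0)$. $\mathbb{G}=\{G\in Gl(H^1_0):\langle Gf,Gg\rangle=\langle f,g\rangle\ \text{for all } f,g\in H^1_0\}$ is a Banach-Lie group in the norm topology of $\mathcal{B}(H^1_0)$ with Lie algebra $\Gamma=\{X\in\mathcal{B}(H^1_0):\langle Xf,g\rangle=-\langle f,Xg\rangle\ \text{for all } f,g\in H^1_0\}$, and its tangent space at $G$ is $\{GX:X\in\Gamma\}$. Elements of $\mathbb{G}$ extend to unitary operators on $L^2$, and elements of $\Gamma$ extend to bounded (antihermitian) operators on $L^2$, so tangent vectors extend to bounded operators on $L^2$; $\|V\|_{\mathcal{B}(L^2)}$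 is the operator norm of the extension of $V$ to $L^2$. The length of a differentiable curve $\gamma$ in $\mathbb{G}$ parametrized on an interval $I$ is $L_2(\gamma)=\int_I\|\dot\gamma(t)\|_{\mathcal{B}(L^2)}\,dt$, and $d_2(G_1,G_2)$ is the infimum of $L_2(\gamma)$ over the curves $\gamma$ in $\mathbb{G}$ joining $G_1$ and $G_2$. *)

theory Defs
  imports "HOL-Analysis.Analysis"
begin

section \<open>The complex space $L^2$ of a Euclidean space\<close>

text \<open>
  Representatives are taken Borel measurable: every Lebesgue measurable function agrees almost
  everywhere with a Borel one, so this gives the usual space of classes modulo null sets.
\<close>

definition sq_integrable :: "('a::euclidean_space \<Rightarrow> complex) \<Rightarrow> bool" where
  "sq_integrable f \<longleftrightarrow> f \<in> borel_measurable lborel \<and> integrable lborel (\<lambda>x. (cmod (f x))\<^sup>2)"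

definition l2_rel :: "('a::euclidean_space \<Rightarrow> complex) \<Rightarrow> ('a \<Rightarrow> complex) \<Rightarrow> bool" where
  "l2_rel f g \<longleftrightarrow> sq_integrable f \<and> sq_integrable g \<and> (AE x in lborel. f x = g x)"

lemma sq_integrable_zero: "sq_integrable (\<lambda>x. 0)"
  by (simp add: sq_integrable_def)

lemma part_equivp_l2_rel: "part_equivp l2_rel"
proof (rule part_equivpI)
  show "\<exists>f::'a \<Rightarrow> complex. l2_rel f f"
    by (rule exI[of _ "\<lambda>x. 0"]) (simp add: l2_rel_def sq_integrable_zero)
  show "symp (l2_rel :: ('a \<Rightarrow> complex) \<Rightarrow> _)"
    by (auto simp: symp_def l2_rel_def elim: AE_mp)
  show "transp (l2_rel :: ('a \<Rightarrow> complex) \<Rightarrow> _)"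
  proof (rule transpI)
    fix f g h :: "'a \<Rightarrow> complex"
    assume fg: "l2_rel f g" and gh: "l2_rel g h"
    have "AE x in lborel. f x = h x"
      using fg gh unfolding l2_rel_def by (auto elim: AE_mp)
    with fg gh show "l2_rel f h" by (simp add: l2_rel_def)
  qed
qed

quotient_type (overloaded) 'a l2 = "'a::euclidean_space \<Rightarrow> complex" / partial: l2_rel
  by (rule part_equivp_l2_rel)

lemma sq_integrable_add:
  assumes "sq_integrable f" "sq_integrable g"
  shows "sq_integrable (\<lambda>x. f x + g x)"
proof -
  have [measurable]: "f \<in> borel_measurable lborel" "g \<in> borel_measurable lborel"
    using assms by (auto simp: sq_integrable_def)
  have le: "(cmod (f x + g x))\<^sup>2 \<le> 2 * (cmod (f x))\<^sup>2 + 2 * (cmod (g x))\<^sup>2" for x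
  proof -
    have "(cmod (f x + g x))\<^sup>2 \<le> (cmod (f x) + cmod (g x))\<^sup>2"
      by (intro power_mono norm_triangle_ineq) auto
    also have "\<dots> \<le> 2 * (cmod (f x))\<^sup>2 + 2 * (cmod (g x))\<^sup>2"
      using zero_le_power2[of "cmod (f x) - cmod (g x)"]
      by (simp add: power2_eq_square algebra_simps)
    finally show ?thesis .
  qed
  have "integrable lborel (\<lambda>x. 2 * (cmod (f x))\<^sup>2 + 2 * (cmod (g x))\<^sup>2)"
    using assms by (auto simp: sq_integrable_def)
  then have "integrable lborel (\<lambda>x. (cmod (f x + g x))\<^sup>2)"
    by (rule Bochner_Integration.integrable_bound) (use le in \<open>auto intro!: AE_I2\<close>)
  then show ?thesis by (simp add: sq_integrable_def)
qed

lemma sq_integrable_mult: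
  assumes "sq_integrable f"
  shows "sq_integrable (\<lambda>x. c * f x)"
  using assms by (auto simp: sq_integrable_def norm_mult power_mult_distrib)

lemma integrable_mult_cnj:
  assumes "sq_integrable f" "sq_integrable g"
  shows "integrable lborel (\<lambda>x. f x * cnj (g x))"
proof -
  have [measurable]: "f \<in> borel_measurable lborel" "g \<in> borel_measurable lborel"
    using assms by (auto simp: sq_integrable_def)
  have le: "cmod (f x * cnj (g x)) \<le> (cmod (f x))\<^sup>2 + (cmod (g x))\<^sup>2" for x
    using zero_le_power2[of "cmod (f x) - cmod (g x)"]
      mult_nonneg_nonneg[OF norm_ge_zero[of "f x"] norm_ge_zero[of "g x"]]
    unfolding norm_mult complex_mod_cnj power2_eq_square right_diff_distrib left_diff_distrib
      mult.commute[of "cmod (g x)" "cmod (f x)"] by linarith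
  have [measurable]: "cnj \<in> borel_measurable borel"
    by (intro borel_measurable_continuous_onI continuous_intros)
  have "integrable lborel (\<lambda>x. (cmod (f x))\<^sup>2 + (cmod (g x))\<^sup>2)"
    using assms by (auto simp: sq_integrable_def)
  then show ?thesis
    by (rule Bochner_Integration.integrable_bound) (use le in \<open>auto intro!: AE_I2\<close>)
qed

lift_definition l2_inner :: "'a::euclidean_space l2 \<Rightarrow> 'a l2 \<Rightarrow> complex"
  is "\<lambda>f g. \<integral>x. f x * cnj (g x) \<partial>lborel"
proof -
  fix f f' g g' :: "'a \<Rightarrow> complex"
  assume f: "l2_rel f f'" and g: "l2_rel g g'"
  have ae: "AE x in lborel. f x * cnj (g x) = f' x * cnj (g' x)"
    using f g unfolding l2_rel_def by (auto elim: AE_mp)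
  show "(\<integral>x. f x * cnj (g x) \<partial>lborel) = (\<integral>x. f' x * cnj (g' x) \<partial>lborel)"
    using f g ae
    by (intro integral_cong_AE borel_measurable_integrable integrable_mult_cnj)
       (auto simp: l2_rel_def)
qed

lift_definition scaleC_l2 :: "complex \<Rightarrow> 'a::euclidean_space l2 \<Rightarrow> 'a l2"
  is "\<lambda>c f x. c * f x"
  by (auto simp: l2_rel_def intro: sq_integrable_mult elim: AE_mp)

instantiation l2 :: (euclidean_space) real_inner
begin

lift_definition zero_l2 :: "'a l2" is "\<lambda>x. 0"
  by (simp add: l2_rel_def sq_integrable_zero)

lift_definition plus_l2 :: "'a l2 \<Rightarrow> 'a l2 \<Rightarrow> 'a l2" is "\<lambda>f g x. f x + g x"
  by (auto simp: l2_rel_def intro: sq_integrable_add elim: AE_mp)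

definition "scaleR r f = scaleC_l2 (complex_of_real r) f" for f :: "'a l2"

definition "- f = scaleC_l2 (-1) f" for f :: "'a l2"

definition "f - g = f + - g" for f g :: "'a l2"

definition "inner f g = Re (l2_inner f g)" for f g :: "'a l2"

definition "norm f = sqrt (inner f f)" for f :: "'a l2"

definition "sgn f = inverse (norm f) *\<^sub>R f" for f :: "'a l2"

definition "dist f g = norm (f - g)" for f g :: "'a l2"

definition [code del]:
  "(uniformity :: ('a l2 \<times> 'a l2) filter) = (INF e\<in>{0 <..}. principal {(f, g). dist f g < e})"

definition [code del]:
  "open (U :: 'a l2 set) \<longleftrightarrow> (\<forall>f\<in>U. eventually (\<lambda>(f', g). f' = f \<longrightarrow> g \<in> U) uniformity)"

instance
proof
  fix f g h :: "'a l2" and r s :: real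
  show "f + g + h = f + (g + h)"
    by transfer (auto simp: l2_rel_def add.assoc intro: sq_integrable_add)
  show "f + g = g + f"
    by transfer (auto simp: l2_rel_def add.commute intro: sq_integrable_add)
  show "0 + f = f"
    by transfer (auto simp: l2_rel_def)
  show "- f + f = 0"
    unfolding uminus_l2_def
    by transfer (auto simp: l2_rel_def intro: sq_integrable_zero)
  show "f - g = f + - g" by (fact minus_l2_def)
  show "r *\<^sub>R (f + g) = r *\<^sub>R f + r *\<^sub>R g"
    unfolding scaleR_l2_def
    by transfer (auto simp: l2_rel_def distrib_left intro!: sq_integrable_add sq_integrable_mult)
  show "(r + s) *\<^sub>R f = r *\<^sub>R f + s *\<^sub>R f"
    unfolding scaleR_l2_def
    by transfer (auto simp: l2_rel_def distrib_right intro!: sq_integrable_add sq_integrable_mult)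
  show "r *\<^sub>R s *\<^sub>R f = (r * s) *\<^sub>R f"
    unfolding scaleR_l2_def
    by transfer (auto simp: l2_rel_def mult.assoc intro!: sq_integrable_mult)
  show "1 *\<^sub>R f = f"
    unfolding scaleR_l2_def
    by transfer (auto simp: l2_rel_def)
  show "sgn f = inverse (norm f) *\<^sub>R f" by (fact sgn_l2_def)
  show "dist f g = norm (f - g)" by (fact dist_l2_def)
  show "(uniformity :: ('a l2 \<times> 'a l2) filter) = (INF e\<in>{0 <..}. principal {(f, g). dist f g < e})"
    by (fact uniformity_l2_def)
  show "open U \<longleftrightarrow> (\<forall>f\<in>U. eventually (\<lambda>(f', g). f' = f \<longrightarrow> g \<in> U) uniformity)"
    for U :: "'a l2 set"
    by (fact open_l2_def)
  have cnj: "l2_inner g f = cnj (l2_inner f g)"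
  proof (transfer)
    fix f g :: "'a \<Rightarrow> complex"
    have "cnj (\<integral>x. f x * cnj (g x) \<partial>lborel) = (\<integral>x. cnj (f x * cnj (g x)) \<partial>lborel)"
      by (simp only: Bochner_Integration.integral_cnj)
    also have "\<dots> = (\<integral>x. g x * cnj (f x) \<partial>lborel)"
      by (simp add: mult.commute)
    finally show "(\<integral>x. g x * cnj (f x) \<partial>lborel) = cnj (\<integral>x. f x * cnj (g x) \<partial>lborel)" ..
  qed
  show "inner f g = inner g f"
    unfolding inner_l2_def by (subst cnj) simp
  have "l2_inner (f + g) h = l2_inner f h + l2_inner g h"
    by transfer
       (auto simp: l2_rel_def distrib_right intro!: Bochner_Integration.integral_add integrable_mult_cnj)
  then show "inner (f + g) h = inner f h + inner g h"
    by (simp add: inner_l2_def)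
  have "l2_inner (scaleC_l2 (of_real r) f) g = of_real r * l2_inner f g"
    by transfer (simp add: mult.assoc)
  then show "inner (r *\<^sub>R f) g = r * inner f g"
    by (simp add: inner_l2_def scaleR_l2_def)
  have sq: "Re (\<integral>x. u x * cnj (u x) \<partial>lborel) = (\<integral>x. (cmod (u x))\<^sup>2 \<partial>lborel)"
    for u :: "'a \<Rightarrow> complex"
  proof -
    have "(\<integral>x. u x * cnj (u x) \<partial>lborel) = (\<integral>x. complex_of_real ((cmod (u x))\<^sup>2) \<partial>lborel)"
      by (simp only: complex_norm_square)
    then show ?thesis by (simp only: integral_complex_of_real Re_complex_of_real)
  qed
  show "0 \<le> inner f f"
    unfolding inner_l2_def by transfer (simp add: sq)
  show "inner f f = 0 \<longleftrightarrow> f = 0"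
    unfolding inner_l2_def
  proof transfer
    fix f :: "'a \<Rightarrow> complex"
    assume "l2_rel f f"
    then have f: "sq_integrable f" by (simp add: l2_rel_def)
    then have "(\<integral>x. (cmod (f x))\<^sup>2 \<partial>lborel) = 0 \<longleftrightarrow> (AE x in lborel. (cmod (f x))\<^sup>2 = 0)"
      by (intro integral_nonneg_eq_0_iff_AE) (auto simp: sq_integrable_def)
    then show "Re (\<integral>x. f x * cnj (f x) \<partial>lborel) = 0 \<longleftrightarrow> l2_rel f (\<lambda>x. 0)"
      using f by (simp add: sq l2_rel_def sq_integrable_zero)
  qed
  show "norm f = sqrt (inner f f)" by (fact norm_l2_def)
qed

end

text \<open>
  The space $L^2(\Omega)$ is identified, through extension by zero, with the subspace of those
  classes that vanish almost everywhere outside $\Omega$.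
\<close>

definition l2_on :: "'a::euclidean_space set \<Rightarrow> 'a l2 set" where
  "l2_on \<Omega> = {f. AE x in lborel. x \<notin> \<Omega> \<longrightarrow> rep_l2 f x = 0}"


section \<open>The Sobolev space $H^1_0$\<close>

fun n_times_cont_diff :: "nat \<Rightarrow> ('a::euclidean_space \<Rightarrow> complex) \<Rightarrow> bool" where
  "n_times_cont_diff 0 f \<longleftrightarrow> continuous_on UNIV f"
| "n_times_cont_diff (Suc k) f \<longleftrightarrow>
     (\<forall>x. f differentiable (at x)) \<and>
     (\<forall>b\<in>Basis. n_times_cont_diff k (\<lambda>x. frechet_derivative f (at x) b))"

text \<open>
  Test functions on \<open>\<Omega>\<close> are extended by zero; a function with compact support in an open
  \<open>\<Omega>\<close> is smooth on \<open>\<Omega>\<close> iff its extension is smooth everywhere.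
\<close>

definition test_functions :: "'a::euclidean_space set \<Rightarrow> ('a \<Rightarrow> complex) set" where
  "test_functions \<Omega> =
     {\<phi>. (\<forall>k. n_times_cont_diff k \<phi>) \<and> (\<exists>K. compact K \<and> K \<subseteq> \<Omega> \<and> (\<forall>x. x \<notin> K \<longrightarrow> \<phi> x = 0))}"

definition has_weak_partial ::
  "'a::euclidean_space set \<Rightarrow> 'a \<Rightarrow> 'a l2 \<Rightarrow> 'a l2 \<Rightarrow> bool" where
  "has_weak_partial \<Omega> b f g \<longleftrightarrow>
     (\<forall>\<phi>\<in>test_functions \<Omega>.
        (\<integral>x. rep_l2 f x * frechet_derivative \<phi> (at x) b \<partial>lborel) =
        - (\<integral>x. rep_l2 g x * \<phi> x \<partial>lborel))"

definition weak_partial :: "'a::euclidean_space set \<Rightarrow> 'a \<Rightarrow> 'a l2 \<Rightarrow> 'a l2" where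
  "weak_partial \<Omega> b f = (THE g. g \<in> l2_on \<Omega> \<and> has_weak_partial \<Omega> b f g)"

definition H1 :: "'a::euclidean_space set \<Rightarrow> 'a l2 set" where
  "H1 \<Omega> = {f \<in> l2_on \<Omega>. \<forall>b\<in>Basis. \<exists>g\<in>l2_on \<Omega>. has_weak_partial \<Omega> b f g}"

definition H1_inner :: "'a::euclidean_space set \<Rightarrow> 'a l2 \<Rightarrow> 'a l2 \<Rightarrow> complex" where
  "H1_inner \<Omega> f g =
     l2_inner f g + (\<Sum>b\<in>Basis. l2_inner (weak_partial \<Omega> b f) (weak_partial \<Omega> b g))"

definition H1_norm :: "'a::euclidean_space set \<Rightarrow> 'a l2 \<Rightarrow> real" where
  "H1_norm \<Omega> f = sqrt (Re (H1_inner \<Omega> f f))"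

definition H10 :: "'a::euclidean_space set \<Rightarrow> 'a l2 set" where
  "H10 \<Omega> = {f \<in> H1 \<Omega>. \<forall>e>0. \<exists>\<phi>\<in>test_functions \<Omega>. H1_norm \<Omega> (f - abs_l2 \<phi>) < e}"


section \<open>Bounded operators on a subspace\<close>

text \<open>
  Since \<open>H10 \<Omega>\<close> and \<open>l2_on \<Omega>\<close> depend on the term \<open>\<Omega>\<close>, they are subsets and not types.
  An operator on a subspace \<open>S\<close> with norm \<open>N\<close> is a map that sends \<open>S\<close> to \<open>S\<close> and, by convention,
  everything outside \<open>S\<close> to 0; two operators on \<open>S\<close> are then equal as soon as they agree on \<open>S\<close>.
\<close>

definition bounded_ops :: "'a::euclidean_space l2 set \<Rightarrow> ('a l2 \<Rightarrow> real) \<Rightarrow> ('a l2 \<Rightarrow> 'a l2) set" where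
  "bounded_ops S N =
     {T. (\<forall>f\<in>S. T f \<in> S) \<and> (\<forall>f. f \<notin> S \<longrightarrow> T f = 0) \<and>
         (\<forall>f\<in>S. \<forall>g\<in>S. T (f + g) = T f + T g) \<and>
         (\<forall>c. \<forall>f\<in>S. T (scaleC_l2 c f) = scaleC_l2 c (T f)) \<and>
         (\<exists>C. \<forall>f\<in>S. N (T f) \<le> C * N f)}"

definition id_op :: "'a::euclidean_space l2 set \<Rightarrow> 'a l2 \<Rightarrow> 'a l2" where
  "id_op S f = (if f \<in> S then f else 0)"

definition op_norm :: "'a::euclidean_space l2 set \<Rightarrow> ('a l2 \<Rightarrow> real) \<Rightarrow> ('a l2 \<Rightarrow> 'a l2) \<Rightarrow> real" where
  "op_norm S N T = (SUP f\<in>{f\<in>S. N f \<le> 1}. N (T f))"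

text \<open>The exponential is the sum of the exponential series in operator norm.\<close>

definition op_exp ::
  "'a::euclidean_space l2 set \<Rightarrow> ('a l2 \<Rightarrow> real) \<Rightarrow> ('a l2 \<Rightarrow> 'a l2) \<Rightarrow> 'a l2 \<Rightarrow> 'a l2" where
  "op_exp S N X =
     (THE E. E \<in> bounded_ops S N \<and>
        (\<lambda>n. op_norm S N (\<lambda>f. E f - (\<Sum>k<n. (X ^^ k) f /\<^sub>R fact k))) \<longlonglongrightarrow> 0)"

definition op_has_derivative_within ::
  "'a::euclidean_space l2 set \<Rightarrow> ('a l2 \<Rightarrow> real) \<Rightarrow> (real \<Rightarrow> 'a l2 \<Rightarrow> 'a l2) \<Rightarrow> ('a l2 \<Rightarrow> 'a l2)
    \<Rightarrow> real \<Rightarrow> real set \<Rightarrow> bool" where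
  "op_has_derivative_within S N \<gamma> V t I \<longleftrightarrow>
     V \<in> bounded_ops S N \<and>
     ((\<lambda>s. op_norm S N (\<lambda>f. (\<gamma> s f - \<gamma> t f) /\<^sub>R (s - t) - V f)) \<longlongrightarrow> 0) (at t within I)"


section \<open>The group, its Lie algebra, and lengths of curves\<close>

abbreviation H10_ops :: "'a::euclidean_space set \<Rightarrow> ('a l2 \<Rightarrow> 'a l2) set" where
  "H10_ops \<Omega> \<equiv> bounded_ops (H10 \<Omega>) (H1_norm \<Omega>)"

abbreviation H10_op_norm :: "'a::euclidean_space set \<Rightarrow> ('a l2 \<Rightarrow> 'a l2) \<Rightarrow> real" where
  "H10_op_norm \<Omega> \<equiv> op_norm (H10 \<Omega>) (H1_norm \<Omega>)"

abbreviation H10_exp :: "'a::euclidean_space set \<Rightarrow> ('a l2 \<Rightarrow> 'a l2) \<Rightarrow> 'a l2 \<Rightarrow> 'a l2" where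
  "H10_exp \<Omega> \<equiv> op_exp (H10 \<Omega>) (H1_norm \<Omega>)"

definition H10_Gl :: "'a::euclidean_space set \<Rightarrow> ('a l2 \<Rightarrow> 'a l2) set" where
  "H10_Gl \<Omega> = {G \<in> H10_ops \<Omega>. \<exists>G'\<in>H10_ops \<Omega>. G \<circ> G' = id_op (H10 \<Omega>) \<and> G' \<circ> G = id_op (H10 \<Omega>)}"

definition isom_group :: "'a::euclidean_space set \<Rightarrow> ('a l2 \<Rightarrow> 'a l2) set" where
  "isom_group \<Omega> =
     {G \<in> H10_Gl \<Omega>. \<forall>f\<in>H10 \<Omega>. \<forall>g\<in>H10 \<Omega>. l2_inner (G f) (G g) = l2_inner f g}"

definition isom_algebra :: "'a::euclidean_space set \<Rightarrow> ('a l2 \<Rightarrow> 'a l2) set" where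
  "isom_algebra \<Omega> =
     {X \<in> H10_ops \<Omega>. \<forall>f\<in>H10 \<Omega>. \<forall>g\<in>H10 \<Omega>. l2_inner (X f) g = - l2_inner f (X g)}"

definition l2_extension :: "'a::euclidean_space set \<Rightarrow> ('a l2 \<Rightarrow> 'a l2) \<Rightarrow> 'a l2 \<Rightarrow> 'a l2" where
  "l2_extension \<Omega> V = (THE W. W \<in> bounded_ops (l2_on \<Omega>) norm \<and> (\<forall>f\<in>H10 \<Omega>. W f = V f))"

definition l2_op_norm :: "'a::euclidean_space set \<Rightarrow> ('a l2 \<Rightarrow> 'a l2) \<Rightarrow> real" where
  "l2_op_norm \<Omega> V = op_norm (l2_on \<Omega>) norm (l2_extension \<Omega> V)"

text \<open>Curves are differentiable at every point, one-sidedly at the endpoints.\<close>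

definition curves_joining ::
  "'a::euclidean_space set \<Rightarrow> real \<Rightarrow> real \<Rightarrow> ('a l2 \<Rightarrow> 'a l2) \<Rightarrow> ('a l2 \<Rightarrow> 'a l2)
    \<Rightarrow> (real \<Rightarrow> 'a l2 \<Rightarrow> 'a l2) set" where
  "curves_joining \<Omega> a b G\<^sub>1 G\<^sub>2 =
     {\<gamma>. (\<forall>t\<in>{a..b}. \<gamma> t \<in> isom_group \<Omega> \<and>
            (\<exists>V. op_has_derivative_within (H10 \<Omega>) (H1_norm \<Omega>) \<gamma> V t {a..b})) \<and>
         \<gamma> a = G\<^sub>1 \<and> \<gamma> b = G\<^sub>2}"

definition velocity ::
  "'a::euclidean_space set \<Rightarrow> real \<Rightarrow> real \<Rightarrow> (real \<Rightarrow> 'a l2 \<Rightarrow> 'a l2) \<Rightarrow> real \<Rightarrow> 'a l2 \<Rightarrow> 'a l2" where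
  "velocity \<Omega> a b \<gamma> t = (THE V. op_has_derivative_within (H10 \<Omega>) (H1_norm \<Omega>) \<gamma> V t {a..b})"

text \<open>
  The speed of a curve that is merely differentiable need not be integrable; the length is
  therefore an extended nonnegative real.
\<close>

definition length2 ::
  "'a::euclidean_space set \<Rightarrow> real \<Rightarrow> real \<Rightarrow> (real \<Rightarrow> 'a l2 \<Rightarrow> 'a l2) \<Rightarrow> ennreal" where
  "length2 \<Omega> a b \<gamma> = (\<integral>\<^sup>+t\<in>{a..b}. ennreal (l2_op_norm \<Omega> (velocity \<Omega> a b \<gamma> t)) \<partial>lborel)"

definition dist2 ::
  "'a::euclidean_space set \<Rightarrow> ('a l2 \<Rightarrow> 'a l2) \<Rightarrow> ('a l2 \<Rightarrow> 'a l2) \<Rightarrow> ennreal" where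
  "dist2 \<Omega> G\<^sub>1 G\<^sub>2 = Inf {length2 \<Omega> a b \<gamma> | a b \<gamma>. a < b \<and> \<gamma> \<in> curves_joining \<Omega> a b G\<^sub>1 G\<^sub>2}"

end

theory Submission
  imports Defs "HOL-Complex_Analysis.Complex_Analysis"
begin

text \<open>
  The group acts on \<open>H = H\<^sup>1\<^sub>0(\<Omega>)\<close>, but the length of a curve is measured in \<open>L\<^sup>2\<close>, where the group consists
  of unitary operators. The minimal curve from \<open>1\<close> to \<open>G\<close> is \<open>t \<mapsto> e\<^sup>t\<^sup>X\<close> with \<open>X = log G\<close>. Two things have to be
  reconciled: the logarithm must be formed in the operators on \<open>H\<close>, where \<open>G\<close> is merely invertible, and its size must be
  controlled in \<open>L\<^sup>2\<close>.

  \<^emph>\<open>The logarithm.\<close> The hypothesis puts the spectrum of \<open>G\<close> in the disc \<open>|z - 1| \<le> 1\<close> without \<open>0\<close>, at the edge of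
  convergence of the logarithmic series at \<open>1\<close>. The parallelogram law of \<open>H\<close> turns this into
  \<open>\<parallel>G - 2\<parallel> < 2\<close> (\<open>half_minus_one_contraction\<close>). So \<open>G = 2 + 2 B\<close> with a strict contraction \<open>B\<close> of \<open>H\<close>, and
  \<open>h(B)\<close> is defined through its Taylor series for every \<open>h\<close> that is holomorphic on the unit disc. The assignment of
  \<open>h(B)\<close> to \<open>h\<close> is multiplicative and bounded by a multiple of the maximum of \<open>|h|\<close> on a smaller disc (\<open>calc_mult\<close>, \<open>calc_bound\<close>), which
  reduces all identities and limits to scalar ones. With \<open>h(z) = Ln (2 + 2 z)\<close> and \<open>h(z) = exp (t Ln (2 + 2 z))\<close> it
  yields \<open>X\<close> and the flow \<open>e\<^sup>t\<^sup>X\<close> on \<open>H\<close>.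

  \<^emph>\<open>From \<open>H\<close> to \<open>L\<^sup>2\<close>.\<close> An operator with \<open>\<parallel>T f\<parallel>\<^sup>2 \<le> \<parallel>T\<^sup>2 f\<parallel> \<parallel>f\<parallel>\<close> in \<open>L\<^sup>2\<close>, in particular a normal or antisymmetric one, is
  bounded in \<open>L\<^sup>2\<close> by its growth rate in \<open>H\<close> (\<open>norm_le_growth_rate\<close>). As \<open>G\<^sup>-\<^sup>1\<close> is the \<open>L\<^sup>2\<close> adjoint of \<open>G\<close> and again
  acts on \<open>H\<close>, all the \<open>h(B)\<close> are normal in this sense (\<open>calc_normal\<close>). The flow passes through the isometries \<open>G\<^sup>n\<close> and
  therefore stays bounded, so its growth rate is at most \<open>1\<close> and it is isometric (\<open>norm_flow\<close>), and differentiation gives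
  \<open>X\<close> in the Lie algebra. The same principle makes the velocities of all curves in the group bounded in \<open>L\<^sup>2\<close>
  (\<open>velocity_properties\<close>).

  \<^emph>\<open>Minimality.\<close> Let \<open>\<theta>\<close> be the \<open>L\<^sup>2\<close> norm of \<open>X\<close>, which may be assumed positive. As \<open>X\<close> is antisymmetric, there are unit vectors \<open>v\<close> in \<open>H\<close> for which
  \<open>X v\<close> is as close as desired to \<open>a v\<close>, where \<open>a = i\<theta>\<close> or \<open>a = - i\<theta>\<close>. By spectral mapping \<open>a\<close> is a value of
  \<open>Ln (2 + 2 z)\<close> on the disc, so \<open>\<theta> < \<pi>\<close>, and \<open>G v\<close> is close to \<open>e\<^sup>a v\<close> (\<open>generator_norm_attained\<close>).
  For any curve \<open>\<gamma>\<close> from \<open>1\<close> to \<open>G\<close> the path \<open>\<gamma>(t) v\<close> on the unit sphere of \<open>L\<^sup>2\<close> joins \<open>v\<close> to \<open>G v\<close>, so the length of \<open>\<gamma>\<close>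
  is at least the angle between them (\<open>angle_le_length\<close>), which tends to \<open>\<theta>\<close>. The flow itself has the constant
  speed \<open>\<theta>\<close>.

  All this rests on three facts of analysis: \<open>L\<^sup>2\<close> and \<open>H\<close> are complete, test functions are dense
  in \<open>L\<^sup>2(\<Omega>)\<close>, and test functions can be integrated by parts. Density makes weak derivatives and the extensions from \<open>H\<close> to
  \<open>L\<^sup>2(\<Omega>)\<close> unique.
\<close>

section \<open>The Hilbert space of square integrable classes\<close>

lemma l2_rel_rep: "l2_rel (rep_l2 f) (rep_l2 f)"
  by (rule Quotient3_rep_reflp[OF Quotient3_l2])

lemma sq_integrable_rep: "sq_integrable (rep_l2 f)"
  using l2_rel_rep[of f] by (simp add: l2_rel_def)

lemma borel_measurable_rep [measurable]: "rep_l2 f \<in> borel_measurable borel"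
  using sq_integrable_rep[of f] by (simp add: sq_integrable_def)

lemma integrable_rep: "integrable lborel (\<lambda>x. (cmod (rep_l2 f x))\<^sup>2)"
  using sq_integrable_rep[of f] by (simp add: sq_integrable_def)

lemma abs_rep_l2 [simp]: "abs_l2 (rep_l2 f) = f"
  by (rule Quotient3_abs_rep[OF Quotient3_l2])

lemma abs_l2_eqI:
  assumes "sq_integrable u" "sq_integrable v" "AE x in lborel. u x = v x"
  shows "abs_l2 u = abs_l2 v"
  by (rule Quotient3_rel_abs[OF Quotient3_l2]) (use assms in \<open>simp add: l2_rel_def\<close>)

lemma rep_abs_AE:
  assumes "sq_integrable u"
  shows "AE x in lborel. rep_l2 (abs_l2 u) x = u x"
proof -
  have "l2_rel (rep_l2 (abs_l2 u)) u"
    using assms by (intro rep_abs_rsp_left[OF Quotient3_l2]) (simp add: l2_rel_def)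
  then show ?thesis by (simp add: l2_rel_def)
qed

lemma rep_add_AE: "AE x in lborel. rep_l2 (f + g) x = rep_l2 f x + rep_l2 g x"
proof -
  have "f + g = abs_l2 (\<lambda>x. rep_l2 f x + rep_l2 g x)"
    using plus_l2.abs_eq[OF l2_rel_rep l2_rel_rep, of f g] by simp
  then show ?thesis
    using rep_abs_AE[OF sq_integrable_add[OF sq_integrable_rep sq_integrable_rep], of f g] by simp
qed

lemma rep_scaleC_AE: "AE x in lborel. rep_l2 (scaleC_l2 c f) x = c * rep_l2 f x"
proof -
  have "scaleC_l2 c f = abs_l2 (\<lambda>x. c * rep_l2 f x)"
    using scaleC_l2.abs_eq[OF l2_rel_rep, of c f] by simp
  then show ?thesis
    using rep_abs_AE[OF sq_integrable_mult[OF sq_integrable_rep], of c f] by simp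
qed

lemma rep_zero_AE: "AE x in lborel. rep_l2 0 x = 0"
  using rep_abs_AE[OF sq_integrable_zero] by (simp add: zero_l2_def)

lemma rep_diff_AE: "AE x in lborel. rep_l2 (f - g) x = rep_l2 f x - rep_l2 g x"
  using rep_add_AE[of f "-g"] rep_scaleC_AE[of "-1" g] unfolding minus_l2_def uminus_l2_def
  by eventually_elim simp

lemma l2_inner_rep: "l2_inner f g = (\<integral>x. rep_l2 f x * cnj (rep_l2 g x) \<partial>lborel)"
  by (simp add: l2_inner.rep_eq)

lemma l2_inner_abs:
  assumes "sq_integrable u" "sq_integrable v"
  shows "l2_inner (abs_l2 u) (abs_l2 v) = (\<integral>x. u x * cnj (v x) \<partial>lborel)"
  using assms by (intro l2_inner.abs_eq) (auto simp: l2_rel_def)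

lemma scaleC_l2_one [simp]: "scaleC_l2 1 f = f"
  by transfer (auto simp: l2_rel_def)

lemma scaleC_l2_scaleC_l2 [simp]: "scaleC_l2 c (scaleC_l2 d f) = scaleC_l2 (c * d) f"
  by transfer (auto simp: l2_rel_def mult.assoc intro!: sq_integrable_mult)

lemma scaleC_l2_add_right: "scaleC_l2 c (f + g) = scaleC_l2 c f + scaleC_l2 c g"
  by transfer (auto simp: l2_rel_def distrib_left intro!: sq_integrable_add sq_integrable_mult)

lemma scaleC_l2_add_left: "scaleC_l2 (c + d) f = scaleC_l2 c f + scaleC_l2 d f"
  by transfer (auto simp: l2_rel_def distrib_right intro!: sq_integrable_add sq_integrable_mult)

lemma scaleC_l2_of_real: "scaleC_l2 (complex_of_real r) f = r *\<^sub>R f"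
  by (simp add: scaleR_l2_def)

lemma scaleC_l2_zero_left [simp]: "scaleC_l2 0 f = 0"
  using scaleC_l2_of_real[of 0 f] by simp

lemma scaleC_l2_zero_right [simp]: "scaleC_l2 c 0 = 0"
  using scaleC_l2_scaleC_l2[of c 0 "0"] by simp

lemma scaleC_l2_minus_left: "scaleC_l2 (- c) f = - scaleC_l2 c f"
  by (simp add: uminus_l2_def)

lemma scaleC_l2_minus_right: "scaleC_l2 c (- f) = - scaleC_l2 c f"
  by (simp add: uminus_l2_def)

lemma scaleC_l2_diff_right: "scaleC_l2 c (f - g) = scaleC_l2 c f - scaleC_l2 c g"
  using scaleC_l2_add_right[of c f "-g"] by (simp add: scaleC_l2_minus_right)

lemma scaleC_l2_sum_right: "scaleC_l2 c (\<Sum>i\<in>I. f i) = (\<Sum>i\<in>I. scaleC_l2 c (f i))"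
  by (induction I rule: infinite_finite_induct) (auto simp: scaleC_l2_add_right)

lemma l2_inner_commute: "l2_inner g f = cnj (l2_inner f g)"
proof -
  have "cnj (\<integral>x. rep_l2 f x * cnj (rep_l2 g x) \<partial>lborel) = (\<integral>x. cnj (rep_l2 f x * cnj (rep_l2 g x)) \<partial>lborel)"
    by (simp only: Bochner_Integration.integral_cnj)
  then show ?thesis by (simp add: l2_inner_rep mult.commute)
qed

lemma l2_inner_add_left: "l2_inner (f + g) h = l2_inner f h + l2_inner g h"
  by transfer
     (auto simp: l2_rel_def distrib_right intro!: Bochner_Integration.integral_add integrable_mult_cnj)

lemma l2_inner_scaleC_left: "l2_inner (scaleC_l2 c f) g = c * l2_inner f g"
  by transfer (simp add: mult.assoc)

lemma l2_inner_add_right: "l2_inner h (f + g) = l2_inner h f + l2_inner h g"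
  by (subst (1 2 3) l2_inner_commute) (simp add: l2_inner_add_left)

lemma l2_inner_scaleC_right: "l2_inner f (scaleC_l2 c g) = cnj c * l2_inner f g"
  by (subst (1 2) l2_inner_commute) (simp add: l2_inner_scaleC_left)

lemma l2_inner_minus_left: "l2_inner (- f) g = - l2_inner f g"
  by (simp add: uminus_l2_def l2_inner_scaleC_left)

lemma l2_inner_minus_right: "l2_inner f (- g) = - l2_inner f g"
  by (simp add: uminus_l2_def l2_inner_scaleC_right)

lemma l2_inner_diff_left: "l2_inner (f - g) h = l2_inner f h - l2_inner g h"
  using l2_inner_add_left[of f "-g" h] by (simp add: l2_inner_minus_left)

lemma l2_inner_diff_right: "l2_inner h (f - g) = l2_inner h f - l2_inner h g"
  using l2_inner_add_right[of h f "-g"] by (simp add: l2_inner_minus_right)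

lemma l2_inner_zero_left [simp]: "l2_inner 0 f = 0"
  using l2_inner_scaleC_left[of 0 0 f] by simp

lemma l2_inner_zero_right [simp]: "l2_inner f 0 = 0"
  using l2_inner_scaleC_right[of f 0 0] by simp

lemma l2_inner_sum_left: "l2_inner (\<Sum>i\<in>I. f i) g = (\<Sum>i\<in>I. l2_inner (f i) g)"
  by (induction I rule: infinite_finite_induct) (auto simp: l2_inner_add_left)

lemma l2_inner_sum_right: "l2_inner g (\<Sum>i\<in>I. f i) = (\<Sum>i\<in>I. l2_inner g (f i))"
  by (induction I rule: infinite_finite_induct) (auto simp: l2_inner_add_right)

lemma l2_inner_self: "l2_inner f f = complex_of_real ((norm f)\<^sup>2)"
proof (rule complex_eqI)
  show "Re (l2_inner f f) = Re (complex_of_real ((norm f)\<^sup>2))"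
    by (simp add: power2_norm_eq_inner flip: inner_l2_def)
  show "Im (l2_inner f f) = Im (complex_of_real ((norm f)\<^sup>2))"
    using l2_inner_commute[of f f] by (simp add: complex_eq_iff)
qed

lemma norm_l2_eq_integral: "(norm f)\<^sup>2 = (\<integral>x. (cmod (rep_l2 f x))\<^sup>2 \<partial>lborel)"
proof -
  have "complex_of_real ((norm f)\<^sup>2) = (\<integral>x. complex_of_real ((cmod (rep_l2 f x))\<^sup>2) \<partial>lborel)"
    by (simp only: l2_inner_self[symmetric] l2_inner_rep complex_norm_square)
  then show ?thesis by (simp only: integral_complex_of_real of_real_eq_iff)
qed

lemma norm_abs_l2:
  assumes "sq_integrable u"
  shows "(norm (abs_l2 u))\<^sup>2 = (\<integral>x. (cmod (u x))\<^sup>2 \<partial>lborel)"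
proof -
  have "complex_of_real ((norm (abs_l2 u))\<^sup>2) = (\<integral>x. complex_of_real ((cmod (u x))\<^sup>2) \<partial>lborel)"
    by (simp only: l2_inner_self[symmetric] l2_inner_abs[OF assms assms] complex_norm_square)
  then show ?thesis by (simp only: integral_complex_of_real of_real_eq_iff)
qed

lemma norm_scaleC_l2: "norm (scaleC_l2 c f) = cmod c * norm f"
proof -
  have "complex_of_real ((norm (scaleC_l2 c f))\<^sup>2) = complex_of_real ((cmod c * norm f)\<^sup>2)"
    by (simp only: l2_inner_self[symmetric] l2_inner_scaleC_left l2_inner_scaleC_right)
       (simp add: l2_inner_self power_mult_distrib complex_norm_square del: of_real_power)
  then have "(norm (scaleC_l2 c f))\<^sup>2 = (cmod c * norm f)\<^sup>2" by (simp only: of_real_eq_iff)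
  then show ?thesis by (simp add: power2_eq_iff_nonneg)
qed

lemma Im_l2_inner: "Im (l2_inner f g) = inner f (scaleC_l2 \<i> g)"
  by (simp add: inner_l2_def l2_inner_scaleC_right)

lemma l2_Cauchy_Schwarz: "cmod (l2_inner f g) \<le> norm f * norm g"
proof (cases "l2_inner f g = 0")
  case False
  define z where "z = l2_inner f g"
  \<comment> \<open>Rotate \<open>f\<close> so that the product becomes real and nonnegative.\<close>
  have "cmod z * cmod z = Re (cnj z * z)"
    using cmod_power2[of z] by (simp add: power2_eq_square)
  also have "\<dots> = inner (scaleC_l2 (cnj z) f) g"
    by (simp add: inner_l2_def l2_inner_scaleC_left z_def)
  also have "\<dots> \<le> cmod z * norm f * norm g"
    using norm_cauchy_schwarz[of "scaleC_l2 (cnj z) f" g] by (simp add: norm_scaleC_l2)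
  finally show ?thesis
    using False by (simp add: z_def mult.assoc)
qed simp

lemma bounded_linear_scaleC_l2: "bounded_linear (scaleC_l2 c)"
  by (rule bounded_linear_intro[of _ "cmod c"])
     (auto simp: scaleC_l2_add_right norm_scaleC_l2 mult.commute simp flip: scaleC_l2_of_real)

text \<open>Both parts of the complex inner product are real inner products, which are continuous.\<close>

lemma tendsto_l2_inner:
  assumes "(f \<longlongrightarrow> a) F" "(g \<longlongrightarrow> b) F"
  shows "((\<lambda>x. l2_inner (f x) (g x)) \<longlongrightarrow> l2_inner a b) F"
proof -
  have "l2_inner u v = Complex (inner u v) (inner u (scaleC_l2 \<i> v))" for u v :: "'b::euclidean_space l2"
    by (simp add: complex_eq_iff Im_l2_inner flip: inner_l2_def)
  then show ?thesis
    by (auto intro!: tendsto_intros assms bounded_linear.tendsto[OF bounded_linear_scaleC_l2])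
qed

text \<open>
  The theorem of Riesz and Fischer for a rapidly converging subsequence. As \<open>\<parallel>u\<^sub>k\<^sub>+\<^sub>1 - u\<^sub>k\<parallel>\<^sup>2 \<le> 8\<^sup>-\<^sup>k\<close>,
  the function \<open>\<Sum>k. 4\<^sup>k |u\<^sub>k\<^sub>+\<^sub>1 - u\<^sub>k|\<^sup>2\<close> has a finite integral, so almost everywhere the increments are
  \<open>O(2\<^sup>-\<^sup>k)\<close> and the \<open>u\<^sub>k\<close> converge. Fatou's lemma turns pointwise convergence into
  convergence in norm.
\<close>

lemma l2_rapid_Cauchy_convergent:
  fixes X :: "nat \<Rightarrow> 'a::euclidean_space l2"
  assumes rapid: "\<And>k m n. k \<le> m \<Longrightarrow> k \<le> n \<Longrightarrow> (norm (X m - X n))\<^sup>2 \<le> (1/8)^k"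
  shows "\<exists>L. X \<longlonglongrightarrow> L"
proof -
  define u where "u k = rep_l2 (X k)" for k
  have [measurable]: "u k \<in> borel_measurable borel" for k by (simp add: u_def)
  have sq_u: "sq_integrable (u k)" for k by (simp add: u_def sq_integrable_rep)
  have sq_diff: "sq_integrable (\<lambda>x. u m x - u n x)" for m n
    using sq_integrable_add[OF sq_u[of m] sq_integrable_mult[OF sq_u[of n], of "-1"]] by simp
  have nn: "(\<integral>\<^sup>+x. ennreal ((cmod (u m x - u n x))\<^sup>2) \<partial>lborel) = ennreal ((norm (X m - X n))\<^sup>2)" for m n
  proof -
    have "(norm (X m - X n))\<^sup>2 = (\<integral>x. (cmod (rep_l2 (X m - X n) x))\<^sup>2 \<partial>lborel)"
      by (rule norm_l2_eq_integral)
    also have "\<dots> = (\<integral>x. (cmod (u m x - u n x))\<^sup>2 \<partial>lborel)"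
      using rep_diff_AE[of "X m" "X n"] by (intro integral_cong_AE) (auto simp: u_def)
    finally show ?thesis
      using sq_diff[of m n] by (subst nn_integral_eq_integral) (auto simp: sq_integrable_def)
  qed
  have "(\<integral>\<^sup>+x. (\<Sum>k. ennreal (4^k) * ennreal ((cmod (u (Suc k) x - u k x))\<^sup>2)) \<partial>lborel)
      = (\<Sum>k. ennreal (4^k) * ennreal ((norm (X (Suc k) - X k))\<^sup>2))"
    by (subst nn_integral_suminf) (auto simp: nn_integral_cmult nn)
  also have "\<dots> \<le> (\<Sum>k. ennreal ((1/2)^k))"
  proof (intro suminf_le)
    fix k
    have "4^k * (norm (X (Suc k) - X k))\<^sup>2 \<le> 4^k * (1/8)^k"
      by (intro mult_left_mono rapid) auto
    also have "\<dots> = (1/2::real)^k" by (simp flip: power_mult_distrib)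
    finally show "ennreal (4^k) * ennreal ((norm (X (Suc k) - X k))\<^sup>2) \<le> ennreal ((1/2)^k)"
      by (simp add: ennreal_leI flip: ennreal_mult)
  qed auto
  also have "\<dots> = ennreal (\<Sum>k. (1/2)^k)"
    by (intro suminf_ennreal2) (auto intro: summable_geometric)
  finally have "(\<integral>\<^sup>+x. (\<Sum>k. ennreal (4^k) * ennreal ((cmod (u (Suc k) x - u k x))\<^sup>2)) \<partial>lborel) \<noteq> \<infinity>"
    by (auto simp: top_unique)
  then have fin: "AE x in lborel. (\<Sum>k. ennreal (4^k) * ennreal ((cmod (u (Suc k) x - u k x))\<^sup>2)) \<noteq> \<infinity>"
    by (intro nn_integral_PInf_AE) auto
  have conv: "AE x in lborel. convergent (\<lambda>k. u k x)"
    using fin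
  proof eventually_elim
    case (elim x)
    define C where "C = enn2real (\<Sum>k. ennreal (4^k) * ennreal ((cmod (u (Suc k) x - u k x))\<^sup>2))"
    have bound: "4^k * (cmod (u (Suc k) x - u k x))\<^sup>2 \<le> C" for k
    proof -
      have "ennreal (4^k * (cmod (u (Suc k) x - u k x))\<^sup>2)
          \<le> (\<Sum>k. ennreal (4^k) * ennreal ((cmod (u (Suc k) x - u k x))\<^sup>2))"
        using sum_le_suminf[of "\<lambda>k. ennreal (4^k) * ennreal ((cmod (u (Suc k) x - u k x))\<^sup>2)" "{k}"]
        by (simp add: ennreal_mult)
      also have "\<dots> = ennreal C"
        using elim by (simp add: C_def less_top)
      finally show ?thesis
        by (subst (asm) ennreal_le_iff) (auto simp: C_def)
    qed
    have decay: "cmod (u (Suc k) x - u k x) \<le> sqrt C * (1/2)^k" for k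
    proof -
      have "(2^k * cmod (u (Suc k) x - u k x))\<^sup>2 \<le> C"
        using bound[of k] by (simp add: power_mult_distrib power2_eq_square[of "2^k"] flip: power_mult_distrib[of 2 2])
      then have "2^k * cmod (u (Suc k) x - u k x) \<le> sqrt C"
        by (rule real_le_rsqrt)
      then show ?thesis by (simp add: field_simps)
    qed
    have "summable (\<lambda>k. sqrt C * (1/2)^k)"
      by (intro summable_mult summable_geometric) auto
    then have "summable (\<lambda>k. u (Suc k) x - u k x)"
      by (rule summable_comparison_test') (rule decay)
    then show ?case by (simp add: summable_iff_convergent sum_lessThan_telescope[of "\<lambda>k. u k x"] convergent_diff_const_right_iff)
  qed
  define v where "v x = lim (\<lambda>k. u k x)" for x
  have [measurable]: "v \<in> borel_measurable borel"
    unfolding v_def by measurable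
  have lim_v: "AE x in lborel. (\<lambda>k. u k x) \<longlonglongrightarrow> v x"
    using conv by eventually_elim (simp add: v_def convergent_LIMSEQ_iff)
  have fatou: "(\<integral>\<^sup>+x. ennreal ((cmod (u k x - v x))\<^sup>2) \<partial>lborel) \<le> ennreal ((1/8)^k)" for k
  proof -
    have "(\<integral>\<^sup>+x. ennreal ((cmod (u k x - v x))\<^sup>2) \<partial>lborel)
        = (\<integral>\<^sup>+x. liminf (\<lambda>j. ennreal ((cmod (u k x - u j x))\<^sup>2)) \<partial>lborel)"
    proof (rule nn_integral_cong_AE)
      show "AE x in lborel. ennreal ((cmod (u k x - v x))\<^sup>2) = liminf (\<lambda>j. ennreal ((cmod (u k x - u j x))\<^sup>2))"
        using lim_v
      proof eventually_elim
        case (elim x)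
        then have "(\<lambda>j. ennreal ((cmod (u k x - u j x))\<^sup>2)) \<longlonglongrightarrow> ennreal ((cmod (u k x - v x))\<^sup>2)"
          by (intro tendsto_intros)
        then show ?case by (intro lim_imp_Liminf[symmetric]) auto
      qed
    qed
    also have "\<dots> \<le> liminf (\<lambda>j. (\<integral>\<^sup>+x. ennreal ((cmod (u k x - u j x))\<^sup>2) \<partial>lborel))"
      by (intro nn_integral_liminf) auto
    also have "\<dots> \<le> ennreal ((1/8)^k)"
    proof (rule Liminf_le)
      show "\<forall>\<^sub>F j in sequentially. (\<integral>\<^sup>+x. ennreal ((cmod (u k x - u j x))\<^sup>2) \<partial>lborel) \<le> ennreal ((1/8)^k)"
        using eventually_ge_at_top[of k] by eventually_elim (auto simp: nn intro!: ennreal_leI rapid)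
    qed auto
    finally show ?thesis .
  qed
  have sq_uv: "sq_integrable (\<lambda>x. u k x - v x)" for k
    unfolding sq_integrable_def
  proof
    show "integrable lborel (\<lambda>x. (cmod (u k x - v x))\<^sup>2)"
      by (rule integrableI_bounded) (use fatou[of k] in \<open>auto simp: less_top[symmetric] top_unique\<close>)
  qed measurable
  have sq_v: "sq_integrable v"
    using sq_integrable_add[OF sq_u[of 0] sq_integrable_mult[OF sq_uv[of 0], of "-1"]] by simp
  have dist: "(norm (X k - abs_l2 v))\<^sup>2 \<le> (1/8)^k" for k
  proof -
    have "(norm (X k - abs_l2 v))\<^sup>2 = (\<integral>x. (cmod (rep_l2 (X k - abs_l2 v) x))\<^sup>2 \<partial>lborel)"
      by (rule norm_l2_eq_integral)
    also have "\<dots> = (\<integral>x. (cmod (u k x - v x))\<^sup>2 \<partial>lborel)"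
    proof (rule integral_cong_AE)
      show "AE x in lborel. (cmod (rep_l2 (X k - abs_l2 v) x))\<^sup>2 = (cmod (u k x - v x))\<^sup>2"
        using rep_diff_AE[of "X k" "abs_l2 v"] rep_abs_AE[OF sq_v]
        by eventually_elim (simp add: u_def)
    qed auto
    finally have "ennreal ((norm (X k - abs_l2 v))\<^sup>2) = (\<integral>\<^sup>+x. ennreal ((cmod (u k x - v x))\<^sup>2) \<partial>lborel)"
      using sq_uv[of k] by (subst nn_integral_eq_integral) (auto simp: sq_integrable_def)
    then have "ennreal ((norm (X k - abs_l2 v))\<^sup>2) \<le> ennreal ((1/8)^k)"
      using fatou[of k] by simp
    then show ?thesis
      by (subst (asm) ennreal_le_iff) auto
  qed
  have "(\<lambda>k. (norm (X k - abs_l2 v))\<^sup>2) \<longlonglongrightarrow> 0"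
    by (rule tendsto_sandwich[OF _ always_eventually[OF allI[OF dist]] tendsto_const LIMSEQ_power_zero]) auto
  then have "(\<lambda>k. norm (X k - abs_l2 v)) \<longlonglongrightarrow> 0"
    using tendsto_real_sqrt by fastforce
  then show ?thesis
    by (auto simp: tendsto_norm_zero_iff LIM_zero_iff)
qed

instance l2 :: (euclidean_space) complete_space
proof
  fix X :: "nat \<Rightarrow> 'a l2"
  assume X: "Cauchy X"
  have "\<exists>N. \<forall>m\<ge>N. \<forall>n\<ge>N. norm (X m - X n) < sqrt ((1/8)^k)" for k
    using X by (auto simp: Cauchy_def dist_norm)
  then obtain N where N: "\<And>k m n. N k \<le> m \<Longrightarrow> N k \<le> n \<Longrightarrow> norm (X m - X n) < sqrt ((1/8)^k)"
    by metis
  define r where "r k = (\<Sum>i\<le>k. N i) + k" for k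
  have r_ge: "N k \<le> r m" if "k \<le> m" for k m
    using member_le_sum[of k "{..m}" N] that by (simp add: r_def)
  have r: "strict_mono r"
    by (rule strict_monoI_Suc) (simp add: r_def)
  have "(norm ((X \<circ> r) m - (X \<circ> r) n))\<^sup>2 \<le> (1/8)^k" if "k \<le> m" "k \<le> n" for k m n
    using power_mono[OF less_imp_le[OF N[OF r_ge[OF that(1)] r_ge[OF that(2)]]], of 2] by simp
  then have "\<exists>L. (X \<circ> r) \<longlonglongrightarrow> L"
    by (intro l2_rapid_Cauchy_convergent)
  then obtain L where "(X \<circ> r) \<longlonglongrightarrow> L" by blast
  then show "convergent X"
    using X r Cauchy_converges_subseq convergentI by blast
qed

instance l2 :: (euclidean_space) banach ..

text \<open>Restriction to the complement of \<open>\<Omega>\<close> is a contraction, so its kernel is closed.\<close>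

lemma closed_l2_on:
  fixes \<Omega> :: "'a::euclidean_space set"
  assumes "\<Omega> \<in> sets borel"
  shows "closed (l2_on \<Omega>)"
  unfolding closed_sequential_limits
proof (intro allI impI)
  fix X :: "nat \<Rightarrow> 'a l2" and L
  assume "(\<forall>n. X n \<in> l2_on \<Omega>) \<and> X \<longlonglongrightarrow> L"
  then have X: "\<And>n. X n \<in> l2_on \<Omega>" "X \<longlonglongrightarrow> L" by auto
  have [measurable]: "\<Omega> \<in> sets borel" by fact
  let ?out = "\<lambda>x. indicator (- \<Omega>) x * (cmod (rep_l2 L x))\<^sup>2"
  have int: "integrable lborel ?out"
    using integrable_rep[of L] by (rule Bochner_Integration.integrable_bound) (auto simp: indicator_def)
  have le: "(\<integral>x. ?out x \<partial>lborel) \<le> (norm (X n - L))\<^sup>2" for n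
  proof -
    have "AE x in lborel. x \<notin> \<Omega> \<longrightarrow> rep_l2 (X n) x = 0"
      using X(1)[of n] by (simp add: l2_on_def)
    then have "AE x in lborel. ?out x \<le> (cmod (rep_l2 (X n - L) x))\<^sup>2"
      using rep_diff_AE[of "X n" L] by eventually_elim (auto simp: indicator_def)
    then show ?thesis
      unfolding norm_l2_eq_integral using int integrable_rep by (intro integral_mono_AE)
  qed
  have "(\<lambda>n. (norm (X n - L))\<^sup>2) \<longlonglongrightarrow> 0\<^sup>2"
    using X(2) by (intro tendsto_power tendsto_norm_zero LIM_zero)
  then have "(\<integral>x. ?out x \<partial>lborel) \<le> 0\<^sup>2"
    using le by (rule LIMSEQ_le_const[OF _ exI, OF _ allI[OF impI]])
  then have "(\<integral>x. ?out x \<partial>lborel) \<le> 0" by simp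
  then have "(\<integral>x. ?out x \<partial>lborel) = 0"
    by (intro antisym integral_nonneg_AE) auto
  then have "AE x in lborel. ?out x = 0"
    using int by (subst (asm) integral_nonneg_eq_0_iff_AE) auto
  then have "AE x in lborel. x \<notin> \<Omega> \<longrightarrow> rep_l2 L x = 0"
    by eventually_elim auto
  then show "L \<in> l2_on \<Omega>" by (simp add: l2_on_def)
qed

lemma l2_on_zero: "0 \<in> l2_on \<Omega>"
  using rep_zero_AE by (auto simp: l2_on_def)

lemma l2_on_add: "f \<in> l2_on \<Omega> \<Longrightarrow> g \<in> l2_on \<Omega> \<Longrightarrow> f + g \<in> l2_on \<Omega>"
  unfolding l2_on_def mem_Collect_eq
proof -
  assume "AE x in lborel. x \<notin> \<Omega> \<longrightarrow> rep_l2 f x = 0" "AE x in lborel. x \<notin> \<Omega> \<longrightarrow> rep_l2 g x = 0"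
  then show "AE x in lborel. x \<notin> \<Omega> \<longrightarrow> rep_l2 (f + g) x = 0"
    using rep_add_AE[of f g] by eventually_elim simp
qed

lemma l2_on_scaleC: "f \<in> l2_on \<Omega> \<Longrightarrow> scaleC_l2 c f \<in> l2_on \<Omega>"
  unfolding l2_on_def mem_Collect_eq
proof -
  assume "AE x in lborel. x \<notin> \<Omega> \<longrightarrow> rep_l2 f x = 0"
  then show "AE x in lborel. x \<notin> \<Omega> \<longrightarrow> rep_l2 (scaleC_l2 c f) x = 0"
    using rep_scaleC_AE[of c f] by eventually_elim simp
qed

section \<open>Smooth functions\<close>

lemma n_times_cont_diff_SucD: "n_times_cont_diff (Suc k) f \<Longrightarrow> n_times_cont_diff k f"
proof (induction k arbitrary: f)
  case 0
  then show ?case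
    by (auto intro!: continuous_at_imp_continuous_on differentiable_imp_continuous_within)
next
  case (Suc k)
  then show ?case
    unfolding n_times_cont_diff.simps(2)[of "Suc k"] n_times_cont_diff.simps(2)[of k f] by blast
qed

lemma n_times_cont_diff_const: "n_times_cont_diff k (\<lambda>x. c)"
  by (induction k arbitrary: c) (auto simp: frechet_derivative_const)

lemma frechet_derivative_add':
  fixes f g :: "'a::euclidean_space \<Rightarrow> complex"
  assumes "f differentiable (at x)" "g differentiable (at x)"
  shows "frechet_derivative (\<lambda>x. f x + g x) (at x) b =
         frechet_derivative f (at x) b + frechet_derivative g (at x) b"
proof -
  have "((\<lambda>x. f x + g x) has_derivative
      (\<lambda>h. frechet_derivative f (at x) h + frechet_derivative g (at x) h)) (at x)"
    using assms by (intro has_derivative_add) (auto simp: frechet_derivative_works)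
  from fun_cong[OF frechet_derivative_at[OF this], of b] show ?thesis by simp
qed

lemma frechet_derivative_mult':
  fixes f g :: "'a::euclidean_space \<Rightarrow> complex"
  assumes "f differentiable (at x)" "g differentiable (at x)"
  shows "frechet_derivative (\<lambda>x. f x * g x) (at x) b =
         f x * frechet_derivative g (at x) b + frechet_derivative f (at x) b * g x"
proof -
  have "((\<lambda>x. f x * g x) has_derivative
      (\<lambda>h. f x * frechet_derivative g (at x) h + frechet_derivative f (at x) h * g x)) (at x)"
    using assms by (intro has_derivative_mult) (auto simp: frechet_derivative_works)
  from fun_cong[OF frechet_derivative_at[OF this], of b] show ?thesis by simp
qed

lemma frechet_derivative_cnj:
  fixes f :: "'a::euclidean_space \<Rightarrow> complex"
  assumes "f differentiable (at x)"
  shows "frechet_derivative (\<lambda>x. cnj (f x)) (at x) b = cnj (frechet_derivative f (at x) b)"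
proof -
  have "((\<lambda>x. cnj (f x)) has_derivative (\<lambda>h. cnj (frechet_derivative f (at x) h))) (at x)"
    using assms by (intro bounded_linear.has_derivative[OF bounded_linear_cnj]) (auto simp: frechet_derivative_works)
  from fun_cong[OF frechet_derivative_at[OF this], of b] show ?thesis by simp
qed

lemma n_times_cont_diff_add:
  "n_times_cont_diff k f \<Longrightarrow> n_times_cont_diff k g \<Longrightarrow> n_times_cont_diff k (\<lambda>x. f x + g x)"
proof (induction k arbitrary: f g)
  case 0 then show ?case by (auto intro!: continuous_intros)
next
  case (Suc k)
  then show ?case by (auto simp: frechet_derivative_add')
qed

lemma n_times_cont_diff_mult:
  "n_times_cont_diff k f \<Longrightarrow> n_times_cont_diff k g \<Longrightarrow> n_times_cont_diff k (\<lambda>x. f x * g x)"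
proof (induction k arbitrary: f g)
  case 0 then show ?case by (auto intro!: continuous_intros)
next
  case (Suc k)
  then have "n_times_cont_diff k f" "n_times_cont_diff k g"
    by (auto intro!: n_times_cont_diff_SucD simp del: n_times_cont_diff.simps)
  with Suc show ?case by (auto simp: frechet_derivative_mult' intro!: n_times_cont_diff_add)
qed

lemma n_times_cont_diff_cnj: "n_times_cont_diff k f \<Longrightarrow> n_times_cont_diff k (\<lambda>x. cnj (f x))"
proof (induction k arbitrary: f)
  case 0 then show ?case by (auto intro!: continuous_intros)
next
  case (Suc k)
  have "(\<lambda>x. cnj (f x)) differentiable (at x)" for x
    using Suc.prems bounded_linear.has_derivative[OF bounded_linear_cnj]
    unfolding n_times_cont_diff.simps differentiable_def by blast
  with Suc show ?case by (auto simp: frechet_derivative_cnj)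
qed

lemma n_times_cont_diff_prod:
  "(\<And>i. i \<in> I \<Longrightarrow> n_times_cont_diff k (f i)) \<Longrightarrow> n_times_cont_diff k (\<lambda>x. \<Prod>i\<in>I. f i x)"
proof (induction I rule: infinite_finite_induct)
  case (insert i I)
  then show ?case
    using n_times_cont_diff_mult[of k "f i" "\<lambda>x. \<Prod>i\<in>I. f i x"] by simp
qed (simp_all add: n_times_cont_diff_const)

text \<open>
  The derivatives of \<open>exp (-1/t)\<close> stay in the class of the functions \<open>p(1/t) exp (-1/t)\<close> with
  \<open>p\<close> a polynomial, all of which are flat at \<open>0\<close>.
\<close>

definition flat_exp :: "real poly \<Rightarrow> real \<Rightarrow> real" where
  "flat_exp p t = (if t \<le> 0 then 0 else poly p (1/t) * exp (- (1/t)))"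

lemma poly_times_exp_tendsto_0: "((\<lambda>y::real. poly p y * exp (- y)) \<longlongrightarrow> 0) at_top"
proof -
  have "((\<lambda>y. \<Sum>i\<le>degree p. coeff p i * (y ^ i / exp y)) \<longlongrightarrow> 0) at_top"
    by (rule tendsto_null_sum, rule tendsto_mult_right_zero, rule tendsto_power_div_exp_0)
  then show ?thesis
    by (simp add: poly_altdef exp_minus sum_distrib_right divide_inverse mult.assoc)
qed

lemma flat_exp_at_0: "((\<lambda>t. flat_exp p t / t) \<longlongrightarrow> 0) (at 0)"
  unfolding filterlim_at_split
proof
  show "((\<lambda>t. flat_exp p t / t) \<longlongrightarrow> 0) (at_left 0)"
    by (rule tendsto_eventually) (auto simp: flat_exp_def eventually_at_filter)
  have "((\<lambda>t. poly ([:0,1:] * p) (inverse t) * exp (- inverse t)) \<longlongrightarrow> 0) (at_right (0::real))"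
    by (rule filterlim_compose[OF poly_times_exp_tendsto_0 filterlim_inverse_at_top_right])
  moreover have "\<forall>\<^sub>F t in at_right (0::real).
      poly ([:0,1:] * p) (inverse t) * exp (- inverse t) = flat_exp p t / t"
    by (auto simp: flat_exp_def eventually_at_filter field_simps)
  ultimately show "((\<lambda>t. flat_exp p t / t) \<longlongrightarrow> 0) (at_right 0)"
    by (rule Lim_transform_eventually)
qed

lemma flat_exp_has_derivative:
  "(flat_exp p has_real_derivative flat_exp ([:0, 0, 1:] * (p - pderiv p)) t) (at t)"
proof -
  consider "t > 0" | "t < 0" | "t = 0" by linarith
  then show ?thesis
  proof cases
    case 1
    have "((\<lambda>t. poly p (1/t) * exp (- (1/t))) has_real_derivative
        poly ([:0, 0, 1:] * (p - pderiv p)) (1/t) * exp (- (1/t))) (at t)"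
      using 1 by (auto intro!: derivative_eq_intros poly_DERIV[THEN DERIV_chain2]
          simp: field_simps power2_eq_square)
    then have "(flat_exp p has_real_derivative
        poly ([:0, 0, 1:] * (p - pderiv p)) (1/t) * exp (- (1/t))) (at t)"
      by (rule has_field_derivative_transform_within_open[where S = "{0<..}"])
         (use 1 in \<open>auto simp: flat_exp_def\<close>)
    with 1 show ?thesis by (simp add: flat_exp_def)
  next
    case 2
    have "((\<lambda>t. 0) has_real_derivative 0) (at t)" by simp
    then have "(flat_exp p has_real_derivative 0) (at t)"
      by (rule has_field_derivative_transform_within_open[where S = "{..<0}"])
         (use 2 in \<open>auto simp: flat_exp_def\<close>)
    with 2 show ?thesis by (simp add: flat_exp_def)
  next
    case 3
    then show ?thesis
      using flat_exp_at_0[of p] by (simp add: has_field_derivative_iff flat_exp_def)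
  qed
qed

lemma n_times_cont_diff_flat_exp:
  fixes d :: "'a::euclidean_space"
  shows "n_times_cont_diff k (\<lambda>x. complex_of_real (flat_exp p (c + x \<bullet> d)))"
proof (induction k arbitrary: p)
  case 0
  have "continuous_on UNIV (flat_exp p)"
    using flat_exp_has_derivative by (intro continuous_at_imp_continuous_on) (auto intro: DERIV_isCont)
  then have "continuous_on UNIV (\<lambda>x. flat_exp p (c + x \<bullet> d))"
    by (rule continuous_on_compose2) (auto intro!: continuous_intros)
  then show ?case by (auto intro!: continuous_intros)
next
  case (Suc k)
  let ?p = "[:0, 0, 1:] * (p - pderiv p)"
  have der: "((\<lambda>x. complex_of_real (flat_exp p (c + x \<bullet> d))) has_derivative
      (\<lambda>h. complex_of_real (flat_exp ?p (c + x \<bullet> d)) * complex_of_real (h \<bullet> d))) (at x)" for x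
  proof -
    have "((\<lambda>x. c + x \<bullet> d) has_derivative (\<lambda>h. h \<bullet> d)) (at x)"
      by (auto intro!: derivative_eq_intros)
    then have "((\<lambda>x. flat_exp p (c + x \<bullet> d)) has_derivative (\<lambda>h. flat_exp ?p (c + x \<bullet> d) * (h \<bullet> d))) (at x)"
      using flat_exp_has_derivative[of p "c + x \<bullet> d", unfolded has_field_derivative_def]
      by (rule has_derivative_compose)
    then have "((\<lambda>x. complex_of_real (flat_exp p (c + x \<bullet> d))) has_derivative
        (\<lambda>h. complex_of_real (flat_exp ?p (c + x \<bullet> d) * (h \<bullet> d)))) (at x)"
      by (rule bounded_linear.has_derivative[OF bounded_linear_of_real])
    then show ?thesis by simp
  qed
  have fd: "frechet_derivative (\<lambda>x. complex_of_real (flat_exp p (c + x \<bullet> d))) (at x) =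
      (\<lambda>h. complex_of_real (flat_exp ?p (c + x \<bullet> d)) * complex_of_real (h \<bullet> d))" for x
    using frechet_derivative_at[OF der] by simp
  show ?case
    unfolding n_times_cont_diff.simps fd
    using der by (auto intro!: n_times_cont_diff_mult n_times_cont_diff_const Suc simp: differentiable_def)
qed


section \<open>Test functions are dense in \<open>L\<^sup>2(\<Omega>)\<close>\<close>

lemma test_functionsI:
  assumes "\<And>k. n_times_cont_diff k \<phi>" "compact K" "K \<subseteq> \<Omega>" "\<And>x. x \<notin> K \<Longrightarrow> \<phi> x = 0"
  shows "\<phi> \<in> test_functions \<Omega>"
  using assms unfolding test_functions_def by blast

lemma test_functionsE:
  assumes "\<phi> \<in> test_functions \<Omega>"
  obtains K where "compact K" "K \<subseteq> \<Omega>" "\<And>x. x \<notin> K \<Longrightarrow> \<phi> x = 0"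
  using assms unfolding test_functions_def by blast

lemma test_functions_smooth: "\<phi> \<in> test_functions \<Omega> \<Longrightarrow> n_times_cont_diff k \<phi>"
  unfolding test_functions_def by blast

lemma test_functions_zero: "(\<lambda>x. 0) \<in> test_functions \<Omega>"
  by (rule test_functionsI[of _ "{}"]) (simp_all add: n_times_cont_diff_const)

lemma test_functions_add:
  assumes "\<phi> \<in> test_functions \<Omega>" "\<psi> \<in> test_functions \<Omega>"
  shows "(\<lambda>x. \<phi> x + \<psi> x) \<in> test_functions \<Omega>"
proof -
  obtain K where K: "compact K" "K \<subseteq> \<Omega>" "\<And>x. x \<notin> K \<Longrightarrow> \<phi> x = 0"
    using test_functionsE[OF assms(1)] by blast
  obtain L where L: "compact L" "L \<subseteq> \<Omega>" "\<And>x. x \<notin> L \<Longrightarrow> \<psi> x = 0"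
    using test_functionsE[OF assms(2)] by blast
  show ?thesis
    by (rule test_functionsI[of _ "K \<union> L"])
       (use K L assms in \<open>simp_all add: n_times_cont_diff_add test_functions_smooth compact_Un\<close>)
qed

lemma test_functions_mult:
  assumes "\<phi> \<in> test_functions \<Omega>" "\<And>k. n_times_cont_diff k \<psi>"
  shows "(\<lambda>x. \<psi> x * \<phi> x) \<in> test_functions \<Omega>"
proof -
  obtain K where K: "compact K" "K \<subseteq> \<Omega>" "\<And>x. x \<notin> K \<Longrightarrow> \<phi> x = 0"
    using test_functionsE[OF assms(1)] by blast
  show ?thesis
    by (rule test_functionsI[of _ K])
       (use K assms in \<open>simp_all add: n_times_cont_diff_mult test_functions_smooth\<close>)
qed

lemma test_functions_cmult: "\<phi> \<in> test_functions \<Omega> \<Longrightarrow> (\<lambda>x. c * \<phi> x) \<in> test_functions \<Omega>"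
  by (rule test_functions_mult) (simp_all add: n_times_cont_diff_const)

lemma test_functions_cnj:
  assumes "\<phi> \<in> test_functions \<Omega>"
  shows "(\<lambda>x. cnj (\<phi> x)) \<in> test_functions \<Omega>"
proof -
  obtain K where K: "compact K" "K \<subseteq> \<Omega>" "\<And>x. x \<notin> K \<Longrightarrow> \<phi> x = 0"
    using test_functionsE[OF assms(1)] by blast
  show ?thesis
    by (rule test_functionsI[of _ K])
       (use K assms in \<open>simp_all add: n_times_cont_diff_cnj test_functions_smooth\<close>)
qed

lemma test_function_differentiable: "\<phi> \<in> test_functions \<Omega> \<Longrightarrow> \<phi> differentiable (at x)"
  using test_functions_smooth[of \<phi> \<Omega> "Suc 0"] by simp

lemma test_function_continuous: "\<phi> \<in> test_functions \<Omega> \<Longrightarrow> continuous_on UNIV \<phi>"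
  using test_functions_smooth[of \<phi> \<Omega> 0] by simp

lemma test_functions_partial:
  assumes "\<phi> \<in> test_functions \<Omega>" "b \<in> Basis"
  shows "(\<lambda>x. frechet_derivative \<phi> (at x) b) \<in> test_functions \<Omega>"
proof -
  obtain K where K: "compact K" "K \<subseteq> \<Omega>" "\<And>x. x \<notin> K \<Longrightarrow> \<phi> x = 0"
    using test_functionsE[OF assms(1)] by blast
  have "frechet_derivative \<phi> (at x) b = 0" if "x \<notin> K" for x
  proof -
    have "((\<lambda>x. 0) has_derivative (\<lambda>h. 0)) (at x)" by simp
    then have "(\<phi> has_derivative (\<lambda>h. 0)) (at x)"
      by (rule has_derivative_transform_within_open[where s = "- K"])
         (use that K compact_imp_closed in auto)
    from fun_cong[OF frechet_derivative_at[OF this], of b] show ?thesis by simp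
  qed
  moreover have "n_times_cont_diff k (\<lambda>x. frechet_derivative \<phi> (at x) b)" for k
    using assms(2) test_functions_smooth[OF assms(1), of "Suc k"] by simp
  ultimately show ?thesis using K by (intro test_functionsI[of _ K])
qed

lemma test_function_integrable:
  assumes "\<phi> \<in> test_functions \<Omega>"
  shows "integrable lborel \<phi>"
proof -
  obtain K where K: "compact K" "K \<subseteq> \<Omega>" "\<And>x. x \<notin> K \<Longrightarrow> \<phi> x = 0"
    using test_functionsE[OF assms] by blast
  have "integrable lborel (\<lambda>x. indicator K x *\<^sub>R \<phi> x)"
    by (rule borel_integrable_compact[OF K(1) continuous_on_subset[OF test_function_continuous[OF assms]]]) simp
  also have "(\<lambda>x. indicator K x *\<^sub>R \<phi> x) = \<phi>"
    using K(3) by (auto simp: fun_eq_iff indicator_def)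
  finally show ?thesis .
qed

lemma test_function_sq_integrable:
  assumes "\<phi> \<in> test_functions \<Omega>"
  shows "sq_integrable \<phi>"
proof -
  have "\<phi> \<in> borel_measurable lborel"
    using test_function_integrable[OF assms] by simp
  moreover have "integrable lborel (\<lambda>x. \<phi> x * cnj (\<phi> x))"
    by (rule test_function_integrable[OF test_functions_mult[OF test_functions_cnj[OF assms]]])
       (rule test_functions_smooth[OF assms])
  then have "integrable lborel (\<lambda>x. complex_of_real ((cmod (\<phi> x))\<^sup>2))"
    by (simp only: complex_norm_square)
  then have "integrable lborel (\<lambda>x. Re (complex_of_real ((cmod (\<phi> x))\<^sup>2)))"
    by (rule integrable_Re)
  ultimately show ?thesis by (simp add: sq_integrable_def)
qed

lemma abs_l2_add:
  assumes "sq_integrable u" "sq_integrable v"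
  shows "abs_l2 (\<lambda>x. u x + v x) = abs_l2 u + abs_l2 v"
  using assms by (intro plus_l2.abs_eq[symmetric]) (auto simp: l2_rel_def)

lemma abs_l2_scaleC:
  assumes "sq_integrable u"
  shows "abs_l2 (\<lambda>x. c * u x) = scaleC_l2 c (abs_l2 u)"
  using assms by (intro scaleC_l2.abs_eq[symmetric]) (auto simp: l2_rel_def)

lemma abs_l2_diff:
  assumes "sq_integrable u" "sq_integrable v"
  shows "abs_l2 (\<lambda>x. u x - v x) = abs_l2 u - abs_l2 v"
  using abs_l2_add[OF assms(1) sq_integrable_mult[OF assms(2)], of "-1"] abs_l2_scaleC[OF assms(2), of "-1"]
  by (simp add: scaleC_l2_minus_left)

lemma abs_l2_tendsto:
  fixes u :: "nat \<Rightarrow> 'a::euclidean_space \<Rightarrow> complex"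
  assumes u: "\<And>n. sq_integrable (u n)" and v: "sq_integrable v" and w: "sq_integrable w"
    and lim: "\<And>x. (\<lambda>n. u n x) \<longlonglongrightarrow> v x" and le: "\<And>n x. cmod (u n x) \<le> cmod (w x)"
  shows "(\<lambda>n. abs_l2 (u n)) \<longlonglongrightarrow> abs_l2 v"
proof -
  have [measurable]: "u n \<in> borel_measurable borel" "v \<in> borel_measurable borel" for n
    using u v by (auto simp: sq_integrable_def)
  have sq: "sq_integrable (\<lambda>x. u n x - v x)" for n
    using sq_integrable_add[OF u[of n] sq_integrable_mult[OF v, of "-1"]] by simp
  have "(\<lambda>n. \<integral>x. (cmod (u n x - v x))\<^sup>2 \<partial>lborel) \<longlonglongrightarrow> (\<integral>x. 0 \<partial>(lborel :: 'a measure))"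
  proof (rule integral_dominated_convergence)
    show "integrable lborel (\<lambda>x. 2 * (cmod (w x))\<^sup>2 + 2 * (cmod (v x))\<^sup>2)"
      using v w by (auto simp: sq_integrable_def)
    show "AE x in lborel. (\<lambda>n. (cmod (u n x - v x))\<^sup>2) \<longlonglongrightarrow> 0"
    proof (rule AE_I2)
      fix x
      have "(\<lambda>n. (cmod (u n x - v x))\<^sup>2) \<longlonglongrightarrow> (cmod (v x - v x))\<^sup>2"
        by (intro tendsto_intros lim)
      then show "(\<lambda>n. (cmod (u n x - v x))\<^sup>2) \<longlonglongrightarrow> 0" by simp
    qed
    show "AE x in lborel. norm ((cmod (u n x - v x))\<^sup>2) \<le> 2 * (cmod (w x))\<^sup>2 + 2 * (cmod (v x))\<^sup>2" for n
    proof (rule AE_I2)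
      fix x
      have "(cmod (u n x - v x))\<^sup>2 \<le> (cmod (w x) + cmod (v x))\<^sup>2"
        by (intro power_mono order_trans[OF norm_triangle_ineq4] add_mono le) auto
      also have "\<dots> \<le> 2 * (cmod (w x))\<^sup>2 + 2 * (cmod (v x))\<^sup>2"
        using zero_le_power2[of "cmod (w x) - cmod (v x)"]
        by (simp add: power2_eq_square algebra_simps)
      finally show "norm ((cmod (u n x - v x))\<^sup>2) \<le> 2 * (cmod (w x))\<^sup>2 + 2 * (cmod (v x))\<^sup>2" by simp
    qed
  qed auto
  then have "(\<lambda>n. (norm (abs_l2 (u n) - abs_l2 v))\<^sup>2) \<longlonglongrightarrow> 0"
    by (simp add: norm_abs_l2[OF sq] flip: abs_l2_diff[OF u v])
  then have "(\<lambda>n. norm (abs_l2 (u n) - abs_l2 v)) \<longlonglongrightarrow> 0"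
    using tendsto_real_sqrt by fastforce
  then show ?thesis by (simp add: tendsto_norm_zero_iff LIM_zero_iff)
qed

lemma closure_test_functions_add:
  assumes "f \<in> closure (abs_l2 ` test_functions \<Omega>)" "g \<in> closure (abs_l2 ` test_functions \<Omega>)"
  shows "f + g \<in> closure (abs_l2 ` test_functions \<Omega>)"
proof -
  obtain x y where x: "\<And>n. x n \<in> abs_l2 ` test_functions \<Omega>" "x \<longlonglongrightarrow> f"
    and y: "\<And>n. y n \<in> abs_l2 ` test_functions \<Omega>" "y \<longlonglongrightarrow> g"
    using assms by (auto simp: closure_sequential)
  have "a + b \<in> abs_l2 ` test_functions \<Omega>"
    if "a \<in> abs_l2 ` test_functions \<Omega>" "b \<in> abs_l2 ` test_functions \<Omega>" for a b
  proof -
    from that obtain u v where uv: "u \<in> test_functions \<Omega>" "v \<in> test_functions \<Omega>"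
      and ab: "a = abs_l2 u" "b = abs_l2 v"
      by blast
    have "a + b = abs_l2 (\<lambda>x. u x + v x)"
      unfolding ab by (rule abs_l2_add[OF uv[THEN test_function_sq_integrable], symmetric])
    then show ?thesis
      using test_functions_add[OF uv] by blast
  qed
  then show ?thesis
    unfolding closure_sequential using x y by (intro exI[of _ "\<lambda>n. x n + y n"]) (auto intro: tendsto_add)
qed

lemma closure_test_functions_scaleC:
  assumes "f \<in> closure (abs_l2 ` test_functions \<Omega>)"
  shows "scaleC_l2 c f \<in> closure (abs_l2 ` test_functions \<Omega>)"
proof -
  obtain x where x: "\<And>n. x n \<in> abs_l2 ` test_functions \<Omega>" "x \<longlonglongrightarrow> f"
    using assms by (auto simp: closure_sequential)
  have "scaleC_l2 c a \<in> abs_l2 ` test_functions \<Omega>" if a: "a \<in> abs_l2 ` test_functions \<Omega>" for a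
  proof -
    from a obtain u where u: "u \<in> test_functions \<Omega>" "a = abs_l2 u" by blast
    have "scaleC_l2 c a = abs_l2 (\<lambda>x. c * u x)"
      unfolding u(2) by (rule abs_l2_scaleC[OF test_function_sq_integrable[OF u(1)], symmetric])
    then show ?thesis
      using test_functions_cmult[OF u(1)] by blast
  qed
  then show ?thesis
    unfolding closure_sequential using x
    by (intro exI[of _ "\<lambda>n. scaleC_l2 c (x n)"])
       (auto intro: bounded_linear.tendsto[OF bounded_linear_scaleC_l2])
qed

lemma closure_test_functions_zero: "0 \<in> closure (abs_l2 ` test_functions \<Omega>)"
  unfolding zero_l2_def by (rule subsetD[OF closure_subset imageI[OF test_functions_zero]])

lemma closure_test_functions_diff:
  assumes "f \<in> closure (abs_l2 ` test_functions \<Omega>)" "g \<in> closure (abs_l2 ` test_functions \<Omega>)"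
  shows "f - g \<in> closure (abs_l2 ` test_functions \<Omega>)"
  using closure_test_functions_add[OF assms(1) closure_test_functions_scaleC[OF assms(2), of "-1"]]
  by (simp add: scaleC_l2_minus_left)

lemma sq_integrable_indicator:
  assumes "A \<in> sets borel" "emeasure lborel A < \<infinity>"
  shows "sq_integrable (indicator A)"
proof -
  have "integrable lborel (\<lambda>x. indicat_real A x)"
    using assms by (simp add: integrable_indicator_iff)
  moreover have "(\<lambda>x. (cmod (indicator A x))\<^sup>2) = indicat_real A"
    by (auto simp: fun_eq_iff indicator_def)
  ultimately show ?thesis using assms by (simp add: sq_integrable_def)
qed

text \<open>
  Let \<open>s(t) = exp (-1/t)\<close> for \<open>t > 0\<close> and \<open>s(t) = 0\<close> otherwise. The products of \<open>s(j t - 1)\<close> over the distances \<open>t\<close> to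
  the faces converge to the indicator of the open box as \<open>j\<close> grows. The shift by \<open>1\<close> makes each of
  them vanish near the boundary, so that its support is compact in the open box.
\<close>

lemma indicator_box_in_closure:
  fixes lo hi :: "'a::euclidean_space"
  assumes box: "box lo hi \<subseteq> \<Omega>"
  shows "abs_l2 (indicator (box lo hi)) \<in> closure (abs_l2 ` test_functions \<Omega>)"
proof -
  define s where "s = flat_exp 1"
  have s_range: "0 \<le> s t" "s t \<le> 1" and s_zero: "t \<le> 0 \<Longrightarrow> s t = 0" for t
    by (auto simp: s_def flat_exp_def)
  have s_lim: "(\<lambda>j. s (real j * t - 1)) \<longlonglongrightarrow> (if t > 0 then 1 else 0)" for t
  proof (cases "t > 0")
    case True
    have at_top: "filterlim (\<lambda>j. real j * t - 1) at_top sequentially"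
      unfolding filterlim_at_top
    proof
      fix Z :: real
      show "\<forall>\<^sub>F j in sequentially. Z \<le> real j * t - 1"
        using eventually_ge_at_top[of "nat \<lceil>(Z + 1) / t\<rceil>"]
      proof eventually_elim
        case (elim j)
        then have "(Z + 1) / t \<le> real j" by linarith
        then show ?case using True by (simp add: field_simps)
      qed
    qed
    have "(\<lambda>j. exp (- inverse (real j * t - 1))) \<longlonglongrightarrow> exp (- 0)"
      by (intro tendsto_intros tendsto_inverse_0_at_top at_top)
    moreover have "\<forall>\<^sub>F j in sequentially. exp (- inverse (real j * t - 1)) = s (real j * t - 1)"
      using filterlim_at_top_dense[THEN iffD1, OF at_top, rule_format, of 0]
      by eventually_elim (simp add: s_def flat_exp_def inverse_eq_divide)
    ultimately show ?thesis using True by (simp add: Lim_transform_eventually)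
  next
    case False
    then have "real j * t - 1 \<le> 0" for j
      using mult_nonneg_nonpos[of "real j" t] by linarith
    with False show ?thesis by (simp add: s_zero)
  qed
  define \<Phi> where "\<Phi> j x = (\<Prod>b\<in>Basis. complex_of_real (s (real j * (x \<bullet> b - lo \<bullet> b) - 1))
      * complex_of_real (s (real j * (hi \<bullet> b - x \<bullet> b) - 1)))" for j and x :: 'a
  have smooth: "n_times_cont_diff k (\<Phi> j)" for j k
  proof -
    have "n_times_cont_diff k (\<lambda>x. complex_of_real (s (real j * (x \<bullet> b - lo \<bullet> b) - 1)))" for b
      using n_times_cont_diff_flat_exp[of k 1 "- real j * (lo \<bullet> b) - 1" "real j *\<^sub>R b"]
      by (simp add: s_def algebra_simps)
    moreover have "n_times_cont_diff k (\<lambda>x. complex_of_real (s (real j * (hi \<bullet> b - x \<bullet> b) - 1)))" for b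
      using n_times_cont_diff_flat_exp[of k 1 "real j * (hi \<bullet> b) - 1" "(- real j) *\<^sub>R b"]
      by (simp add: s_def algebra_simps)
    ultimately show ?thesis
      unfolding \<Phi>_def by (intro n_times_cont_diff_prod n_times_cont_diff_mult)
  qed
  have test: "\<Phi> j \<in> test_functions \<Omega>" if "j > 0" for j
  proof -
    define K where "K = cbox (lo + (1 / real j) *\<^sub>R One) (hi - (1 / real j) *\<^sub>R One)"
    have "K \<subseteq> box lo hi"
    proof
      fix x assume "x \<in> K"
      then have in_K: "lo \<bullet> b + 1 / real j \<le> x \<bullet> b \<and> x \<bullet> b \<le> hi \<bullet> b - 1 / real j" if "b \<in> Basis" for b
        using that by (auto simp: K_def mem_box inner_simps)
      have "1 / real j > 0" using \<open>j > 0\<close> by simp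
      then have "lo \<bullet> b < x \<bullet> b \<and> x \<bullet> b < hi \<bullet> b" if "b \<in> Basis" for b
        using in_K[OF that] by linarith
      then show "x \<in> box lo hi" by (simp add: mem_box)
    qed
    moreover have "\<Phi> j x = 0" if x: "x \<notin> K" for x
    proof -
      obtain b where b: "b \<in> Basis" "x \<bullet> b < lo \<bullet> b + 1 / real j \<or> hi \<bullet> b - 1 / real j < x \<bullet> b"
        using x by (auto simp: K_def mem_box inner_simps not_le)
      then have "real j * (x \<bullet> b - lo \<bullet> b) - 1 \<le> 0 \<or> real j * (hi \<bullet> b - x \<bullet> b) - 1 \<le> 0"
        using \<open>j > 0\<close> by (auto simp: field_simps)
      then have "s (real j * (x \<bullet> b - lo \<bullet> b) - 1) = 0 \<or> s (real j * (hi \<bullet> b - x \<bullet> b) - 1) = 0"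
        using s_zero by blast
      then show ?thesis
        unfolding \<Phi>_def using b(1) by (intro prod_zero) auto
    qed
    ultimately show ?thesis
      using box smooth by (intro test_functionsI[of _ K]) (auto simp: K_def)
  qed
  have bound: "cmod (\<Phi> (Suc j) x) \<le> cmod (indicator (box lo hi) x)" for j x
  proof (cases "x \<in> box lo hi")
    case True
    have "cmod (\<Phi> (Suc j) x) \<le> 1"
      unfolding \<Phi>_def prod_norm[symmetric]
      by (intro prod_le_1) (auto simp: norm_mult s_range intro!: mult_le_one)
    with True show ?thesis by simp
  next
    case False
    then obtain b where b: "b \<in> Basis" "x \<bullet> b \<le> lo \<bullet> b \<or> hi \<bullet> b \<le> x \<bullet> b"
      by (auto simp: mem_box not_less)
    then have "real (Suc j) * (x \<bullet> b - lo \<bullet> b) - 1 \<le> 0 \<or> real (Suc j) * (hi \<bullet> b - x \<bullet> b) - 1 \<le> 0"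
      using mult_nonneg_nonpos[of "real (Suc j)" "x \<bullet> b - lo \<bullet> b"]
        mult_nonneg_nonpos[of "real (Suc j)" "hi \<bullet> b - x \<bullet> b"] by auto
    then have "s (real (Suc j) * (x \<bullet> b - lo \<bullet> b) - 1) = 0 \<or> s (real (Suc j) * (hi \<bullet> b - x \<bullet> b) - 1) = 0"
      using s_zero by blast
    then have "\<Phi> (Suc j) x = 0"
      unfolding \<Phi>_def using b(1) by (intro prod_zero) auto
    then show ?thesis by simp
  qed
  have lim: "(\<lambda>j. \<Phi> (Suc j) x) \<longlonglongrightarrow> indicator (box lo hi) x" for x
  proof -
    let ?P = "\<Prod>b\<in>Basis. complex_of_real (if x \<bullet> b - lo \<bullet> b > 0 then 1 else 0)
        * complex_of_real (if hi \<bullet> b - x \<bullet> b > 0 then 1 else 0)"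
    have "(\<lambda>j. \<Phi> j x) \<longlonglongrightarrow> ?P"
      unfolding \<Phi>_def
      by (rule tendsto_prod, rule tendsto_mult; rule tendsto_of_real; rule s_lim)
    moreover have "?P = indicator (box lo hi) x"
    proof (cases "x \<in> box lo hi")
      case False
      then obtain b where b: "b \<in> Basis" "x \<bullet> b \<le> lo \<bullet> b \<or> hi \<bullet> b \<le> x \<bullet> b"
        by (auto simp: mem_box not_less)
      then have "complex_of_real (if x \<bullet> b - lo \<bullet> b > 0 then 1 else 0)
          * complex_of_real (if hi \<bullet> b - x \<bullet> b > 0 then 1 else 0) = 0"
        by auto
      then have "?P = 0"
        by (rule prod_zero[OF finite_Basis bexI[OF _ b(1)]])
      with False show ?thesis by simp
    qed (auto simp: mem_box)
    ultimately have "(\<lambda>j. \<Phi> j x) \<longlonglongrightarrow> indicator (box lo hi) x" by (simp only:)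
    from LIMSEQ_Suc[OF this] show ?thesis .
  qed
  have sq: "sq_integrable (indicator (box lo hi))"
    by (intro sq_integrable_indicator) (auto simp: emeasure_lborel_box_eq)
  have "(\<lambda>j. abs_l2 (\<Phi> (Suc j))) \<longlonglongrightarrow> abs_l2 (indicator (box lo hi))"
    by (rule abs_l2_tendsto[OF test_function_sq_integrable[OF test[OF zero_less_Suc]] sq sq lim bound])
  moreover have "abs_l2 (\<Phi> (Suc j)) \<in> abs_l2 ` test_functions \<Omega>" for j
    by (rule imageI[OF test[OF zero_less_Suc]])
  ultimately show ?thesis
    unfolding closure_sequential by (intro exI[of _ "\<lambda>j. abs_l2 (\<Phi> (Suc j))"]) simp
qed

text \<open>
  The sets whose traces on the box have their indicators in the closure form a Dynkin system, and the boxes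
  are a generator of the Borel sets that is stable under intersection.
\<close>

lemma indicator_in_closure:
  fixes lo hi :: "'a::euclidean_space"
  assumes box: "box lo hi \<subseteq> \<Omega>" and A: "A \<in> sets borel"
  shows "abs_l2 (indicator (A \<inter> box lo hi)) \<in> closure (abs_l2 ` test_functions \<Omega>)"
proof -
  have sq: "sq_integrable (indicator (B \<inter> box lo hi))" if "B \<in> sets borel" for B
  proof (rule sq_integrable_indicator)
    have "emeasure lborel (B \<inter> box lo hi) \<le> emeasure lborel (box lo hi)"
      using that by (intro emeasure_mono) auto
    also have "\<dots> < \<infinity>" by (auto simp: emeasure_lborel_box_eq)
    finally show "emeasure lborel (B \<inter> box lo hi) < \<infinity>" .
  qed (use that in auto)
  have "Int_stable (range (\<lambda>(a, b). box a b :: 'a set))"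
    by (auto simp: Int_stable_def box_Int_box)
  moreover have "range (\<lambda>(a, b). box a b :: 'a set) \<subseteq> Pow UNIV"
    by auto
  moreover have "A \<in> sigma_sets UNIV (range (\<lambda>(a, b). box a b))"
    using A unfolding borel_eq_box by simp
  ultimately show ?thesis
  proof (induction rule: sigma_sets_induct_disjoint)
    case (basic A)
    then obtain a b where "A = box a b" by auto
    moreover obtain c d where "box a b \<inter> box lo hi = box c d" by (auto simp: box_Int_box)
    ultimately show ?case
      using indicator_box_in_closure[of c d \<Omega>] box by auto
  next
    case empty
    have "indicator ({} \<inter> box lo hi) = (\<lambda>x. 0 :: complex)" by auto
    then show ?case using closure_test_functions_zero[of \<Omega>] by (simp only: zero_l2_def)
  next
    case (compl A)
    then have A: "A \<in> sets borel" by (simp add: borel_eq_box)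
    have "indicator ((UNIV - A) \<inter> box lo hi)
        = (\<lambda>x. indicator (UNIV \<inter> box lo hi) x - indicator (A \<inter> box lo hi) x :: complex)"
      by (auto simp: fun_eq_iff indicator_def)
    then have "abs_l2 (indicator ((UNIV - A) \<inter> box lo hi))
        = abs_l2 (indicator (UNIV \<inter> box lo hi)) - abs_l2 (indicator (A \<inter> box lo hi))"
      using abs_l2_diff[OF sq[of UNIV] sq[OF A]] by simp
    then show ?case
      using closure_test_functions_diff[OF indicator_box_in_closure[OF box] compl(2)] by simp
  next
    case (union F)
    then have F: "\<And>i. F i \<in> sets borel"
      by (simp add: borel_eq_box subset_eq)
    have disj: "indicator ((\<Union>i<Suc n. F i) \<inter> box lo hi)
        = (\<lambda>x. indicator ((\<Union>i<n. F i) \<inter> box lo hi) x + indicator (F n \<inter> box lo hi) x :: complex)" for n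
    proof
      fix x
      have "x \<notin> F i" if "x \<in> F n" "i < n" for i
        using disjoint_family_onD[OF union(1), of i n] that by auto
      then show "indicator ((\<Union>i<Suc n. F i) \<inter> box lo hi) x
        = (indicator ((\<Union>i<n. F i) \<inter> box lo hi) x + indicator (F n \<inter> box lo hi) x :: complex)"
        by (auto simp: indicator_def less_Suc_eq)
    qed
    have fin: "abs_l2 (indicator ((\<Union>i<n. F i) \<inter> box lo hi)) \<in> closure (abs_l2 ` test_functions \<Omega>)" for n
    proof (induction n)
      case 0
      have "indicator ((\<Union>i<0. F i) \<inter> box lo hi) = (\<lambda>x. 0 :: complex)" by auto
      then show ?case using closure_test_functions_zero[of \<Omega>] by (simp only: zero_l2_def)
    next
      case (Suc n)
      have "abs_l2 (indicator ((\<Union>i<Suc n. F i) \<inter> box lo hi))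
          = abs_l2 (indicator ((\<Union>i<n. F i) \<inter> box lo hi)) + abs_l2 (indicator (F n \<inter> box lo hi))"
        unfolding disj using F by (intro abs_l2_add sq) auto
      then show ?case using closure_test_functions_add[OF Suc union(3)] by simp
    qed
    have "(\<lambda>n. abs_l2 (indicator ((\<Union>i<n. F i) \<inter> box lo hi))) \<longlonglongrightarrow> abs_l2 (indicator ((\<Union>i. F i) \<inter> box lo hi))"
    proof (rule abs_l2_tendsto[OF sq sq sq[of UNIV]])
      fix x
      show "(\<lambda>n. indicator ((\<Union>i<n. F i) \<inter> box lo hi) x) \<longlonglongrightarrow> (indicator ((\<Union>i. F i) \<inter> box lo hi) x :: complex)"
        unfolding indicator_inter_arith by (intro tendsto_mult tendsto_const LIMSEQ_indicator_UN)
    qed (use F in \<open>auto simp: indicator_def\<close>)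
    then show ?case
      by (rule closed_sequentially[OF closed_closure fin])
  qed
qed

text \<open>
  Finite unions of boxes exhaust \<open>\<Omega>\<close>. Simple functions that converge to \<open>f\<close> and are cut off to these unions
  are finite combinations of the indicators above, and dominated convergence applies.
\<close>

theorem test_functions_dense:
  fixes \<Omega> :: "'a::euclidean_space set"
  assumes "open \<Omega>"
  shows "l2_on \<Omega> \<subseteq> closure (abs_l2 ` test_functions \<Omega>)"
proof
  fix f assume f: "f \<in> l2_on \<Omega>"
  let ?T = "closure (abs_l2 ` test_functions \<Omega>)"
  obtain D where D: "countable D" "D \<subseteq> Pow \<Omega>" "\<And>X. X \<in> D \<Longrightarrow> \<exists>a b. X = box a b" "\<Union>D = \<Omega>"
    using open_countable_Union_open_box[OF assms] by metis
  \<comment> \<open>The empty set is added because \<open>D\<close> has no enumeration if \<open>\<Omega>\<close> is empty.\<close>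
  define Q where "Q = from_nat_into (insert {} D)"
  have rangeQ: "range Q = insert {} D"
    unfolding Q_def using D(1) by (intro range_from_nat_into) auto
  have Q: "\<exists>a b. Q n = box a b" "Q n \<subseteq> \<Omega>" for n
  proof -
    have "Q n \<in> insert {} D" using rangeQ by blast
    moreover have "{} = box (0::'a) 0" by simp
    ultimately show "\<exists>a b. Q n = box a b" using D(3) by blast
    show "Q n \<subseteq> \<Omega>" using \<open>Q n \<in> insert {} D\<close> D(2) by blast
  qed
  have borelQ [measurable]: "Q n \<in> sets borel" for n
    using Q(1)[of n] by auto
  have UQ: "(\<Union>n. Q n) = \<Omega>" using rangeQ D(4) by auto
  have [measurable]: "\<Omega> \<in> sets borel" using assms by simp
  define U where "U n = (\<Union>i<n. Q i)" for n
  have [measurable]: "U n \<in> sets borel" for n by (simp add: U_def)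
  have finU: "emeasure lborel (U n) < \<infinity>" for n
  proof (induction n)
    case (Suc n)
    have "emeasure lborel (U (Suc n)) \<le> emeasure lborel (U n) + emeasure lborel (Q n)"
      using emeasure_subadditive[of "U n" lborel "Q n"] by (simp add: U_def lessThan_Suc Un_commute)
    moreover have "emeasure lborel (Q n) < \<infinity>" using Q(1)[of n] by (auto simp: emeasure_lborel_box_eq)
    ultimately show ?case using Suc by (auto simp: less_top[symmetric] top_unique)
  qed (simp add: U_def)
  have sqU: "sq_integrable (indicator (A \<inter> U n))" if "A \<in> sets borel" for A n
  proof (rule sq_integrable_indicator)
    show "emeasure lborel (A \<inter> U n) < \<infinity>"
      using that by (intro order.strict_trans1[OF emeasure_mono finU[of n]]) auto
  qed (use that in auto)
  have indU: "abs_l2 (indicator (A \<inter> U n)) \<in> ?T" if [measurable]: "A \<in> sets borel" for A n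
  proof (induction n)
    case 0
    have "indicator (A \<inter> U 0) = (\<lambda>x. 0 :: complex)" by (auto simp: U_def)
    then show ?case using closure_test_functions_zero[of \<Omega>] by (simp only: zero_l2_def)
  next
    case (Suc n)
    obtain a b where ab: "Q n = box a b" using Q(1) by blast
    have eq: "indicator (A \<inter> U (Suc n)) = (\<lambda>x. indicator (A \<inter> U n) x + indicator ((A - U n) \<inter> box a b) x :: complex)"
      by (auto simp: U_def lessThan_Suc ab[symmetric] indicator_def fun_eq_iff)
    have "(A - U n) \<inter> box a b = (A \<inter> box a b - U n) \<inter> U (Suc n)"
      by (auto simp: U_def lessThan_Suc ab)
    then have "sq_integrable (indicator ((A - U n) \<inter> box a b))"
      using sqU[of "A \<inter> box a b - U n" "Suc n"] by simp
    then have "abs_l2 (indicator (A \<inter> U (Suc n)))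
        = abs_l2 (indicator (A \<inter> U n)) + abs_l2 (indicator ((A - U n) \<inter> box a b))"
      unfolding eq by (intro abs_l2_add sqU) auto
    then show ?case
      using closure_test_functions_add[OF Suc indicator_in_closure[of a b \<Omega> "A - U n"]] Q(2)[of n] ab by simp
  qed
  obtain s where s: "\<And>i. simple_function lborel (s i)" "\<And>x. (\<lambda>i. s i x) \<longlonglongrightarrow> rep_l2 f x"
    "\<And>i x. cmod (s i x) \<le> 2 * cmod (rep_l2 f x)"
    using borel_measurable_implies_sequence_metric[of "rep_l2 f" lborel 0] by auto
  have simpleT: "abs_l2 (\<lambda>x. s i x * indicator (U n) x) \<in> ?T \<and> sq_integrable (\<lambda>x. s i x * indicator (U n) x)" for i n
  proof -
    have meas: "s i -` {y} \<in> sets borel" for y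
      using simple_functionD(2)[OF s(1)[of i], of "{y}"] by simp
    have fin: "finite (range (s i))"
      using simple_functionD(1)[OF s(1)[of i]] by simp
    have "abs_l2 (\<lambda>x. \<Sum>y\<in>F. y * indicator (s i -` {y} \<inter> U n) x) \<in> ?T
        \<and> sq_integrable (\<lambda>x. \<Sum>y\<in>F. y * indicator (s i -` {y} \<inter> U n) x)" if "finite F" for F
      using that
    proof induction
      case empty
      show ?case using closure_test_functions_zero[of \<Omega>] by (simp add: zero_l2_def sq_integrable_zero)
    next
      case (insert y F)
      have sq: "sq_integrable (\<lambda>x. y * indicator (s i -` {y} \<inter> U n) x)"
        by (intro sq_integrable_mult sqU meas)
      have "abs_l2 (\<lambda>x. y * indicator (s i -` {y} \<inter> U n) x) \<in> ?T"
        using closure_test_functions_scaleC[OF indU[OF meas], of y y n] abs_l2_scaleC[OF sqU[OF meas], of y y n] by simp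
      with insert(3) sq show ?case
        unfolding sum.insert[OF insert(1,2)]
        by (auto simp only: abs_l2_add intro!: closure_test_functions_add sq_integrable_add)
    qed
    from this[OF fin] show ?thesis
    proof -
      have "(\<Sum>y\<in>range (s i). y * indicator (s i -` {y} \<inter> U n) x) = s i x * indicator (U n) x" for x
      proof -
        have "(\<Sum>y\<in>range (s i). y * indicator (s i -` {y} \<inter> U n) x)
            = (\<Sum>y\<in>range (s i). if y = s i x then y * indicator (U n) x else 0)"
          by (intro sum.cong) (auto simp: indicator_def)
        then show ?thesis using fin by simp
      qed
      then show ?thesis
        using \<open>abs_l2 (\<lambda>x. \<Sum>y\<in>range (s i). y * indicator (s i -` {y} \<inter> U n) x) \<in> ?T
        \<and> sq_integrable (\<lambda>x. \<Sum>y\<in>range (s i). y * indicator (s i -` {y} \<inter> U n) x)\<close> by simp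
    qed
  qed
  have sq_f\<Omega>: "sq_integrable (\<lambda>x. rep_l2 f x * indicator \<Omega> x)"
    unfolding sq_integrable_def
  proof
    show "integrable lborel (\<lambda>x. (cmod (rep_l2 f x * indicator \<Omega> x))\<^sup>2)"
      by (rule Bochner_Integration.integrable_bound[OF integrable_rep[of f]]) (auto simp: indicator_def)
  qed auto
  have "(\<lambda>n. abs_l2 (\<lambda>x. s n x * indicator (U n) x)) \<longlonglongrightarrow> abs_l2 (\<lambda>x. rep_l2 f x * indicator \<Omega> x)"
  proof (rule abs_l2_tendsto[where w = "\<lambda>x. 2 * rep_l2 f x"])
    show "(\<lambda>n. s n x * indicator (U n) x) \<longlonglongrightarrow> rep_l2 f x * indicator \<Omega> x" for x
      unfolding U_def UQ[symmetric] by (intro tendsto_mult s LIMSEQ_indicator_UN)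
    show "cmod (s n x * indicator (U n) x) \<le> cmod (2 * rep_l2 f x)" for n x
      using s(3)[of n x] by (auto simp: indicator_def norm_mult)
  qed (use simpleT sq_f\<Omega> sq_integrable_mult[OF sq_integrable_rep] in auto)
  moreover have "abs_l2 (\<lambda>x. rep_l2 f x * indicator \<Omega> x) = f"
  proof -
    have "AE x in lborel. rep_l2 f x * indicator \<Omega> x = rep_l2 f x"
      using f unfolding l2_on_def mem_Collect_eq by eventually_elim (auto simp: indicator_def)
    then show ?thesis
      using abs_l2_eqI[OF sq_f\<Omega> sq_integrable_rep[of f]] by simp
  qed
  ultimately have "(\<lambda>n. abs_l2 (\<lambda>x. s n x * indicator (U n) x)) \<longlonglongrightarrow> f" by (simp only:)
  then show "f \<in> ?T"
    by (rule closed_sequentially[OF closed_closure conjunct1[OF simpleT]])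
qed

section \<open>Weak derivatives and the Sobolev space\<close>

lemma has_vector_derivative_iff_quotient:
  fixes f :: "real \<Rightarrow> 'b::real_normed_vector"
  shows "(f has_vector_derivative D) (at x within S) \<longleftrightarrow>
    ((\<lambda>y. (f y - f x) /\<^sub>R (y - x)) \<longlongrightarrow> D) (at x within S)"
proof -
  have "(f has_vector_derivative D) (at x within S) \<longleftrightarrow>
      ((\<lambda>y. (f y - f x - (y - x) *\<^sub>R D) /\<^sub>R norm (y - x)) \<longlongrightarrow> 0) (at x within S)"
    by (simp add: has_vector_derivative_def has_derivative_at_within bounded_linear_scaleR_left)
  also have "\<dots> \<longleftrightarrow>
      ((\<lambda>y. norm ((f y - f x - (y - x) *\<^sub>R D) /\<^sub>R norm (y - x))) \<longlongrightarrow> 0) (at x within S)"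
    by (rule tendsto_norm_zero_iff[symmetric])
  also have "\<dots> \<longleftrightarrow> ((\<lambda>y. norm ((f y - f x) /\<^sub>R (y - x) - D)) \<longlongrightarrow> 0) (at x within S)"
  proof (rule filterlim_cong[OF refl refl])
    have "norm ((f y - f x - (y - x) *\<^sub>R D) /\<^sub>R norm (y - x)) = norm ((f y - f x) /\<^sub>R (y - x) - D)"
      if "y \<noteq> x" for y
    proof -
      have "(f y - f x) /\<^sub>R (y - x) - D = (f y - f x - (y - x) *\<^sub>R D) /\<^sub>R (y - x)"
        using that by (simp add: scaleR_diff_right)
      then show ?thesis by simp
    qed
    then show "\<forall>\<^sub>F y in at x within S. norm ((f y - f x - (y - x) *\<^sub>R D) /\<^sub>R norm (y - x))
        = norm ((f y - f x) /\<^sub>R (y - x) - D)"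
      by (simp add: eventually_at_filter)
  qed
  also have "\<dots> \<longleftrightarrow> ((\<lambda>y. (f y - f x) /\<^sub>R (y - x)) \<longlongrightarrow> D) (at x within S)"
    by (simp add: tendsto_norm_zero_iff LIM_zero_iff)
  finally show ?thesis .
qed

lemma bounded_test_function:
  assumes "\<phi> \<in> test_functions \<Omega>"
  obtains C where "\<And>x. cmod (\<phi> x) \<le> C"
proof -
  obtain K where K: "compact K" "K \<subseteq> \<Omega>" "\<And>x. x \<notin> K \<Longrightarrow> \<phi> x = 0"
    using test_functionsE[OF assms] by blast
  have "compact (\<phi> ` K)"
    by (rule compact_continuous_image[OF continuous_on_subset[OF test_function_continuous[OF assms]] K(1)]) simp
  then obtain C where C: "\<And>y. y \<in> \<phi> ` K \<Longrightarrow> cmod y \<le> C"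
    using compact_imp_bounded bounded_iff by metis
  have "cmod (\<phi> x) \<le> max C 0" for x
    using C[of "\<phi> x"] K(3)[of x] by (cases "x \<in> K") auto
  then show thesis by (rule that)
qed

text \<open>
  Difference quotients have integral \<open>0\<close> by translation invariance, and they converge to the
  partial derivative boundedly on a fixed ball.
\<close>

lemma integral_partial_test_function:
  fixes \<phi> :: "'a::euclidean_space \<Rightarrow> complex"
  assumes \<phi>: "\<phi> \<in> test_functions \<Omega>" and b: "b \<in> Basis"
  shows "(\<integral>x. frechet_derivative \<phi> (at x) b \<partial>lborel) = 0"
proof -
  obtain K where K: "compact K" "K \<subseteq> \<Omega>" "\<And>x. x \<notin> K \<Longrightarrow> \<phi> x = 0"
    using test_functionsE[OF \<phi>] by blast
  obtain R where R: "\<And>x. x \<in> K \<Longrightarrow> norm x \<le> R"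
    using compact_imp_bounded[OF K(1)] bounded_iff by metis
  obtain C where C: "\<And>x. cmod (frechet_derivative \<phi> (at x) b) \<le> C"
    using bounded_test_function[OF test_functions_partial[OF \<phi> b]] by blast
  have [measurable]: "\<phi> \<in> borel_measurable borel"
    using test_function_sq_integrable[OF \<phi>] by (simp add: sq_integrable_def)
  have normb: "norm b = 1" using b by simp
  have line: "((\<lambda>t. \<phi> (x + t *\<^sub>R b)) has_vector_derivative frechet_derivative \<phi> (at (x + t *\<^sub>R b)) b) (at t within T)"
    for x t T
  proof -
    let ?D = "frechet_derivative \<phi> (at (x + t *\<^sub>R b))"
    have D: "(\<phi> has_derivative ?D) (at (x + t *\<^sub>R b))"
      using test_function_differentiable[OF \<phi>] by (simp add: frechet_derivative_works)
    have "((\<lambda>t. x + t *\<^sub>R b) has_derivative (\<lambda>h. h *\<^sub>R b)) (at t within T)"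
      by (auto intro!: derivative_eq_intros)
    then have "((\<lambda>t. \<phi> (x + t *\<^sub>R b)) has_derivative (\<lambda>h. ?D (h *\<^sub>R b))) (at t within T)"
      using D by (rule has_derivative_compose)
    moreover have "?D (h *\<^sub>R b) = h *\<^sub>R ?D b" for h
      using linear_cmul[OF has_derivative_linear[OF D]] .
    ultimately show ?thesis by (simp add: has_vector_derivative_def)
  qed
  define dq where "dq n x = real (Suc n) *\<^sub>R (\<phi> (x + (1 / real (Suc n)) *\<^sub>R b) - \<phi> x)" for n x
  have [measurable]: "dq n \<in> borel_measurable borel" for n
    unfolding dq_def by measurable
  have int_shift: "integrable lborel (\<lambda>x. \<phi> (x + c))" and integral_shift: "(\<integral>x. \<phi> (x + c) \<partial>lborel) = (\<integral>x. \<phi> x \<partial>lborel)" for c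
  proof -
    have "integrable (distr lborel borel ((+) c)) \<phi>"
      using test_function_integrable[OF \<phi>] by (simp add: lborel_distr_plus)
    then show "integrable lborel (\<lambda>x. \<phi> (x + c))"
      by (subst (asm) integrable_distr_eq) (auto simp: add.commute)
    have "(\<integral>x. \<phi> x \<partial>lborel) = (\<integral>x. \<phi> x \<partial>(distr lborel borel ((+) c)))"
      by (simp add: lborel_distr_plus)
    then show "(\<integral>x. \<phi> (x + c) \<partial>lborel) = (\<integral>x. \<phi> x \<partial>lborel)"
      by (subst (asm) integral_distr) (auto simp: add.commute)
  qed
  have zero: "(\<integral>x. dq n x \<partial>lborel) = 0" for n
    unfolding dq_def using int_shift integral_shift test_function_integrable[OF \<phi>] by simp
  have "(\<lambda>n. \<integral>x. dq n x \<partial>lborel) \<longlonglongrightarrow> (\<integral>x. frechet_derivative \<phi> (at x) b \<partial>lborel)"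
  proof (rule integral_dominated_convergence)
    show "(\<lambda>x. frechet_derivative \<phi> (at x) b) \<in> borel_measurable lborel"
      using test_function_sq_integrable[OF test_functions_partial[OF \<phi> b]] by (simp add: sq_integrable_def)
    show "integrable lborel (\<lambda>x. C * indicat_real (cball 0 (R + 1)) x)"
      using borel_integrable_compact[OF compact_cball continuous_on_const, of 0 "R + 1" C] by (simp add: mult.commute)
    show "AE x in lborel. (\<lambda>n. dq n x) \<longlonglongrightarrow> frechet_derivative \<phi> (at x) b"
    proof (rule AE_I2)
      fix x
      have "((\<lambda>t. (\<phi> (x + t *\<^sub>R b) - \<phi> x) /\<^sub>R t) \<longlongrightarrow> frechet_derivative \<phi> (at x) b) (at 0)"
        using line[of x 0 UNIV] unfolding has_vector_derivative_iff_quotient by simp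
      then have "((\<lambda>t. (\<phi> (x + t *\<^sub>R b) - \<phi> x) /\<^sub>R t) \<longlongrightarrow> frechet_derivative \<phi> (at x) b) (at_right 0)"
        by (rule filterlim_at_split[THEN iffD1, THEN conjunct2])
      moreover have "filterlim (\<lambda>n. 1 / real (Suc n)) (at_right 0) sequentially"
        using LIMSEQ_inverse_real_of_nat
        by (auto simp: filterlim_at inverse_eq_divide intro!: always_eventually)
      ultimately have "((\<lambda>n. (\<phi> (x + (1 / real (Suc n)) *\<^sub>R b) - \<phi> x) /\<^sub>R (1 / real (Suc n)))
          \<longlongrightarrow> frechet_derivative \<phi> (at x) b) sequentially"
        by (rule filterlim_compose)
      then show "(\<lambda>n. dq n x) \<longlonglongrightarrow> frechet_derivative \<phi> (at x) b"
        by (simp add: dq_def)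
    qed
    show "AE x in lborel. norm (dq n x) \<le> C * indicat_real (cball 0 (R + 1)) x" for n
    proof (rule AE_I2)
      fix x
      define h where "h = 1 / real (Suc n)"
      have h: "0 < h" "h \<le> 1" by (auto simp: h_def)
      show "norm (dq n x) \<le> C * indicat_real (cball 0 (R + 1)) x"
      proof (cases "x \<in> cball 0 (R + 1)")
        case True
        have "norm (\<phi> (x + h *\<^sub>R b) - \<phi> (x + 0 *\<^sub>R b)) \<le> C * norm (h - 0)"
        proof (rule differentiable_bound)
          show "convex {0..h}" by simp
          show "((\<lambda>t. \<phi> (x + t *\<^sub>R b)) has_derivative (\<lambda>s. s *\<^sub>R frechet_derivative \<phi> (at (x + t *\<^sub>R b)) b)) (at t within {0..h})" for t
            using line by (simp add: has_vector_derivative_def)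
          show "onorm (\<lambda>s. s *\<^sub>R frechet_derivative \<phi> (at (x + t *\<^sub>R b)) b) \<le> C" for t
          proof (rule onorm_le)
            fix s
            show "norm (s *\<^sub>R frechet_derivative \<phi> (at (x + t *\<^sub>R b)) b) \<le> C * norm s"
              using mult_left_mono[OF C[of "x + t *\<^sub>R b"], of "\<bar>s\<bar>"] by (simp add: mult.commute)
          qed
        qed (use h in auto)
        then have "real (Suc n) * norm (\<phi> (x + h *\<^sub>R b) - \<phi> x) \<le> C"
          using h by (simp add: h_def field_simps)
        with True show ?thesis by (simp add: dq_def h_def)
      next
        case False
        have "norm x \<le> norm (x + h *\<^sub>R b) + norm (h *\<^sub>R b)"
          using norm_triangle_ineq4[of "x + h *\<^sub>R b" "h *\<^sub>R b"] by simp
        then have "x \<notin> K" "x + h *\<^sub>R b \<notin> K"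
          using False R[of x] R[of "x + h *\<^sub>R b"] h normb by auto
        then have "\<phi> x = 0" "\<phi> (x + h *\<^sub>R b) = 0" by (simp_all only: K(3) simp_thms)
        then show ?thesis unfolding dq_def h_def[symmetric] using False by simp
      qed
    qed
  qed auto
  then show ?thesis
    using zero by (simp add: LIMSEQ_const_iff)
qed

lemma integration_by_parts_test_functions:
  assumes \<phi>: "\<phi> \<in> test_functions \<Omega>" and \<psi>: "\<psi> \<in> test_functions \<Omega>" and b: "b \<in> Basis"
  shows "(\<integral>x. \<phi> x * frechet_derivative \<psi> (at x) b \<partial>lborel) =
         - (\<integral>x. frechet_derivative \<phi> (at x) b * \<psi> x \<partial>lborel)"
proof -
  have "0 = (\<integral>x. frechet_derivative (\<lambda>x. \<phi> x * \<psi> x) (at x) b \<partial>lborel)"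
    using integral_partial_test_function[OF test_functions_mult[OF \<psi> test_functions_smooth[OF \<phi>]] b] by simp
  also have "\<dots> = (\<integral>x. \<phi> x * frechet_derivative \<psi> (at x) b + frechet_derivative \<phi> (at x) b * \<psi> x \<partial>lborel)"
    by (simp add: frechet_derivative_mult' test_function_differentiable[OF \<phi>] test_function_differentiable[OF \<psi>])
  also have "\<dots> = (\<integral>x. \<phi> x * frechet_derivative \<psi> (at x) b \<partial>lborel) + (\<integral>x. frechet_derivative \<phi> (at x) b * \<psi> x \<partial>lborel)"
    by (intro Bochner_Integration.integral_add test_function_integrable[of _ \<Omega>] test_functions_mult
        test_functions_smooth[OF \<phi>] test_functions_partial \<phi> \<psi> b test_functions_smooth[OF test_functions_partial[OF \<phi> b]])
  finally show ?thesis by (simp add: eq_neg_iff_add_eq_0)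
qed

lemma abs_test_in_l2_on:
  assumes "\<phi> \<in> test_functions \<Omega>"
  shows "abs_l2 \<phi> \<in> l2_on \<Omega>"
proof -
  obtain K where K: "compact K" "K \<subseteq> \<Omega>" "\<And>x. x \<notin> K \<Longrightarrow> \<phi> x = 0"
    using test_functionsE[OF assms] by blast
  then have zero: "\<phi> x = 0" if "x \<notin> \<Omega>" for x
    using that by blast
  show ?thesis
    unfolding l2_on_def mem_Collect_eq
    using rep_abs_AE[OF test_function_sq_integrable[OF assms]] by eventually_elim (simp add: zero)
qed

text \<open>
  In terms of inner products, weak derivatives can be treated by continuity and density. The conjugation in the
  inner product is harmless because conjugates of test functions are test functions.
\<close>

lemma has_weak_partial_iff:
  "has_weak_partial \<Omega> b f g \<longleftrightarrow> (\<forall>\<phi>\<in>test_functions \<Omega>.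
     l2_inner f (abs_l2 (\<lambda>x. frechet_derivative \<phi> (at x) b)) = - l2_inner g (abs_l2 \<phi>))"
  if b: "b \<in> Basis"
proof -
  have inner: "l2_inner h (abs_l2 \<phi>) = (\<integral>x. rep_l2 h x * cnj (\<phi> x) \<partial>lborel)" if "\<phi> \<in> test_functions \<Omega>" for h \<phi>
    using l2_inner_abs[OF sq_integrable_rep[of h] test_function_sq_integrable[OF that]] by simp
  have eq: "(\<integral>x. rep_l2 f x * frechet_derivative (\<lambda>x. cnj (\<phi> x)) (at x) b \<partial>lborel) =
        - (\<integral>x. rep_l2 g x * cnj (\<phi> x) \<partial>lborel) \<longleftrightarrow>
      l2_inner f (abs_l2 (\<lambda>x. frechet_derivative \<phi> (at x) b)) = - l2_inner g (abs_l2 \<phi>)"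
    if \<phi>: "\<phi> \<in> test_functions \<Omega>" for \<phi>
    by (simp add: inner[OF \<phi>] inner[OF test_functions_partial[OF \<phi> b]]
        frechet_derivative_cnj[OF test_function_differentiable[OF \<phi>]])
  show ?thesis
    unfolding has_weak_partial_def
  proof safe
    fix \<phi> assume \<phi>: "\<phi> \<in> test_functions \<Omega>"
    {
      assume "\<forall>\<phi>\<in>test_functions \<Omega>. (\<integral>x. rep_l2 f x * frechet_derivative \<phi> (at x) b \<partial>lborel) =
        - (\<integral>x. rep_l2 g x * \<phi> x \<partial>lborel)"
      then show "l2_inner f (abs_l2 (\<lambda>x. frechet_derivative \<phi> (at x) b)) = - l2_inner g (abs_l2 \<phi>)"
        using test_functions_cnj[OF \<phi>] eq[OF \<phi>] by blast
    next
      assume "\<forall>\<phi>\<in>test_functions \<Omega>.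
        l2_inner f (abs_l2 (\<lambda>x. frechet_derivative \<phi> (at x) b)) = - l2_inner g (abs_l2 \<phi>)"
      then show "(\<integral>x. rep_l2 f x * frechet_derivative \<phi> (at x) b \<partial>lborel) =
        - (\<integral>x. rep_l2 g x * \<phi> x \<partial>lborel)"
        using eq[OF test_functions_cnj[OF \<phi>]] test_functions_cnj[OF \<phi>] by simp
    }
  qed
qed

lemma has_weak_partial_add:
  assumes "b \<in> Basis" "has_weak_partial \<Omega> b f g" "has_weak_partial \<Omega> b f' g'"
  shows "has_weak_partial \<Omega> b (f + f') (g + g')"
  using assms by (simp add: has_weak_partial_iff l2_inner_add_left)

lemma has_weak_partial_scaleC:
  assumes "b \<in> Basis" "has_weak_partial \<Omega> b f g"
  shows "has_weak_partial \<Omega> b (scaleC_l2 c f) (scaleC_l2 c g)"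
  using assms by (simp add: has_weak_partial_iff l2_inner_scaleC_left)

lemma has_weak_partial_limit:
  assumes b: "b \<in> Basis" and w: "\<And>n. has_weak_partial \<Omega> b (f n) (g n)"
    and lim: "f \<longlonglongrightarrow> f'" "g \<longlonglongrightarrow> g'"
  shows "has_weak_partial \<Omega> b f' g'"
  unfolding has_weak_partial_iff[OF b]
proof
  fix \<phi> assume \<phi>: "\<phi> \<in> test_functions \<Omega>"
  have "(\<lambda>n. l2_inner (f n) (abs_l2 (\<lambda>x. frechet_derivative \<phi> (at x) b)))
      \<longlonglongrightarrow> l2_inner f' (abs_l2 (\<lambda>x. frechet_derivative \<phi> (at x) b))"
    by (intro tendsto_l2_inner lim tendsto_const)
  moreover have "(\<lambda>n. - l2_inner (g n) (abs_l2 \<phi>)) \<longlonglongrightarrow> - l2_inner g' (abs_l2 \<phi>)"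
    by (intro tendsto_minus tendsto_l2_inner lim tendsto_const)
  moreover have "l2_inner (f n) (abs_l2 (\<lambda>x. frechet_derivative \<phi> (at x) b)) = - l2_inner (g n) (abs_l2 \<phi>)" for n
    using w[of n] \<phi> by (simp add: has_weak_partial_iff[OF b])
  ultimately show "l2_inner f' (abs_l2 (\<lambda>x. frechet_derivative \<phi> (at x) b)) = - l2_inner g' (abs_l2 \<phi>)"
    using LIMSEQ_unique by simp
qed

lemma has_weak_partial_test:
  assumes \<phi>: "\<phi> \<in> test_functions \<Omega>" and b: "b \<in> Basis"
  shows "has_weak_partial \<Omega> b (abs_l2 \<phi>) (abs_l2 (\<lambda>x. frechet_derivative \<phi> (at x) b))"
  unfolding has_weak_partial_def
proof
  fix \<psi> assume \<psi>: "\<psi> \<in> test_functions \<Omega>"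
  have [measurable]: "\<phi> \<in> borel_measurable borel" "\<psi> \<in> borel_measurable borel"
    "(\<lambda>x. frechet_derivative \<phi> (at x) b) \<in> borel_measurable borel"
    "(\<lambda>x. frechet_derivative \<psi> (at x) b) \<in> borel_measurable borel"
    using test_functions_partial[OF _ b] \<phi> \<psi> test_function_sq_integrable unfolding sq_integrable_def by auto
  have "(\<integral>x. rep_l2 (abs_l2 \<phi>) x * frechet_derivative \<psi> (at x) b \<partial>lborel)
      = (\<integral>x. \<phi> x * frechet_derivative \<psi> (at x) b \<partial>lborel)"
    using rep_abs_AE[OF test_function_sq_integrable[OF \<phi>]] by (intro integral_cong_AE) auto
  moreover have "(\<integral>x. rep_l2 (abs_l2 (\<lambda>x. frechet_derivative \<phi> (at x) b)) x * \<psi> x \<partial>lborel)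
      = (\<integral>x. frechet_derivative \<phi> (at x) b * \<psi> x \<partial>lborel)"
    using rep_abs_AE[OF test_function_sq_integrable[OF test_functions_partial[OF \<phi> b]]]
    by (intro integral_cong_AE) auto
  ultimately show "(\<integral>x. rep_l2 (abs_l2 \<phi>) x * frechet_derivative \<psi> (at x) b \<partial>lborel) =
      - (\<integral>x. rep_l2 (abs_l2 (\<lambda>x. frechet_derivative \<phi> (at x) b)) x * \<psi> x \<partial>lborel)"
    using integration_by_parts_test_functions[OF \<phi> \<psi> b] by simp
qed

context
  fixes \<Omega> :: "'a::euclidean_space set"
  assumes \<Omega>: "open \<Omega>"
begin

text \<open>The uniqueness of weak derivatives rests on this consequence of density.\<close>

lemma l2_on_eq_zero:
  assumes g: "g \<in> l2_on \<Omega>" and orth: "\<And>\<phi>. \<phi> \<in> test_functions \<Omega> \<Longrightarrow> l2_inner g (abs_l2 \<phi>) = 0"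
  shows "g = 0"
proof -
  have "g \<in> closure (abs_l2 ` test_functions \<Omega>)"
    by (rule subsetD[OF test_functions_dense[OF \<Omega>] g])
  then obtain x where x: "\<And>n. x n \<in> abs_l2 ` test_functions \<Omega>" "x \<longlonglongrightarrow> g"
    unfolding closure_sequential by blast
  have "(\<lambda>n. l2_inner g (x n)) \<longlonglongrightarrow> l2_inner g g"
    by (intro tendsto_l2_inner x tendsto_const)
  moreover have "l2_inner g (x n) = 0" for n
    using x(1)[of n] orth by auto
  ultimately have "l2_inner g g = 0"
    by (simp add: LIMSEQ_const_iff)
  then show ?thesis by (simp add: l2_inner_self)
qed

lemma weak_partial_eqI:
  assumes b: "b \<in> Basis" and g: "g \<in> l2_on \<Omega>" "has_weak_partial \<Omega> b f g"
  shows "weak_partial \<Omega> b f = g"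
  unfolding weak_partial_def
proof (rule the_equality)
  fix g' assume g': "g' \<in> l2_on \<Omega> \<and> has_weak_partial \<Omega> b f g'"
  have "g' - g = 0"
  proof (rule l2_on_eq_zero)
    show "g' - g \<in> l2_on \<Omega>"
      using l2_on_add[OF _ l2_on_scaleC[OF g(1), of "-1"]] g' by (simp add: scaleC_l2_minus_left)
    fix \<phi> assume "\<phi> \<in> test_functions \<Omega>"
    then have "- l2_inner g' (abs_l2 \<phi>) = - l2_inner g (abs_l2 \<phi>)"
      using g(2) g' unfolding has_weak_partial_iff[OF b] by metis
    then show "l2_inner (g' - g) (abs_l2 \<phi>) = 0" by (simp add: l2_inner_diff_left)
  qed
  then show "g' = g" by simp
qed (use g in simp)

lemma weak_partial_H1:
  assumes "f \<in> H1 \<Omega>" "b \<in> Basis"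
  shows "weak_partial \<Omega> b f \<in> l2_on \<Omega>" "has_weak_partial \<Omega> b f (weak_partial \<Omega> b f)"
proof -
  obtain g where g: "g \<in> l2_on \<Omega>" "has_weak_partial \<Omega> b f g"
    using assms by (auto simp: H1_def)
  then show "weak_partial \<Omega> b f \<in> l2_on \<Omega>" "has_weak_partial \<Omega> b f (weak_partial \<Omega> b f)"
    using weak_partial_eqI[OF assms(2) g] by auto
qed

lemma H1_I:
  assumes "f \<in> l2_on \<Omega>" "\<And>b. b \<in> Basis \<Longrightarrow> g b \<in> l2_on \<Omega>" "\<And>b. b \<in> Basis \<Longrightarrow> has_weak_partial \<Omega> b f (g b)"
  shows "f \<in> H1 \<Omega>"
  using assms by (auto simp: H1_def)

lemma H1_add:
  assumes f: "f \<in> H1 \<Omega>" and g: "g \<in> H1 \<Omega>"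
  shows "f + g \<in> H1 \<Omega>"
    and "b \<in> Basis \<Longrightarrow> weak_partial \<Omega> b (f + g) = weak_partial \<Omega> b f + weak_partial \<Omega> b g"
proof -
  have *: "weak_partial \<Omega> b f + weak_partial \<Omega> b g \<in> l2_on \<Omega>"
    "has_weak_partial \<Omega> b (f + g) (weak_partial \<Omega> b f + weak_partial \<Omega> b g)" if "b \<in> Basis" for b
    using that weak_partial_H1[OF f] weak_partial_H1[OF g] by (auto intro: l2_on_add has_weak_partial_add)
  show "f + g \<in> H1 \<Omega>"
    using f g by (intro H1_I[OF _ *]) (auto simp: H1_def intro: l2_on_add)
  show "b \<in> Basis \<Longrightarrow> weak_partial \<Omega> b (f + g) = weak_partial \<Omega> b f + weak_partial \<Omega> b g"
    by (intro weak_partial_eqI *)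
qed

lemma H1_scaleC:
  assumes f: "f \<in> H1 \<Omega>"
  shows "scaleC_l2 c f \<in> H1 \<Omega>"
    and "b \<in> Basis \<Longrightarrow> weak_partial \<Omega> b (scaleC_l2 c f) = scaleC_l2 c (weak_partial \<Omega> b f)"
proof -
  have *: "scaleC_l2 c (weak_partial \<Omega> b f) \<in> l2_on \<Omega>"
    "has_weak_partial \<Omega> b (scaleC_l2 c f) (scaleC_l2 c (weak_partial \<Omega> b f))" if "b \<in> Basis" for b
    using that weak_partial_H1[OF f] by (auto intro: l2_on_scaleC has_weak_partial_scaleC)
  show "scaleC_l2 c f \<in> H1 \<Omega>"
    using f by (intro H1_I[OF _ *]) (auto simp: H1_def intro: l2_on_scaleC)
  show "b \<in> Basis \<Longrightarrow> weak_partial \<Omega> b (scaleC_l2 c f) = scaleC_l2 c (weak_partial \<Omega> b f)"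
    by (intro weak_partial_eqI *)
qed

lemma abs_test_in_H1:
  assumes \<phi>: "\<phi> \<in> test_functions \<Omega>"
  shows "abs_l2 \<phi> \<in> H1 \<Omega>"
  by (rule H1_I[OF abs_test_in_l2_on[OF \<phi>] abs_test_in_l2_on[OF test_functions_partial[OF \<phi>]] has_weak_partial_test[OF \<phi>]])

lemma H1_zero: "0 \<in> H1 \<Omega>"
  using abs_test_in_H1[OF test_functions_zero] by (simp add: zero_l2_def)

lemma H1_diff:
  assumes "f \<in> H1 \<Omega>" "g \<in> H1 \<Omega>"
  shows "f - g \<in> H1 \<Omega>"
    and "b \<in> Basis \<Longrightarrow> weak_partial \<Omega> b (f - g) = weak_partial \<Omega> b f - weak_partial \<Omega> b g"
proof -
  have eq: "f - g = f + scaleC_l2 (-1) g" by (simp add: scaleC_l2_minus_left)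
  show "f - g \<in> H1 \<Omega>"
    unfolding eq by (rule H1_add(1)[OF assms(1) H1_scaleC(1)[OF assms(2)]])
  assume b: "b \<in> Basis"
  show "weak_partial \<Omega> b (f - g) = weak_partial \<Omega> b f - weak_partial \<Omega> b g"
    unfolding eq H1_add(2)[OF assms(1) H1_scaleC(1)[OF assms(2)] b] H1_scaleC(2)[OF assms(2) b]
    by (simp add: scaleC_l2_minus_left)
qed

end

text \<open>The Sobolev norm is the Euclidean norm of the tuple of the norms of \<open>f\<close> and its partials.\<close>

definition jet_norm :: "'a::euclidean_space set \<Rightarrow> 'a l2 \<Rightarrow> 'a option \<Rightarrow> real" where
  "jet_norm \<Omega> f i = (case i of None \<Rightarrow> norm f | Some b \<Rightarrow> norm (weak_partial \<Omega> b f))"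

abbreviation jet_indices :: "'a::euclidean_space option set" where
  "jet_indices \<equiv> insert None (Some ` Basis)"

lemma H1_norm_L2_set: "H1_norm \<Omega> f = L2_set (jet_norm \<Omega> f) jet_indices"
  by (simp add: H1_norm_def H1_inner_def L2_set_def jet_norm_def l2_inner_self sum.reindex)

lemma H1_norm_power2: "(H1_norm \<Omega> f)\<^sup>2 = (norm f)\<^sup>2 + (\<Sum>b\<in>Basis. (norm (weak_partial \<Omega> b f))\<^sup>2)"
  by (simp add: H1_norm_def H1_inner_def l2_inner_self add_nonneg_nonneg sum_nonneg)

lemma norm_le_H1_norm: "norm f \<le> H1_norm \<Omega> f"
  using member_le_L2_set[of jet_indices None "jet_norm \<Omega> f"] by (simp add: H1_norm_L2_set jet_norm_def)

lemma H1_norm_nonneg: "0 \<le> H1_norm \<Omega> f"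
  by (rule order_trans[OF norm_ge_zero norm_le_H1_norm])

lemma norm_weak_partial_le_H1_norm: "b \<in> Basis \<Longrightarrow> norm (weak_partial \<Omega> b f) \<le> H1_norm \<Omega> f"
  using member_le_L2_set[of jet_indices "Some b" "jet_norm \<Omega> f"] by (simp add: H1_norm_L2_set jet_norm_def)

context
  fixes \<Omega> :: "'a::euclidean_space set"
  assumes \<Omega>: "open \<Omega>"
begin

lemma H1_norm_add:
  assumes "f \<in> H1 \<Omega>" "g \<in> H1 \<Omega>"
  shows "H1_norm \<Omega> (f + g) \<le> H1_norm \<Omega> f + H1_norm \<Omega> g"
proof -
  have "jet_norm \<Omega> (f + g) i \<le> jet_norm \<Omega> f i + jet_norm \<Omega> g i" if "i \<in> jet_indices" for i
    using that by (auto simp: jet_norm_def H1_add(2)[OF \<Omega> assms] norm_triangle_ineq)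
  then have "L2_set (jet_norm \<Omega> (f + g)) jet_indices \<le> L2_set (\<lambda>i. jet_norm \<Omega> f i + jet_norm \<Omega> g i) jet_indices"
    by (intro L2_set_mono) (auto simp: jet_norm_def split: option.split)
  also have "\<dots> \<le> L2_set (jet_norm \<Omega> f) jet_indices + L2_set (jet_norm \<Omega> g) jet_indices"
    by (rule L2_set_triangle_ineq)
  finally show ?thesis by (simp only: H1_norm_L2_set)
qed

lemma H1_norm_scaleC:
  assumes "f \<in> H1 \<Omega>"
  shows "H1_norm \<Omega> (scaleC_l2 c f) = cmod c * H1_norm \<Omega> f"
proof -
  have "(H1_norm \<Omega> (scaleC_l2 c f))\<^sup>2 = (cmod c * H1_norm \<Omega> f)\<^sup>2"
    by (simp add: H1_norm_power2 H1_scaleC(2)[OF \<Omega> assms] norm_scaleC_l2 power_mult_distrib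
        distrib_left sum_distrib_left)
  then show ?thesis
    by (simp add: power2_eq_iff_nonneg H1_norm_nonneg)
qed

lemma H1_norm_parallelogram:
  assumes "f \<in> H1 \<Omega>" "g \<in> H1 \<Omega>"
  shows "(H1_norm \<Omega> (f + g))\<^sup>2 + (H1_norm \<Omega> (f - g))\<^sup>2 = 2 * (H1_norm \<Omega> f)\<^sup>2 + 2 * (H1_norm \<Omega> g)\<^sup>2"
proof -
  have par: "(norm (u + v))\<^sup>2 + (norm (u - v))\<^sup>2 = 2 * (norm u)\<^sup>2 + 2 * (norm v)\<^sup>2" for u v :: "'a l2"
    by (simp add: power2_norm_eq_inner inner_add inner_diff inner_commute)
  have "(\<Sum>b\<in>Basis. (norm (weak_partial \<Omega> b (f + g)))\<^sup>2) + (\<Sum>b\<in>Basis. (norm (weak_partial \<Omega> b (f - g)))\<^sup>2)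
      = (\<Sum>b\<in>Basis. 2 * (norm (weak_partial \<Omega> b f))\<^sup>2 + 2 * (norm (weak_partial \<Omega> b g))\<^sup>2)"
    unfolding sum.distrib[symmetric]
    by (intro sum.cong refl) (simp add: H1_add(2)[OF \<Omega> assms] H1_diff(2)[OF \<Omega> assms] par)
  then show ?thesis
    using par[of f g] by (simp add: H1_norm_power2 sum.distrib sum_distrib_left)
qed

text \<open>
  A Cauchy sequence and its partials converge in \<open>L\<^sup>2\<close>, and the relation between a function and its weak
  partials is preserved in the limit.
\<close>

lemma H1_complete:
  assumes X: "\<And>n. X n \<in> H1 \<Omega>" and cauchy: "\<And>e. e > 0 \<Longrightarrow> \<exists>M. \<forall>m\<ge>M. \<forall>n\<ge>M. H1_norm \<Omega> (X m - X n) < e"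
  shows "\<exists>f\<in>H1 \<Omega>. (\<lambda>n. H1_norm \<Omega> (X n - f)) \<longlonglongrightarrow> 0"
proof -
  have closed: "closed (l2_on \<Omega>)" using \<Omega> by (intro closed_l2_on) simp
  have "Cauchy X"
    unfolding Cauchy_def dist_norm
    using cauchy order.strict_trans1[OF norm_le_H1_norm] by meson
  then obtain f where f: "X \<longlonglongrightarrow> f" using Cauchy_convergent convergent_def by blast
  have "\<exists>g. (\<lambda>n. weak_partial \<Omega> b (X n)) \<longlonglongrightarrow> g" if b: "b \<in> Basis" for b
  proof -
    have "Cauchy (\<lambda>n. weak_partial \<Omega> b (X n))"
      unfolding Cauchy_def dist_norm H1_diff(2)[OF \<Omega> X X b, symmetric]
      using cauchy order.strict_trans1[OF norm_weak_partial_le_H1_norm[OF b]] by meson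
    then show ?thesis using Cauchy_convergent convergent_def by blast
  qed
  then obtain g where g: "\<And>b. b \<in> Basis \<Longrightarrow> (\<lambda>n. weak_partial \<Omega> b (X n)) \<longlonglongrightarrow> g b" by metis
  have f_in: "f \<in> l2_on \<Omega>"
    using closed_sequentially[OF closed _ f] X by (auto simp: H1_def)
  have g_in: "g b \<in> l2_on \<Omega>" if "b \<in> Basis" for b
    using closed_sequentially[OF closed _ g[OF that]] weak_partial_H1(1)[OF \<Omega> X that] by blast
  have weak: "has_weak_partial \<Omega> b f (g b)" if b: "b \<in> Basis" for b
    by (rule has_weak_partial_limit[OF b weak_partial_H1(2)[OF \<Omega> X b] f g[OF b]])
  have fH: "f \<in> H1 \<Omega>" by (rule H1_I[OF \<Omega> f_in g_in weak])
  have "(\<lambda>n. (H1_norm \<Omega> (X n - f))\<^sup>2) \<longlonglongrightarrow> 0"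
  proof -
    have "(H1_norm \<Omega> (X n - f))\<^sup>2 = (norm (X n - f))\<^sup>2 + (\<Sum>b\<in>Basis. (norm (weak_partial \<Omega> b (X n) - g b))\<^sup>2)" for n
      by (simp add: H1_norm_power2 H1_diff(2)[OF \<Omega> X fH] weak_partial_eqI[OF \<Omega> _ g_in weak])
    moreover have "(\<lambda>n. (norm (X n - f))\<^sup>2 + (\<Sum>b\<in>Basis. (norm (weak_partial \<Omega> b (X n) - g b))\<^sup>2))
        \<longlonglongrightarrow> (norm (f - f))\<^sup>2 + (\<Sum>b\<in>Basis. (norm (g b - g b))\<^sup>2)"
      by (intro tendsto_intros f g)
    ultimately show ?thesis by simp
  qed
  then have "(\<lambda>n. sqrt ((H1_norm \<Omega> (X n - f))\<^sup>2)) \<longlonglongrightarrow> sqrt 0"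
    by (rule tendsto_real_sqrt)
  then have "(\<lambda>n. H1_norm \<Omega> (X n - f)) \<longlonglongrightarrow> 0"
    by (simp add: H1_norm_nonneg)
  with fH show ?thesis by blast
qed

lemma H10_subset_H1: "H10 \<Omega> \<subseteq> H1 \<Omega>"
  by (auto simp: H10_def)

lemma abs_test_in_H10: "\<phi> \<in> test_functions \<Omega> \<Longrightarrow> abs_l2 \<phi> \<in> H10 \<Omega>"
  unfolding H10_def
proof (intro CollectI conjI allI impI)
  assume \<phi>: "\<phi> \<in> test_functions \<Omega>"
  show "abs_l2 \<phi> \<in> H1 \<Omega>" by (rule abs_test_in_H1[OF \<Omega> \<phi>])
  have "H1_norm \<Omega> (abs_l2 \<phi> - abs_l2 \<phi>) = 0"
    using H1_norm_scaleC[OF H1_zero[OF \<Omega>], of 0] by simp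
  with \<phi> show "\<exists>\<psi>\<in>test_functions \<Omega>. H1_norm \<Omega> (abs_l2 \<phi> - abs_l2 \<psi>) < e" if "0 < e" for e
    using that by (intro bexI[of _ \<phi>]) simp_all
qed

lemma H10_closed:
  assumes f: "f \<in> H1 \<Omega>" and approx: "\<And>e. e > 0 \<Longrightarrow> \<exists>g\<in>H10 \<Omega>. H1_norm \<Omega> (f - g) < e"
  shows "f \<in> H10 \<Omega>"
  unfolding H10_def
proof (intro CollectI conjI allI impI f)
  fix e :: real assume "0 < e"
  then obtain g where g: "g \<in> H10 \<Omega>" "H1_norm \<Omega> (f - g) < e/2"
    using approx[of "e/2"] by auto
  obtain \<phi> where \<phi>: "\<phi> \<in> test_functions \<Omega>" "H1_norm \<Omega> (g - abs_l2 \<phi>) < e/2"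
    using g(1) \<open>0 < e\<close> unfolding H10_def by (fastforce dest: spec[of _ "e/2"])
  have gH: "g \<in> H1 \<Omega>" using g(1) H10_subset_H1 by blast
  have "H1_norm \<Omega> ((f - g) + (g - abs_l2 \<phi>)) \<le> H1_norm \<Omega> (f - g) + H1_norm \<Omega> (g - abs_l2 \<phi>)"
    by (intro H1_norm_add H1_diff[OF \<Omega>] f gH abs_test_in_H1[OF \<Omega> \<phi>(1)])
  with g(2) \<phi> show "\<exists>\<phi>\<in>test_functions \<Omega>. H1_norm \<Omega> (f - abs_l2 \<phi>) < e"
    by (intro bexI[of _ \<phi>]) auto
qed

lemma H10_zero: "0 \<in> H10 \<Omega>"
  using abs_test_in_H10[OF test_functions_zero] by (simp add: zero_l2_def)

lemma H10_add:
  assumes f: "f \<in> H10 \<Omega>" and g: "g \<in> H10 \<Omega>"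
  shows "f + g \<in> H10 \<Omega>"
proof (rule H10_closed)
  have H: "f \<in> H1 \<Omega>" "g \<in> H1 \<Omega>" using f g H10_subset_H1 by auto
  show "f + g \<in> H1 \<Omega>" by (rule H1_add(1)[OF \<Omega> H])
  fix e :: real assume "0 < e"
  then obtain \<phi> \<psi> where t: "\<phi> \<in> test_functions \<Omega>" "H1_norm \<Omega> (f - abs_l2 \<phi>) < e/2"
    "\<psi> \<in> test_functions \<Omega>" "H1_norm \<Omega> (g - abs_l2 \<psi>) < e/2"
    using f g half_gt_zero unfolding H10_def by blast
  have "abs_l2 \<phi> + abs_l2 \<psi> = abs_l2 (\<lambda>x. \<phi> x + \<psi> x)"
    using t by (intro abs_l2_add[symmetric] test_function_sq_integrable)
  then have mem: "abs_l2 \<phi> + abs_l2 \<psi> \<in> H10 \<Omega>"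
    using abs_test_in_H10[OF test_functions_add[OF t(1,3)]] by simp
  have "H1_norm \<Omega> ((f - abs_l2 \<phi>) + (g - abs_l2 \<psi>)) \<le> H1_norm \<Omega> (f - abs_l2 \<phi>) + H1_norm \<Omega> (g - abs_l2 \<psi>)"
    by (intro H1_norm_add H1_diff[OF \<Omega>] H abs_test_in_H1[OF \<Omega>] t)
  moreover have "(f - abs_l2 \<phi>) + (g - abs_l2 \<psi>) = (f + g) - (abs_l2 \<phi> + abs_l2 \<psi>)" by simp
  ultimately have "H1_norm \<Omega> ((f + g) - (abs_l2 \<phi> + abs_l2 \<psi>))
      \<le> H1_norm \<Omega> (f - abs_l2 \<phi>) + H1_norm \<Omega> (g - abs_l2 \<psi>)" by (simp only:)
  then have "H1_norm \<Omega> ((f + g) - (abs_l2 \<phi> + abs_l2 \<psi>)) < e"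
    using t(2,4) by linarith
  with mem show "\<exists>h\<in>H10 \<Omega>. H1_norm \<Omega> (f + g - h) < e" by blast
qed

lemma H10_scaleC:
  assumes f: "f \<in> H10 \<Omega>"
  shows "scaleC_l2 c f \<in> H10 \<Omega>"
proof (rule H10_closed)
  have H: "f \<in> H1 \<Omega>" using f H10_subset_H1 by auto
  show "scaleC_l2 c f \<in> H1 \<Omega>" by (rule H1_scaleC(1)[OF \<Omega> H])
  fix e :: real assume "0 < e"
  then have "0 < e / (cmod c + 1)" by (simp add: add_nonneg_pos)
  then obtain \<phi> where \<phi>: "\<phi> \<in> test_functions \<Omega>" "H1_norm \<Omega> (f - abs_l2 \<phi>) < e / (cmod c + 1)"
    using f unfolding H10_def by blast
  have "scaleC_l2 c (abs_l2 \<phi>) = abs_l2 (\<lambda>x. c * \<phi> x)"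
    using \<phi> by (intro abs_l2_scaleC[symmetric] test_function_sq_integrable)
  then have mem: "scaleC_l2 c (abs_l2 \<phi>) \<in> H10 \<Omega>"
    using abs_test_in_H10[OF test_functions_cmult[OF \<phi>(1)]] by simp
  have "H1_norm \<Omega> (scaleC_l2 c f - scaleC_l2 c (abs_l2 \<phi>)) = cmod c * H1_norm \<Omega> (f - abs_l2 \<phi>)"
    using H1_norm_scaleC[OF H1_diff(1)[OF \<Omega> H abs_test_in_H1[OF \<Omega> \<phi>(1)]], of c]
    by (simp add: scaleC_l2_diff_right)
  also have "\<dots> \<le> cmod c * (e / (cmod c + 1))"
    using \<phi>(2) by (intro mult_left_mono) auto
  also have "\<dots> < e"
    using \<open>0 < e\<close> by (simp add: divide_less_eq add_nonneg_pos)
  finally show "\<exists>h\<in>H10 \<Omega>. H1_norm \<Omega> (scaleC_l2 c f - h) < e" using mem by blast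
qed

lemma H10_complete:
  assumes X: "\<And>n. X n \<in> H10 \<Omega>" and cauchy: "\<And>e. e > 0 \<Longrightarrow> \<exists>M. \<forall>m\<ge>M. \<forall>n\<ge>M. H1_norm \<Omega> (X m - X n) < e"
  shows "\<exists>f\<in>H10 \<Omega>. (\<lambda>n. H1_norm \<Omega> (X n - f)) \<longlonglongrightarrow> 0"
proof -
  have XH: "X n \<in> H1 \<Omega>" for n using X H10_subset_H1 by blast
  obtain f where f: "f \<in> H1 \<Omega>" "(\<lambda>n. H1_norm \<Omega> (X n - f)) \<longlonglongrightarrow> 0"
    using H1_complete[OF XH cauchy] by blast
  have "f \<in> H10 \<Omega>"
  proof (rule H10_closed[OF f(1)])
    fix e :: real assume "0 < e"
    then obtain n where "H1_norm \<Omega> (X n - f) < e"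
      using order_tendstoD(2)[OF f(2)] eventually_sequentially by fastforce
    moreover have "H1_norm \<Omega> (f - X n) = H1_norm \<Omega> (X n - f)"
      using H1_norm_scaleC[OF H1_diff(1)[OF \<Omega> XH[of n] f(1)], of "-1"] by (simp add: scaleC_l2_minus_left)
    ultimately show "\<exists>g\<in>H10 \<Omega>. H1_norm \<Omega> (f - g) < e"
      using X[of n] by (intro bexI[of _ "X n"]) simp_all
  qed
  with f show ?thesis by blast
qed

lemma H10_subset_l2_on: "H10 \<Omega> \<subseteq> l2_on \<Omega>"
  by (auto simp: H10_def H1_def)

lemma H10_dense: "l2_on \<Omega> \<subseteq> closure (H10 \<Omega>)"
proof -
  have "abs_l2 ` test_functions \<Omega> \<subseteq> H10 \<Omega>" using abs_test_in_H10 by blast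
  then show ?thesis
    using test_functions_dense[OF \<Omega>] closure_mono by blast
qed

end

section \<open>Bounded operators on a normed subspace\<close>

lemma scaleC_l2_scaleR: "scaleC_l2 c (r *\<^sub>R f) = r *\<^sub>R scaleC_l2 c f"
  by (simp add: mult.commute flip: scaleC_l2_of_real)

text \<open>
  The spaces \<open>L\<^sup>2(\<Omega>)\<close> and \<open>H\<^sup>1\<^sub>0(\<Omega>)\<close> are subsets of one type, each with its own norm, and both norms
  dominate the norm of \<open>L\<^sup>2\<close>. Hence \<open>N\<close> is definite, and limits in \<open>N\<close> are limits in the topology of the type.
\<close>

locale normed_subspace =
  fixes S :: "'a::euclidean_space l2 set" and N :: "'a l2 \<Rightarrow> real"
  assumes zero_mem: "0 \<in> S"
    and add_mem: "f \<in> S \<Longrightarrow> g \<in> S \<Longrightarrow> f + g \<in> S"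
    and scaleC_mem: "f \<in> S \<Longrightarrow> scaleC_l2 c f \<in> S"
    and N_add: "f \<in> S \<Longrightarrow> g \<in> S \<Longrightarrow> N (f + g) \<le> N f + N g"
    and N_scaleC: "f \<in> S \<Longrightarrow> N (scaleC_l2 c f) = cmod c * N f"
    and norm_le_N: "f \<in> S \<Longrightarrow> norm f \<le> N f"
begin

lemma scaleR_mem: "f \<in> S \<Longrightarrow> r *\<^sub>R f \<in> S"
  using scaleC_mem[of f "of_real r"] by (simp add: scaleC_l2_of_real)

lemma minus_mem: "f \<in> S \<Longrightarrow> - f \<in> S"
  using scaleC_mem[of f "-1"] by (simp add: scaleC_l2_minus_left)

lemma diff_mem: "f \<in> S \<Longrightarrow> g \<in> S \<Longrightarrow> f - g \<in> S"
  using add_mem[of f "- g"] minus_mem[of g] by simp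

lemma sum_mem: "(\<And>i. i \<in> I \<Longrightarrow> f i \<in> S) \<Longrightarrow> (\<Sum>i\<in>I. f i) \<in> S"
  by (induction I rule: infinite_finite_induct) (simp_all add: zero_mem add_mem)

lemma N_nonneg: "f \<in> S \<Longrightarrow> 0 \<le> N f"
  using norm_le_N[of f] norm_ge_zero[of f] by linarith

lemma N_zero [simp]: "N 0 = 0"
  using N_scaleC[OF zero_mem, of 0] by simp

lemma N_eq_0: "f \<in> S \<Longrightarrow> N f = 0 \<Longrightarrow> f = 0"
  using norm_le_N[of f] by simp

lemma N_minus: "f \<in> S \<Longrightarrow> N (- f) = N f"
  using N_scaleC[of f "-1"] by (simp add: scaleC_l2_minus_left)

lemma N_diff: "f \<in> S \<Longrightarrow> g \<in> S \<Longrightarrow> N (f - g) \<le> N f + N g"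
  using N_add[of f "- g"] minus_mem[of g] N_minus[of g] by simp

lemma N_minus_commute: "f \<in> S \<Longrightarrow> g \<in> S \<Longrightarrow> N (f - g) = N (g - f)"
  using N_minus[of "f - g"] diff_mem[of f g] by simp

lemma N_scaleR: "f \<in> S \<Longrightarrow> N (r *\<^sub>R f) = \<bar>r\<bar> * N f"
  using N_scaleC[of f "of_real r"] by (simp add: scaleC_l2_of_real)

lemma N_sum: "(\<And>i. i \<in> I \<Longrightarrow> f i \<in> S) \<Longrightarrow> N (\<Sum>i\<in>I. f i) \<le> (\<Sum>i\<in>I. N (f i))"
proof (induction I rule: infinite_finite_induct)
  case (insert i I)
  have "N (\<Sum>i\<in>insert i I. f i) \<le> N (f i) + N (\<Sum>i\<in>I. f i)"
    using N_add[of "f i" "\<Sum>i\<in>I. f i"] insert sum_mem[of I f] by simp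
  with insert show ?case by simp
qed simp_all

lemma tendsto_of_N:
  assumes "\<And>n. f n \<in> S" "g \<in> S" "((\<lambda>n. N (f n - g)) \<longlongrightarrow> 0) F"
  shows "(f \<longlongrightarrow> g) F"
proof -
  have "((\<lambda>n. f n - g) \<longlongrightarrow> 0) F"
    by (rule Lim_null_comparison[OF always_eventually assms(3)]) (simp add: norm_le_N diff_mem assms)
  then show ?thesis by (simp add: LIM_zero_iff)
qed

text \<open>
  Bounded operators on \<open>S\<close> with arbitrary values outside \<open>S\<close>. Unlike \<^const>\<open>bounded_ops\<close> this contains the powers
  \<open>X ^^ k\<close> for \<open>k = 0\<close>, which occur in the exponential series, and it is closed under all constructions below.
\<close>

definition bop :: "('a l2 \<Rightarrow> 'a l2) \<Rightarrow> bool" where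
  "bop T \<longleftrightarrow> (\<forall>f\<in>S. T f \<in> S) \<and> (\<forall>f\<in>S. \<forall>g\<in>S. T (f + g) = T f + T g) \<and>
     (\<forall>c. \<forall>f\<in>S. T (scaleC_l2 c f) = scaleC_l2 c (T f)) \<and> (\<exists>C. \<forall>f\<in>S. N (T f) \<le> C * N f)"

lemma bounded_ops_iff: "T \<in> bounded_ops S N \<longleftrightarrow> bop T \<and> (\<forall>f. f \<notin> S \<longrightarrow> T f = 0)"
  unfolding bounded_ops_def bop_def by blast

lemma bopI:
  assumes "\<And>f. f \<in> S \<Longrightarrow> T f \<in> S" "\<And>f g. f \<in> S \<Longrightarrow> g \<in> S \<Longrightarrow> T (f + g) = T f + T g"
    "\<And>c f. f \<in> S \<Longrightarrow> T (scaleC_l2 c f) = scaleC_l2 c (T f)" "\<And>f. f \<in> S \<Longrightarrow> N (T f) \<le> C * N f"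
  shows "bop T"
  using assms unfolding bop_def by blast

lemma bop_mem: "bop T \<Longrightarrow> f \<in> S \<Longrightarrow> T f \<in> S"
  by (simp add: bop_def)

lemma bop_add: "bop T \<Longrightarrow> f \<in> S \<Longrightarrow> g \<in> S \<Longrightarrow> T (f + g) = T f + T g"
  by (simp add: bop_def)

lemma bop_scaleC: "bop T \<Longrightarrow> f \<in> S \<Longrightarrow> T (scaleC_l2 c f) = scaleC_l2 c (T f)"
  by (simp add: bop_def)

lemma bop_scaleR: "bop T \<Longrightarrow> f \<in> S \<Longrightarrow> T (r *\<^sub>R f) = r *\<^sub>R T f"
  using bop_scaleC[of T f "of_real r"] by (simp add: scaleC_l2_of_real)

lemma bop_zero: "bop T \<Longrightarrow> T 0 = 0"
  using bop_scaleC[OF _ zero_mem, of T 0] by simp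

lemma bop_minus: "bop T \<Longrightarrow> f \<in> S \<Longrightarrow> T (- f) = - T f"
  using bop_scaleC[of T f "-1"] by (simp add: scaleC_l2_minus_left)

lemma bop_diff: "bop T \<Longrightarrow> f \<in> S \<Longrightarrow> g \<in> S \<Longrightarrow> T (f - g) = T f - T g"
  using bop_add[of T f "- g"] bop_minus[of T g] minus_mem[of g] by simp

lemma bop_sum: "bop T \<Longrightarrow> (\<And>i. i \<in> I \<Longrightarrow> f i \<in> S) \<Longrightarrow> T (\<Sum>i\<in>I. f i) = (\<Sum>i\<in>I. T (f i))"
proof (induction I rule: infinite_finite_induct)
  case (insert i I)
  then show ?case using bop_add[of T "f i" "\<Sum>i\<in>I. f i"] sum_mem[of I f] by simp
qed (simp_all add: bop_zero)

lemma bop_bound: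
  assumes "bop T"
  obtains C where "0 \<le> C" "\<And>f. f \<in> S \<Longrightarrow> N (T f) \<le> C * N f"
proof -
  obtain C where C: "\<forall>f\<in>S. N (T f) \<le> C * N f" using assms unfolding bop_def by blast
  have "N (T f) \<le> max C 0 * N f" if "f \<in> S" for f
    using C[rule_format, OF that] mult_right_mono[OF max.cobounded1[of C 0] N_nonneg[OF that]] by linarith
  then show thesis using that[of "max C 0"] by simp
qed

lemma bop_id: "bop (\<lambda>f. f)"
  by (rule bopI[where C = 1]) simp_all

lemma bop_comp:
  assumes T: "bop T" and U: "bop U"
  shows "bop (\<lambda>f. T (U f))"
proof -
  obtain C where C: "0 \<le> C" "\<And>f. f \<in> S \<Longrightarrow> N (T f) \<le> C * N f" using bop_bound[OF T] by blast
  obtain D where D: "0 \<le> D" "\<And>f. f \<in> S \<Longrightarrow> N (U f) \<le> D * N f" using bop_bound[OF U] by blast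
  have "N (T (U f)) \<le> (C * D) * N f" if "f \<in> S" for f
    using C(2)[OF bop_mem[OF U that]] mult_left_mono[OF D(2)[OF that] C(1)] by (simp add: mult.assoc)
  then show ?thesis
    by (intro bopI) (simp_all add: bop_mem[OF T] bop_mem[OF U] bop_add[OF T] bop_add[OF U]
        bop_scaleC[OF T] bop_scaleC[OF U])
qed

lemma bop_funpow: "bop T \<Longrightarrow> bop (T ^^ n)"
proof (induction n)
  case 0
  then show ?case using bop_id by (simp add: id_def)
next
  case (Suc n)
  then show ?case using bop_comp[of T "T ^^ n"] by (simp add: o_def)
qed

lemma bop_add_op:
  assumes T: "bop T" and U: "bop U"
  shows "bop (\<lambda>f. T f + U f)"
proof -
  obtain C where C: "0 \<le> C" "\<And>f. f \<in> S \<Longrightarrow> N (T f) \<le> C * N f" using bop_bound[OF T] by blast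
  obtain D where D: "0 \<le> D" "\<And>f. f \<in> S \<Longrightarrow> N (U f) \<le> D * N f" using bop_bound[OF U] by blast
  have "N (T f + U f) \<le> (C + D) * N f" if "f \<in> S" for f
    using N_add[OF bop_mem[OF T that] bop_mem[OF U that]] C(2)[OF that] D(2)[OF that]
    by (simp add: distrib_right)
  then show ?thesis
    by (intro bopI) (simp_all add: bop_mem[OF T] bop_mem[OF U] bop_add[OF T] bop_add[OF U]
        bop_scaleC[OF T] bop_scaleC[OF U] add_mem scaleC_l2_add_right)
qed

lemma bop_scaleC_op:
  assumes T: "bop T"
  shows "bop (\<lambda>f. scaleC_l2 c (T f))"
proof -
  obtain C where C: "0 \<le> C" "\<And>f. f \<in> S \<Longrightarrow> N (T f) \<le> C * N f" using bop_bound[OF T] by blast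
  have "N (scaleC_l2 c (T f)) \<le> (cmod c * C) * N f" if "f \<in> S" for f
    using mult_left_mono[OF C(2)[OF that] norm_ge_zero[of c]] by (simp add: N_scaleC bop_mem[OF T that] mult.assoc)
  then show ?thesis
    by (intro bopI) (simp_all add: bop_mem[OF T] bop_add[OF T] bop_scaleC[OF T] scaleC_mem
        scaleC_l2_add_right mult.commute[of c])
qed

lemma bop_diff_op: "bop T \<Longrightarrow> bop U \<Longrightarrow> bop (\<lambda>f. T f - U f)"
  using bop_add_op[of T "\<lambda>f. scaleC_l2 (-1) (U f)"] bop_scaleC_op[of U "-1"] by (simp add: scaleC_l2_minus_left)

lemma bop_sum_op: "(\<And>i. i \<in> I \<Longrightarrow> bop (T i)) \<Longrightarrow> bop (\<lambda>f. \<Sum>i\<in>I. T i f)"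
proof (induction I rule: infinite_finite_induct)
  case (insert i I)
  then show ?case using bop_add_op[of "T i" "\<lambda>f. \<Sum>i\<in>I. T i f"] by simp
qed (auto intro!: bopI[where C = 0] simp: zero_mem)

lemma op_norm_le:
  assumes "0 \<le> C" "\<And>f. f \<in> S \<Longrightarrow> N (T f) \<le> C * N f"
  shows "op_norm S N T \<le> C"
  unfolding op_norm_def
proof (rule cSUP_least)
  show "{f \<in> S. N f \<le> 1} \<noteq> {}" using zero_mem by auto
  fix f assume "f \<in> {f \<in> S. N f \<le> 1}"
  then show "N (T f) \<le> C"
    using assms(2)[of f] mult_left_mono[of "N f" 1 C] assms(1) by auto
qed

text \<open>Boundedness makes the supremum in \<^const>\<open>op_norm\<close> a genuine one.\<close>

lemma op_norm_bound:
  assumes T: "bop T" and f: "f \<in> S"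
  shows "N (T f) \<le> op_norm S N T * N f"
proof (cases "N f = 0")
  case True
  then show ?thesis using N_eq_0[OF f] bop_zero[OF T] by simp
next
  case False
  then have pos: "0 < N f" using N_nonneg[OF f] by simp
  obtain C where C: "0 \<le> C" "\<And>f. f \<in> S \<Longrightarrow> N (T f) \<le> C * N f" using bop_bound[OF T] by blast
  have "bdd_above ((\<lambda>f. N (T f)) ` {f \<in> S. N f \<le> 1})"
  proof (rule bdd_aboveI2)
    fix f assume "f \<in> {f \<in> S. N f \<le> 1}"
    then show "N (T f) \<le> C" using C(2)[of f] mult_left_mono[of "N f" 1 C] C(1) by auto
  qed
  then have "N (T ((1 / N f) *\<^sub>R f)) \<le> op_norm S N T"
    unfolding op_norm_def
    by (intro cSUP_upper[where f = "\<lambda>f. N (T f)"]) (use pos f in \<open>auto simp: scaleR_mem N_scaleR\<close>)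
  then show ?thesis
    using pos by (simp add: bop_scaleR[OF T f] N_scaleR[OF bop_mem[OF T f]] field_simps)
qed

lemma op_norm_nonneg:
  assumes T: "bop T"
  shows "0 \<le> op_norm S N T"
proof -
  obtain C where C: "0 \<le> C" "\<And>f. f \<in> S \<Longrightarrow> N (T f) \<le> C * N f" using bop_bound[OF T] by blast
  have "bdd_above ((\<lambda>f. N (T f)) ` {f \<in> S. N f \<le> 1})"
  proof (rule bdd_aboveI2)
    fix f assume "f \<in> {f \<in> S. N f \<le> 1}"
    then show "N (T f) \<le> C" using C(2)[of f] mult_left_mono[of "N f" 1 C] C(1) by auto
  qed
  then have "N (T 0) \<le> op_norm S N T"
    unfolding op_norm_def by (intro cSUP_upper[where f = "\<lambda>f. N (T f)"]) (use zero_mem in auto)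
  then show ?thesis by (simp add: bop_zero[OF T])
qed

lemma op_norm_tendsto_0I:
  assumes "\<And>x. bop (T x)" "\<forall>\<^sub>F x in F. 0 \<le> c x \<and> (\<forall>f\<in>S. N (T x f) \<le> c x * N f)" "(c \<longlongrightarrow> 0) F"
  shows "((\<lambda>x. op_norm S N (T x)) \<longlongrightarrow> 0) F"
proof (rule tendsto_sandwich[OF _ _ tendsto_const assms(3)])
  show "\<forall>\<^sub>F x in F. 0 \<le> op_norm S N (T x)" by (simp add: op_norm_nonneg assms(1))
  show "\<forall>\<^sub>F x in F. op_norm S N (T x) \<le> c x"
    using assms(2) by eventually_elim (rule op_norm_le; simp)
qed

lemma op_norm_tendsto_0D:
  assumes bop: "\<forall>\<^sub>F x in F. bop (T x)" and lim: "((\<lambda>x. op_norm S N (T x)) \<longlongrightarrow> 0) F" and f: "f \<in> S"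
  shows "((\<lambda>x. N (T x f)) \<longlongrightarrow> 0) F"
proof (rule tendsto_sandwich[OF _ _ tendsto_const])
  show "\<forall>\<^sub>F x in F. 0 \<le> N (T x f)"
    using bop by eventually_elim (rule N_nonneg[OF bop_mem[OF _ f]])
  show "\<forall>\<^sub>F x in F. N (T x f) \<le> op_norm S N (T x) * N f"
    using bop by eventually_elim (rule op_norm_bound[OF _ f])
  show "((\<lambda>x. op_norm S N (T x) * N f) \<longlongrightarrow> 0) F"
    using tendsto_mult_left_zero[OF lim] .
qed

text \<open>
  The mechanism behind the theorems of Krein and Lax on symmetrizable operators: if
  \<open>\<parallel>T f\<parallel>\<^sup>2 \<le> \<parallel>T\<^sup>2 f\<parallel> \<parallel>f\<parallel>\<close>, the ratios \<open>\<parallel>T\<^sup>n\<^sup>+\<^sup>1 f\<parallel> / \<parallel>T\<^sup>n f\<parallel>\<close> increase with \<open>n\<close>, so the first of them is at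
  most the exponential growth rate of \<open>\<parallel>T\<^sup>n f\<parallel>\<close>. That rate can be read off in a stronger norm.
\<close>

lemma norm_le_growth_rate:
  assumes mem: "\<And>f. f \<in> S \<Longrightarrow> T f \<in> S"
    and convex: "\<And>f. f \<in> S \<Longrightarrow> (norm (T f))\<^sup>2 \<le> norm (T (T f)) * norm f"
    and f: "f \<in> S" and c: "0 \<le> c" and growth: "\<And>n. norm ((T ^^ n) f) \<le> K * c ^ n"
  shows "norm (T f) \<le> c * norm f"
proof (rule ccontr)
  define a where "a n = norm ((T ^^ n) f)" for n
  assume "\<not> norm (T f) \<le> c * norm f"
  then have less: "c * a 0 < a 1" by (simp add: a_def)
  have memn: "(T ^^ n) f \<in> S" for n by (induction n) (simp_all add: mem f)
  have conv: "(a (Suc n))\<^sup>2 \<le> a (Suc (Suc n)) * a n" for n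
    using convex[OF memn[of n]] by (simp add: a_def)
  have a0: "0 < a 0"
  proof (rule ccontr)
    assume "\<not> 0 < a 0"
    then have "a 0 = 0" by (simp add: a_def)
    then have "(a 1)\<^sup>2 \<le> 0" using conv[of 0] by simp
    then show False using less \<open>a 0 = 0\<close> by simp
  qed
  define \<rho> where "\<rho> = a 1 / a 0"
  have \<rho>: "c < \<rho>" "0 < \<rho>" using less a0 c by (simp_all add: \<rho>_def field_simps order.strict_trans1)
  have step: "0 < a n \<and> \<rho> * a n \<le> a (Suc n)" for n
  proof (induction n)
    case 0
    then show ?case using a0 by (simp add: \<rho>_def)
  next
    case (Suc n)
    then have pos: "0 < a n" "0 < a (Suc n)" using \<rho>(2) by (auto intro: less_le_trans[OF mult_pos_pos])
    have "\<rho> * a n * a (Suc n) \<le> a (Suc n) * a (Suc n)"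
      using Suc pos by (intro mult_right_mono) auto
    also have "\<dots> \<le> a (Suc (Suc n)) * a n" using conv[of n] by (simp add: power2_eq_square)
    finally have "(\<rho> * a (Suc n)) * a n \<le> a (Suc (Suc n)) * a n" by (simp add: mult_ac)
    with pos show ?case by simp
  qed
  have lower: "\<rho> ^ n * a 0 \<le> a n" for n
  proof (induction n)
    case (Suc n)
    have "\<rho> ^ Suc n * a 0 \<le> \<rho> * a n" using Suc \<rho>(2) by (simp add: mult_left_mono mult.assoc)
    then show ?case using step[of n] by linarith
  qed simp
  have upper: "\<rho> ^ n * a 0 \<le> K * c ^ n" for n
    using lower[of n] growth[of n] by (simp add: a_def)
  show False
  proof (cases "c = 0")
    case True
    then show False using upper[of 1] mult_pos_pos[OF \<rho>(2) a0] by simp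
  next
    case False
    then have "0 < c" using c by simp
    then obtain n where "K / a 0 < (\<rho> / c) ^ n"
      using real_arch_pow[of "\<rho> / c" "K / a 0"] \<rho>(1) by auto
    then have "K * c ^ n < \<rho> ^ n * a 0"
      using \<open>0 < c\<close> a0 by (simp add: power_divide field_simps)
    with upper[of n] show False by simp
  qed
qed

text \<open>Here the growth of \<open>T\<^sup>n f\<close> is read off in the norm \<open>N\<close>.\<close>

lemma norm_le_of_N_bound:
  assumes mem: "\<And>f. f \<in> S \<Longrightarrow> T f \<in> S"
    and convex: "\<And>f. f \<in> S \<Longrightarrow> (norm (T f))\<^sup>2 \<le> norm (T (T f)) * norm f"
    and C: "0 \<le> C" "\<And>f. f \<in> S \<Longrightarrow> N (T f) \<le> C * N f" and f: "f \<in> S"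
  shows "norm (T f) \<le> C * norm f"
proof (rule norm_le_growth_rate[OF mem convex f C(1)])
  fix n
  have "(T ^^ n) f \<in> S \<and> N ((T ^^ n) f) \<le> C ^ n * N f"
  proof (induction n)
    case (Suc n)
    then have "N (T ((T ^^ n) f)) \<le> C * (C ^ n * N f)"
      using C(2)[of "(T ^^ n) f"] mult_left_mono[OF _ C(1), of "N ((T ^^ n) f)" "C ^ n * N f"] by linarith
    with Suc show ?case by (simp add: mem mult.assoc)
  qed (simp add: f)
  then show "norm ((T ^^ n) f) \<le> N f * C ^ n"
    using norm_le_N[of "(T ^^ n) f"] by (simp add: mult.commute)
qed

text \<open>
  Polarization recovers the real inner product from the norm. The imaginary part of \<open>\<langle>f, g\<rangle>\<close> is the real
  inner product of \<open>f\<close> and \<open>i g\<close>.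
\<close>

lemma l2_inner_isometry:
  assumes T: "bop T" and iso: "\<And>f. f \<in> S \<Longrightarrow> norm (T f) = norm f" and f: "f \<in> S" and g: "g \<in> S"
  shows "l2_inner (T f) (T g) = l2_inner f g"
proof -
  have re: "inner (T u) (T v) = inner u v" if "u \<in> S" "v \<in> S" for u v
    using iso[OF add_mem[OF that]] iso[of u] iso[of v] that
    by (simp add: dot_norm bop_add[OF T])
  show ?thesis
  proof (rule complex_eqI)
    show "Re (l2_inner (T f) (T g)) = Re (l2_inner f g)"
      using re[OF f g] by (simp add: inner_l2_def)
    show "Im (l2_inner (T f) (T g)) = Im (l2_inner f g)"
      using re[OF f scaleC_mem[OF g]] by (simp add: Im_l2_inner bop_scaleC[OF T g])
  qed
qed

text \<open>Antisymmetry gives \<open>\<parallel>X f\<parallel>\<^sup>2 = - \<langle>f, X\<^sup>2 f\<rangle>\<close>, and the Cauchy-Schwarz inequality applies.\<close>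

lemma antisymmetric_norm_convex:
  assumes mem: "\<And>f. f \<in> S \<Longrightarrow> X f \<in> S"
    and anti: "\<And>f g. f \<in> S \<Longrightarrow> g \<in> S \<Longrightarrow> l2_inner (X f) g = - l2_inner f (X g)" and f: "f \<in> S"
  shows "(norm (X f))\<^sup>2 \<le> norm (X (X f)) * norm f"
proof -
  have "complex_of_real ((norm (X f))\<^sup>2) = - l2_inner f (X (X f))"
    using anti[OF f mem[OF f]] by (simp add: l2_inner_self)
  then have "(norm (X f))\<^sup>2 = cmod (l2_inner f (X (X f)))"
    by (metis norm_minus_cancel norm_of_real abs_of_nonneg zero_le_power2)
  then show ?thesis
    using l2_Cauchy_Schwarz[of f "X (X f)"] by (simp add: mult.commute)
qed

text \<open>
  An antisymmetric operator of norm \<open>\<theta>\<close> has \<open>i\<theta>\<close> or \<open>-i\<theta>\<close> in its approximate spectrum. If the unit vector \<open>f\<close>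
  almost attains the norm, then \<open>(X\<^sup>2 + \<theta>\<^sup>2) f\<close> is small. Since \<open>(X - i\<theta>) (X + i\<theta>) = X\<^sup>2 + \<theta>\<^sup>2\<close>, either \<open>f\<close> or the
  normalized \<open>(X + i\<theta>) f\<close> is an approximate eigenvector.
\<close>

lemma antisymmetric_approximate_eigenvector:
  assumes X: "bop X" and anti: "\<And>f g. f \<in> S \<Longrightarrow> g \<in> S \<Longrightarrow> l2_inner (X f) g = - l2_inner f (X g)"
    and \<theta>: "0 < \<theta>" and bound: "\<And>f. f \<in> S \<Longrightarrow> norm (X f) \<le> \<theta> * norm f"
    and least: "\<And>C. 0 \<le> C \<Longrightarrow> (\<And>f. f \<in> S \<Longrightarrow> norm (X f) \<le> C * norm f) \<Longrightarrow> \<theta> \<le> C"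
    and \<eta>: "0 < \<eta>"
  shows "\<exists>v\<in>S. norm v = 1 \<and> (norm (X v - scaleC_l2 (\<i> * \<theta>) v) \<le> \<eta> \<or> norm (X v - scaleC_l2 (- \<i> * \<theta>) v) \<le> \<eta>)"
proof -
  \<comment> \<open>\<open>\<kappa>\<close> is chosen such that \<open>\<parallel>X f\<parallel>\<^sup>2 \<ge> \<theta>\<^sup>2 - \<kappa>\<close> implies \<open>\<parallel>(X\<^sup>2 + \<theta>\<^sup>2) f\<parallel> \<le> \<eta>\<^sup>2\<close>.\<close>
  define \<kappa> where "\<kappa> = \<eta>^4 / (2 * \<theta>\<^sup>2)"
  have \<kappa>: "0 < \<kappa>" using \<theta> \<eta> by (simp add: \<kappa>_def)
  define C where "C = sqrt (max 0 (\<theta>\<^sup>2 - \<kappa>))"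
  have "C < \<theta>"
    unfolding C_def using \<theta> \<kappa> by (intro real_less_lsqrt) auto
  then have "\<not> (\<forall>f\<in>S. norm (X f) \<le> C * norm f)"
    using least[of C] by (auto simp: C_def)
  then obtain u where u: "u \<in> S" "C * norm u < norm (X u)" by (auto simp: not_le)
  then have u0: "0 < norm u" using bop_zero[OF X] by (cases "u = 0") auto
  define f where "f = (1 / norm u) *\<^sub>R u"
  have f: "f \<in> S" "norm f = 1" using u u0 by (simp_all add: f_def scaleR_mem)
  have "C < norm (X f)"
    using u u0 by (simp add: f_def bop_scaleR[OF X] field_simps)
  then have "C\<^sup>2 < (norm (X f))\<^sup>2"
    by (intro power_strict_mono) (auto simp: C_def)
  then have almost: "\<theta>\<^sup>2 - \<kappa> \<le> (norm (X f))\<^sup>2" by (simp add: C_def)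
  have XfS: "X f \<in> S" "X (X f) \<in> S" using bop_mem[OF X] f by auto
  have inner: "inner (X (X f)) f = - (norm (X f))\<^sup>2"
    using anti[OF XfS(1) f(1)] by (simp add: inner_l2_def l2_inner_self)
  have "norm (X (X f)) \<le> \<theta> * (\<theta> * norm f)"
    by (rule order_trans[OF bound[OF XfS(1)] mult_left_mono[OF bound[OF f(1)]]]) (use \<theta> in simp)
  then have le2: "norm (X (X f)) \<le> \<theta>\<^sup>2"
    by (simp add: f(2) power2_eq_square)
  have "(norm (X (X f) + \<theta>\<^sup>2 *\<^sub>R f))\<^sup>2 = (norm (X (X f)))\<^sup>2 + 2 * \<theta>\<^sup>2 * inner (X (X f)) f + (\<theta>\<^sup>2)\<^sup>2"
    using f(2) by (simp only: power2_norm_eq_inner inner_add_left inner_add_right inner_scaleR_left inner_scaleR_right)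
       (simp add: power2_eq_square inner_commute norm_eq_1 algebra_simps)
  also have "\<dots> \<le> (\<theta>\<^sup>2)\<^sup>2 - 2 * \<theta>\<^sup>2 * (\<theta>\<^sup>2 - \<kappa>) + (\<theta>\<^sup>2)\<^sup>2"
    unfolding inner
    using power_mono[OF le2, of 2] mult_left_mono[OF almost, of "2 * \<theta>\<^sup>2"] by simp
  also have "\<dots> = (\<eta>\<^sup>2)\<^sup>2"
    using \<theta> by (simp add: \<kappa>_def right_diff_distrib power2_eq_square power4_eq_xxxx)
  finally have small: "norm (X (X f) + \<theta>\<^sup>2 *\<^sub>R f) \<le> \<eta>\<^sup>2"
    by (rule power2_le_imp_le) simp
  define g where "g = X f - scaleC_l2 (- \<i> * \<theta>) f"
  have g: "g \<in> S" unfolding g_def by (intro diff_mem XfS scaleC_mem f)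
  show ?thesis
  proof (cases "norm g \<le> \<eta>")
    case True
    with f show ?thesis unfolding g_def by blast
  next
    case False
    then have gpos: "\<eta> < norm g" "0 < norm g" using \<eta> by auto
    define v where "v = (1 / norm g) *\<^sub>R g"
    have v: "v \<in> S" "norm v = 1" using g gpos by (simp_all add: v_def scaleR_mem)
    have "\<i> * complex_of_real \<theta> * (\<i> * complex_of_real \<theta>) = - (complex_of_real \<theta> * complex_of_real \<theta>)"
      by (simp add: complex_eq_iff)
    then have "X g - scaleC_l2 (\<i> * \<theta>) g = X (X f) + \<theta>\<^sup>2 *\<^sub>R f"
      unfolding g_def bop_diff[OF X XfS(1) scaleC_mem[OF f(1)]] bop_scaleC[OF X f(1)]
      by (simp add: scaleC_l2_diff_right scaleC_l2_minus_left scaleC_l2_add_right power2_eq_square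
          flip: scaleC_l2_of_real)
    moreover have "X v - scaleC_l2 (\<i> * \<theta>) v = (1 / norm g) *\<^sub>R (X g - scaleC_l2 (\<i> * \<theta>) g)"
      by (simp add: v_def bop_scaleR[OF X g] scaleR_diff_right scaleC_l2_scaleR)
    ultimately have "norm (X v - scaleC_l2 (\<i> * \<theta>) v) = norm (X (X f) + \<theta>\<^sup>2 *\<^sub>R f) / norm g"
      by simp
    also have "\<dots> \<le> \<eta>\<^sup>2 / \<eta>"
      using small gpos \<eta> by (intro frac_le) auto
    also have "\<dots> = \<eta>" using \<eta> by (simp add: power2_eq_square)
    finally show ?thesis using v by blast
  qed
qed

end

section \<open>Holomorphic functional calculus for a strict contraction\<close>

locale complete_subspace = normed_subspace +
  assumes complete: "(\<And>n. X n \<in> S) \<Longrightarrow> (\<And>e. 0 < e \<Longrightarrow> \<exists>M. \<forall>m\<ge>M. \<forall>n\<ge>M. N (X m - X n) < e) \<Longrightarrow>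
    \<exists>f\<in>S. (\<lambda>n. N (X n - f)) \<longlonglongrightarrow> 0"

abbreviation disc_holomorphic :: "(complex \<Rightarrow> complex) \<Rightarrow> bool" where
  "disc_holomorphic h \<equiv> h holomorphic_on ball 0 1"

definition taylor :: "(complex \<Rightarrow> complex) \<Rightarrow> nat \<Rightarrow> complex" where
  "taylor h n = (deriv ^^ n) h 0 / fact n"

lemma taylor_add: "disc_holomorphic h \<Longrightarrow> disc_holomorphic g \<Longrightarrow> taylor (\<lambda>z. h z + g z) n = taylor h n + taylor g n"
  by (simp add: taylor_def higher_deriv_add[of h "ball 0 1" g] add_divide_distrib)

lemma taylor_cmult: "disc_holomorphic h \<Longrightarrow> taylor (\<lambda>z. c * h z) n = c * taylor h n"
  by (simp add: taylor_def higher_deriv_cmult[of h "ball 0 1"])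

lemma taylor_cong:
  "disc_holomorphic h \<Longrightarrow> disc_holomorphic g \<Longrightarrow> (\<And>z. cmod z < 1 \<Longrightarrow> h z = g z) \<Longrightarrow> taylor h n = taylor g n"
  unfolding taylor_def by (subst higher_deriv_transform_within_open[of h "ball 0 1" g]) auto

lemma taylor_const: "taylor (\<lambda>z. c) n = (if n = 0 then c else 0)"
  by (simp add: taylor_def)

lemma taylor_shift:
  assumes "disc_holomorphic h"
  shows "taylor (\<lambda>z. z * h z) 0 = 0" "taylor (\<lambda>z. z * h z) (Suc n) = taylor h n"
proof -
  show "taylor (\<lambda>z. z * h z) 0 = 0" by (simp add: taylor_def)
  have "(deriv ^^ Suc n) (\<lambda>z. z * h z) 0 =
      (\<Sum>i = 0..Suc n. of_nat (Suc n choose i) * (deriv ^^ i) (\<lambda>z. z) 0 * (deriv ^^ (Suc n - i)) h 0)"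
    by (rule higher_deriv_mult[of _ "ball 0 1"]) (use assms in auto)
  also have "\<dots> = (\<Sum>i\<in>{1}. of_nat (Suc n choose i) * (deriv ^^ i) (\<lambda>z. z) 0 * (deriv ^^ (Suc n - i)) h 0)"
    by (rule sum.mono_neutral_right) (auto simp del: funpow.simps)
  also have "\<dots> = of_nat (Suc n) * (deriv ^^ n) h 0" by simp
  finally show "taylor (\<lambda>z. z * h z) (Suc n) = taylor h n"
    by (simp add: taylor_def field_simps del: funpow.simps of_nat_Suc)
qed

lemma disc_holomorphic_bounded:
  assumes "disc_holomorphic h" "\<rho> < 1"
  obtains M where "0 \<le> M" "\<And>z. cmod z \<le> \<rho> \<Longrightarrow> cmod (h z) \<le> M"
proof -
  have "continuous_on (cball 0 \<rho>) h"
    by (rule holomorphic_on_imp_continuous_on[OF holomorphic_on_subset[OF assms(1)]]) (use assms(2) in auto)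
  then have "compact (h ` cball 0 \<rho>)"
    by (rule compact_continuous_image) simp
  then obtain M where M: "\<And>y. y \<in> h ` cball 0 \<rho> \<Longrightarrow> cmod y \<le> M"
    using compact_imp_bounded bounded_iff by metis
  have "cmod (h z) \<le> max M 0" if "cmod z \<le> \<rho>" for z
    using M[of "h z"] that by auto
  then show thesis using that[of "max M 0"] by simp
qed

lemma taylor_bound:
  assumes "disc_holomorphic h" "0 < \<rho>" "\<rho> < 1" "\<And>z. cmod z \<le> \<rho> \<Longrightarrow> cmod (h z) \<le> M"
  shows "cmod (taylor h n) \<le> M / \<rho> ^ n"
proof -
  have "norm ((deriv ^^ n) h 0) \<le> fact n * M / \<rho> ^ n"
  proof (rule Cauchy_inequality)
    show "h holomorphic_on ball 0 \<rho>"
      by (rule holomorphic_on_subset[OF assms(1)]) (use assms(3) in auto)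
    show "continuous_on (cball 0 \<rho>) h"
      by (rule holomorphic_on_imp_continuous_on[OF holomorphic_on_subset[OF assms(1)]]) (use assms(3) in auto)
  qed (use assms in auto)
  then show ?thesis by (simp add: taylor_def norm_divide field_simps)
qed

text \<open>Cauchy's estimates on a slightly larger disc give a geometric majorant.\<close>

lemma taylor_uniform:
  assumes h: "disc_holomorphic h" and \<rho>: "0 < \<rho>" "\<rho> < 1"
  shows "uniform_limit (cball 0 \<rho>) (\<lambda>K z. \<Sum>n<K. taylor h n * z ^ n) h sequentially"
proof -
  define \<rho>' where "\<rho>' = (1 + \<rho>) / 2"
  have \<rho>': "\<rho> < \<rho>'" "0 < \<rho>'" "\<rho>' < 1" using \<rho> by (auto simp: \<rho>'_def)
  obtain M where M: "0 \<le> M" "\<And>z. cmod z \<le> \<rho>' \<Longrightarrow> cmod (h z) \<le> M"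
    using disc_holomorphic_bounded[OF h \<rho>'(3)] by blast
  have "uniform_limit (cball 0 \<rho>) (\<lambda>K z. \<Sum>n<K. taylor h n * z ^ n) (\<lambda>z. \<Sum>n. taylor h n * z ^ n) sequentially"
  proof (rule Weierstrass_m_test)
    fix n and z :: complex assume "z \<in> cball 0 \<rho>"
    then have "cmod (taylor h n) * cmod z ^ n \<le> (M / \<rho>' ^ n) * \<rho> ^ n"
      using \<rho> \<rho>' M(1) by (intro mult_mono taylor_bound[OF h \<rho>'(2,3) M(2)] power_mono) auto
    also have "\<dots> = M * (\<rho> / \<rho>') ^ n" by (simp add: power_divide)
    finally show "norm (taylor h n * z ^ n) \<le> M * (\<rho> / \<rho>') ^ n"
      by (simp add: norm_mult norm_power)
  next
    show "summable (\<lambda>n. M * (\<rho> / \<rho>') ^ n)"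
      using \<rho> \<rho>' by (intro summable_mult summable_geometric) auto
  qed
  also have "?this \<longleftrightarrow> ?thesis"
  proof (rule uniform_limit_cong')
    fix z :: complex assume "z \<in> cball 0 \<rho>"
    then have "(\<lambda>n. taylor h n * z ^ n) sums h z"
      using holomorphic_power_series[OF h, of z] \<rho> by (simp add: taylor_def)
    then show "(\<Sum>n. taylor h n * z ^ n) = h z" by (rule sums_unique[symmetric])
  qed simp
  finally show ?thesis .
qed

locale contraction = complete_subspace S N for S :: "'a::euclidean_space l2 set" and N +
  fixes B :: "'a l2 \<Rightarrow> 'a l2" and q :: real
  assumes B: "bop B" and q: "0 \<le> q" "q < 1" and contr: "f \<in> S \<Longrightarrow> N (B f) \<le> q * N f"
begin

text \<open>
  Values between \<open>q\<close> and \<open>1\<close> serve both sides: Cauchy's estimates hold on the disc of this radius inside the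
  domain of holomorphy, and \<open>\<Sum>n. radius\<^sup>-\<^sup>n \<parallel>B\<^sup>n\<parallel>\<close> converges.
\<close>

definition radius :: real where "radius = (1 + q) / 2"

lemma radius: "q < radius" "0 < radius" "radius < 1"
  using q by (auto simp: radius_def)

definition calc_const :: real where "calc_const = (\<Sum>n. (q / radius) ^ n)"

lemma summable_ratio: "summable (\<lambda>n. (q / radius) ^ n)"
  using q radius by (intro summable_geometric) auto

lemma calc_const_nonneg: "0 \<le> calc_const"
  unfolding calc_const_def using q radius by (intro suminf_nonneg summable_ratio) auto

lemma B_pow_mem: "f \<in> S \<Longrightarrow> (B ^^ n) f \<in> S"
  by (rule bop_mem[OF bop_funpow[OF B]])

lemma B_pow_bound: "f \<in> S \<Longrightarrow> N ((B ^^ n) f) \<le> q ^ n * N f"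
proof (induction n)
  case (Suc n)
  then show ?case
    using contr[OF B_pow_mem[OF Suc.prems], of n] mult_left_mono[OF Suc.IH[OF Suc.prems] q(1)]
    by (simp add: mult.assoc)
qed simp

definition partial_calc :: "(complex \<Rightarrow> complex) \<Rightarrow> nat \<Rightarrow> 'a l2 \<Rightarrow> 'a l2" where
  "partial_calc h K f = (\<Sum>n<K. scaleC_l2 (taylor h n) ((B ^^ n) f))"

text \<open>The value \<open>h(B)\<close> of the Taylor series of \<open>h\<close>, which converges as \<open>q < 1\<close>.\<close>

definition calc :: "(complex \<Rightarrow> complex) \<Rightarrow> 'a l2 \<Rightarrow> 'a l2" where
  "calc h f = (if f \<in> S then (\<Sum>n. scaleC_l2 (taylor h n) ((B ^^ n) f)) else 0)"

lemma bop_partial_calc: "bop (partial_calc h K)"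
  unfolding partial_calc_def by (intro bop_sum_op bop_scaleC_op bop_funpow B)

lemma taylor_term_bound:
  assumes h: "disc_holomorphic h" and M: "\<And>z. cmod z \<le> radius \<Longrightarrow> cmod (h z) \<le> M" and f: "f \<in> S"
  shows "N (scaleC_l2 (taylor h n) ((B ^^ n) f)) \<le> M * N f * (q / radius) ^ n"
proof -
  have "0 \<le> M" by (rule order_trans[OF norm_ge_zero M[of 0]]) (use radius(2) in simp)
  have "N (scaleC_l2 (taylor h n) ((B ^^ n) f)) = cmod (taylor h n) * N ((B ^^ n) f)"
    by (simp add: N_scaleC B_pow_mem f)
  also have "\<dots> \<le> (M / radius ^ n) * (q ^ n * N f)"
    using radius \<open>0 \<le> M\<close> by (intro mult_mono taylor_bound[OF h radius(2,3) M] B_pow_bound[OF f] N_nonneg B_pow_mem f) auto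
  also have "\<dots> = M * N f * (q / radius) ^ n" by (simp add: power_divide)
  finally show ?thesis .
qed

lemma partial_calc_diff_bound:
  assumes h: "disc_holomorphic h" and M: "\<And>z. cmod z \<le> radius \<Longrightarrow> cmod (h z) \<le> M" and f: "f \<in> S" and "j \<le> k"
  shows "N (partial_calc h k f - partial_calc h j f) \<le> (\<Sum>n=j..<k. M * N f * (q / radius) ^ n)"
proof -
  have "partial_calc h k f - partial_calc h j f = (\<Sum>n=j..<k. scaleC_l2 (taylor h n) ((B ^^ n) f))"
    unfolding partial_calc_def lessThan_atLeast0
    using sum.atLeastLessThan_concat[of 0 j k "\<lambda>n. scaleC_l2 (taylor h n) ((B ^^ n) f)"] \<open>j \<le> k\<close>
    by (simp add: algebra_simps)
  also have "N \<dots> \<le> (\<Sum>n=j..<k. N (scaleC_l2 (taylor h n) ((B ^^ n) f)))"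
    by (rule N_sum) (simp add: scaleC_mem B_pow_mem f)
  also have "\<dots> \<le> (\<Sum>n=j..<k. M * N f * (q / radius) ^ n)"
    by (rule sum_mono) (rule taylor_term_bound[OF h M f])
  finally show ?thesis .
qed

text \<open>
  The series converges in \<open>N\<close> by completeness, and \<^const>\<open>calc\<close>, which is a limit in the topology of the type, is the same
  limit because \<open>N\<close> dominates its norm.
\<close>

lemma calc_limit:
  assumes h: "disc_holomorphic h" and f: "f \<in> S"
  shows "calc h f \<in> S" "(\<lambda>K. N (partial_calc h K f - calc h f)) \<longlonglongrightarrow> 0"
proof -
  obtain M where M: "0 \<le> M" "\<And>z. cmod z \<le> radius \<Longrightarrow> cmod (h z) \<le> M"
    using disc_holomorphic_bounded[OF h radius(3)] by blast
  let ?a = "\<lambda>n. M * N f * (q / radius) ^ n"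
  have mem: "partial_calc h K f \<in> S" for K by (rule bop_mem[OF bop_partial_calc f])
  have "summable ?a" by (intro summable_mult summable_ratio)
  have "\<exists>l\<in>S. (\<lambda>K. N (partial_calc h K f - l)) \<longlonglongrightarrow> 0"
  proof (rule complete[OF mem])
    fix e :: real assume "0 < e"
    then obtain m where m: "\<And>j k. m \<le> j \<Longrightarrow> norm (sum ?a {j..<k}) < e"
      using \<open>summable ?a\<close> unfolding summable_Cauchy by blast
    have less: "N (partial_calc h k f - partial_calc h j f) < e" if "m \<le> j" "j \<le> k" for j k
      using partial_calc_diff_bound[OF h M(2) f that(2)] m[OF that(1), of k] by (simp add: abs_less_iff)
    have "N (partial_calc h k f - partial_calc h j f) < e" if "m \<le> j" "m \<le> k" for j k
      using less[of j k] less[of k j] that N_minus_commute[OF mem mem, of j k] by (cases "j \<le> k") auto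
    then show "\<exists>M. \<forall>m\<ge>M. \<forall>n\<ge>M. N (partial_calc h m f - partial_calc h n f) < e" by blast
  qed
  then obtain l where l: "l \<in> S" "(\<lambda>K. N (partial_calc h K f - l)) \<longlonglongrightarrow> 0" by blast
  have "(\<lambda>K. partial_calc h K f) \<longlonglongrightarrow> l" by (rule tendsto_of_N[OF mem l])
  then have "(\<lambda>n. scaleC_l2 (taylor h n) ((B ^^ n) f)) sums l"
    by (simp add: sums_def partial_calc_def)
  then have "calc h f = l" using f by (simp add: calc_def sums_unique[symmetric])
  with l show "calc h f \<in> S" "(\<lambda>K. N (partial_calc h K f - calc h f)) \<longlonglongrightarrow> 0" by auto
qed

lemma partial_calc_tendsto:
  assumes "disc_holomorphic h" "f \<in> S"
  shows "(\<lambda>K. partial_calc h K f) \<longlonglongrightarrow> calc h f"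
  by (rule tendsto_of_N[OF bop_mem[OF bop_partial_calc assms(2)] calc_limit[OF assms]])

lemma calc_outside: "f \<notin> S \<Longrightarrow> calc h f = 0"
  by (simp add: calc_def)

lemma partial_calc_bound:
  assumes h: "disc_holomorphic h" and M: "\<And>z. cmod z \<le> radius \<Longrightarrow> cmod (h z) \<le> M" and f: "f \<in> S"
  shows "N (partial_calc h K f) \<le> M * calc_const * N f"
proof -
  have "0 \<le> M" by (rule order_trans[OF norm_ge_zero M[of 0]]) (use radius(2) in simp)
  have "N (partial_calc h K f) \<le> (\<Sum>n=0..<K. M * N f * (q / radius) ^ n)"
    using partial_calc_diff_bound[OF h M f, of 0 K] by (simp add: partial_calc_def)
  also have "\<dots> = M * N f * (\<Sum>n<K. (q / radius) ^ n)"
    by (simp add: sum_distrib_left lessThan_atLeast0)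
  also have "\<dots> \<le> M * N f * calc_const"
    unfolding calc_const_def using q radius N_nonneg[OF f] \<open>0 \<le> M\<close>
    by (intro mult_left_mono sum_le_suminf summable_ratio) auto
  finally show ?thesis by (simp add: mult_ac)
qed

lemma calc_bound:
  assumes h: "disc_holomorphic h" and M: "\<And>z. cmod z \<le> radius \<Longrightarrow> cmod (h z) \<le> M" and f: "f \<in> S"
  shows "N (calc h f) \<le> M * calc_const * N f"
proof (rule LIMSEQ_le_const[OF _ exI, OF _ allI[OF impI]])
  have "(\<lambda>K. M * calc_const * N f + N (partial_calc h K f - calc h f)) \<longlonglongrightarrow> M * calc_const * N f + 0"
    by (intro tendsto_intros calc_limit[OF h f])
  then show "(\<lambda>K. M * calc_const * N f + N (partial_calc h K f - calc h f)) \<longlonglongrightarrow> M * calc_const * N f" by simp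
  fix K :: nat assume "0 \<le> K"
  have "N (partial_calc h K f - (partial_calc h K f - calc h f))
      \<le> N (partial_calc h K f) + N (partial_calc h K f - calc h f)"
    by (intro N_diff diff_mem bop_mem[OF bop_partial_calc] calc_limit h f)
  then show "N (calc h f) \<le> M * calc_const * N f + N (partial_calc h K f - calc h f)"
    using partial_calc_bound[OF h M f, of K] by simp
qed

lemma calc_add_arg:
  assumes h: "disc_holomorphic h" and f: "f \<in> S" and g: "g \<in> S"
  shows "calc h (f + g) = calc h f + calc h g"
proof (rule LIMSEQ_unique[OF partial_calc_tendsto[OF h add_mem[OF f g]]])
  show "(\<lambda>K. partial_calc h K (f + g)) \<longlonglongrightarrow> calc h f + calc h g"
    unfolding bop_add[OF bop_partial_calc f g] by (intro tendsto_add partial_calc_tendsto h f g)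
qed

lemma calc_scaleC_arg:
  assumes h: "disc_holomorphic h" and f: "f \<in> S"
  shows "calc h (scaleC_l2 c f) = scaleC_l2 c (calc h f)"
proof (rule LIMSEQ_unique[OF partial_calc_tendsto[OF h scaleC_mem[OF f]]])
  show "(\<lambda>K. partial_calc h K (scaleC_l2 c f)) \<longlonglongrightarrow> scaleC_l2 c (calc h f)"
    unfolding bop_scaleC[OF bop_partial_calc f]
    by (intro bounded_linear.tendsto[OF bounded_linear_scaleC_l2] partial_calc_tendsto h f)
qed

lemma bop_calc:
  assumes h: "disc_holomorphic h"
  shows "bop (calc h)"
proof -
  obtain M where M: "0 \<le> M" "\<And>z. cmod z \<le> radius \<Longrightarrow> cmod (h z) \<le> M"
    using disc_holomorphic_bounded[OF h radius(3)] by blast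
  show ?thesis
    by (rule bopI[where C = "M * calc_const"])
       (simp_all add: calc_limit(1)[OF h] calc_add_arg[OF h] calc_scaleC_arg[OF h] calc_bound[OF h M(2)])
qed

lemma calc_bounded_ops: "disc_holomorphic h \<Longrightarrow> calc h \<in> bounded_ops S N"
  by (simp add: bounded_ops_iff bop_calc calc_outside)

lemma calc_cong:
  assumes "disc_holomorphic h" "disc_holomorphic g" "\<And>z. cmod z < 1 \<Longrightarrow> h z = g z"
  shows "calc h = calc g"
  by (simp add: fun_eq_iff calc_def taylor_cong[OF assms])

lemma calc_add:
  assumes h: "disc_holomorphic h" and g: "disc_holomorphic g" and f: "f \<in> S"
  shows "calc (\<lambda>z. h z + g z) f = calc h f + calc g f"
proof (rule LIMSEQ_unique[OF partial_calc_tendsto[OF holomorphic_on_add[OF h g] f]])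
  have "partial_calc (\<lambda>z. h z + g z) K f = partial_calc h K f + partial_calc g K f" for K
    by (simp add: partial_calc_def taylor_add[OF h g] scaleC_l2_add_left sum.distrib)
  then show "(\<lambda>K. partial_calc (\<lambda>z. h z + g z) K f) \<longlonglongrightarrow> calc h f + calc g f"
    using tendsto_add[OF partial_calc_tendsto[OF h f] partial_calc_tendsto[OF g f]] by simp
qed

lemma calc_cmult:
  assumes h: "disc_holomorphic h" and f: "f \<in> S"
  shows "calc (\<lambda>z. c * h z) f = scaleC_l2 c (calc h f)"
proof (rule LIMSEQ_unique[OF partial_calc_tendsto[OF holomorphic_on_mult[OF holomorphic_on_const h] f]])
  have "partial_calc (\<lambda>z. c * h z) K f = scaleC_l2 c (partial_calc h K f)" for K
    by (simp add: partial_calc_def taylor_cmult[OF h] scaleC_l2_sum_right)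
  then show "(\<lambda>K. partial_calc (\<lambda>z. c * h z) K f) \<longlonglongrightarrow> scaleC_l2 c (calc h f)"
    using bounded_linear.tendsto[OF bounded_linear_scaleC_l2 partial_calc_tendsto[OF h f]] by simp
qed

lemma calc_diff:
  assumes h: "disc_holomorphic h" and g: "disc_holomorphic g" and f: "f \<in> S"
  shows "calc (\<lambda>z. h z - g z) f = calc h f - calc g f"
  using calc_add[OF h holomorphic_on_mult[OF holomorphic_on_const g] f, of "-1"] calc_cmult[OF g f, of "-1"]
  by (simp add: scaleC_l2_minus_left)

lemma calc_sum:
  assumes "\<And>i. i \<in> I \<Longrightarrow> disc_holomorphic (h i)" and f: "f \<in> S"
  shows "calc (\<lambda>z. \<Sum>i\<in>I. h i z) f = (\<Sum>i\<in>I. calc (h i) f)"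
  using assms(1)
proof (induction I rule: infinite_finite_induct)
  case (insert i I)
  then show ?case
    using calc_add[of "h i" "\<lambda>z. \<Sum>i\<in>I. h i z" f] f by (simp add: holomorphic_on_sum)
qed (simp_all add: calc_def taylor_const f)

lemma calc_diff_bound:
  assumes h: "disc_holomorphic h" and g: "disc_holomorphic g"
    and M: "\<And>z. cmod z \<le> radius \<Longrightarrow> cmod (h z - g z) \<le> M" and f: "f \<in> S"
  shows "N (calc h f - calc g f) \<le> M * calc_const * N f"
  using calc_bound[OF holomorphic_on_diff[OF h g] M f] by (simp add: calc_diff[OF h g f])

lemma calc_one: "f \<in> S \<Longrightarrow> calc (\<lambda>z. 1) f = f"
proof (rule LIMSEQ_unique[OF partial_calc_tendsto[OF holomorphic_on_const]])
  assume "f \<in> S"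
  have "partial_calc (\<lambda>z. 1) (Suc K) f = f" for K
    unfolding partial_calc_def sum.lessThan_Suc_shift by (simp add: taylor_const)
  then have "(\<lambda>K. partial_calc (\<lambda>z. 1) (Suc K) f) \<longlonglongrightarrow> f" by simp
  then show "(\<lambda>K. partial_calc (\<lambda>z. 1) K f) \<longlonglongrightarrow> f"
    by (rule LIMSEQ_imp_Suc)
qed

lemma calc_shift:
  assumes h: "disc_holomorphic h" and f: "f \<in> S"
  shows "calc (\<lambda>z. z * h z) f = B (calc h f)"
proof -
  have hol: "disc_holomorphic (\<lambda>z. z * h z)" by (intro holomorphic_intros h)
  have eq: "partial_calc (\<lambda>z. z * h z) (Suc K) f = B (partial_calc h K f)" for K
  proof -
    have "partial_calc (\<lambda>z. z * h z) (Suc K) f = (\<Sum>n<K. scaleC_l2 (taylor h n) ((B ^^ Suc n) f))"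
      unfolding partial_calc_def sum.lessThan_Suc_shift taylor_shift[OF h] by simp
    also have "\<dots> = B (partial_calc h K f)"
      unfolding partial_calc_def
      by (subst bop_sum[OF B]) (simp_all add: scaleC_mem B_pow_mem f bop_scaleC[OF B])
    finally show ?thesis .
  qed
  have "(\<lambda>K. B (partial_calc h K f)) \<longlonglongrightarrow> B (calc h f)"
  proof (rule tendsto_of_N)
    have mem: "partial_calc h K f \<in> S" "calc h f \<in> S" for K
      by (rule bop_mem[OF bop_partial_calc f], rule calc_limit(1)[OF h f])
    have le: "N (B (partial_calc h K f) - B (calc h f)) \<le> q * N (partial_calc h K f - calc h f)" for K
      using contr[OF diff_mem[OF mem, of K]] by (simp add: bop_diff[OF B] mem)
    have ge: "0 \<le> N (B (partial_calc h K f) - B (calc h f))" for K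
      by (intro N_nonneg diff_mem bop_mem[OF B] mem)
    show "(\<lambda>K. N (B (partial_calc h K f) - B (calc h f))) \<longlonglongrightarrow> 0"
      by (rule tendsto_sandwich[OF always_eventually[OF allI[OF ge]] always_eventually[OF allI[OF le]]
            tendsto_const tendsto_mult_right_zero[OF calc_limit(2)[OF h f]]])
  qed (simp_all add: bop_mem[OF B] bop_mem[OF bop_partial_calc f] calc_limit(1)[OF h f])
  then have "(\<lambda>K. partial_calc (\<lambda>z. z * h z) (Suc K) f) \<longlonglongrightarrow> B (calc h f)" by (simp only: eq)
  from LIMSEQ_unique[OF LIMSEQ_Suc[OF partial_calc_tendsto[OF hol f]] this] show ?thesis .
qed

lemma calc_power_mult:
  assumes g: "disc_holomorphic g" and f: "f \<in> S"
  shows "calc (\<lambda>z. z ^ n * g z) f = (B ^^ n) (calc g f)"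
proof (induction n)
  case (Suc n)
  have "calc (\<lambda>z. z * (z ^ n * g z)) f = B (calc (\<lambda>z. z ^ n * g z) f)"
    by (rule calc_shift[OF _ f]) (intro holomorphic_intros g)
  then show ?case by (simp add: Suc mult.assoc)
qed simp

text \<open>
  Multiplicativity: it holds for \<open>h(z) = z\<^sup>n\<close> by a shift of coefficients, hence for polynomials,
  and the Taylor polynomials of \<open>h\<close> converge to \<open>h\<close> uniformly on a disc of radius larger than \<open>q\<close>.
\<close>

lemma calc_mult:
  assumes h: "disc_holomorphic h" and g: "disc_holomorphic g" and f: "f \<in> S"
  shows "calc (\<lambda>z. h z * g z) f = calc h (calc g f)"
proof -
  define T where "T = (\<lambda>K z. \<Sum>n<K. taylor h n * z ^ n)"
  have holT: "disc_holomorphic (T K)" for K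
    unfolding T_def
    by (rule holomorphic_on_sum)
       (rule holomorphic_on_mult[OF holomorphic_on_const holomorphic_on_power[OF holomorphic_on_ident]])
  have poly: "calc (\<lambda>z. T K z * g z) f = partial_calc h K (calc g f)" for K
  proof -
    have "calc (\<lambda>z. \<Sum>n<K. taylor h n * (z ^ n * g z)) f = (\<Sum>n<K. calc (\<lambda>z. taylor h n * (z ^ n * g z)) f)"
      by (rule calc_sum[OF _ f]) (intro holomorphic_intros g)
    also have "\<dots> = partial_calc h K (calc g f)"
      unfolding partial_calc_def
    proof (rule sum.cong[OF refl])
      fix n
      have "disc_holomorphic (\<lambda>z. z ^ n * g z)" by (intro holomorphic_intros g)
      from calc_cmult[OF this f, of "taylor h n"]
      show "calc (\<lambda>z. taylor h n * (z ^ n * g z)) f = scaleC_l2 (taylor h n) ((B ^^ n) (calc g f))"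
        by (simp only: calc_power_mult[OF g f])
    qed
    finally show ?thesis by (simp add: T_def sum_distrib_right mult.assoc)
  qed
  obtain M where M: "0 \<le> M" "\<And>z. cmod z \<le> radius \<Longrightarrow> cmod (g z) \<le> M"
    using disc_holomorphic_bounded[OF g radius(3)] by blast
  have "(\<lambda>K. N (calc (\<lambda>z. T K z * g z) f - calc (\<lambda>z. h z * g z) f)) \<longlonglongrightarrow> 0"
  proof (rule LIMSEQ_I)
    fix e :: real assume "0 < e"
    define W where "W = M * calc_const * N f + 1"
    have pos: "0 < W"
      using M(1) calc_const_nonneg N_nonneg[OF f] by (simp add: W_def add_nonneg_pos)
    define d where "d = e / (2 * W)"
    have "0 < d" using \<open>0 < e\<close> pos by (simp add: d_def)
    then have "\<forall>\<^sub>F K in sequentially. \<forall>z\<in>cball 0 radius. dist (T K z) (h z) < d"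
      using taylor_uniform[OF h radius(2,3)] unfolding uniform_limit_iff T_def by blast
    then obtain K0 where "\<forall>K\<ge>K0. \<forall>z\<in>cball 0 radius. dist (T K z) (h z) < d"
      unfolding eventually_sequentially by blast
    then have K0: "cmod (T K z - h z) < d" if "K0 \<le> K" "cmod z \<le> radius" for K z
      using that by (simp add: dist_norm)
    have "norm (N (calc (\<lambda>z. T K z * g z) f - calc (\<lambda>z. h z * g z) f) - 0) < e" if "K0 \<le> K" for K
    proof -
      have holTg: "disc_holomorphic (\<lambda>z. T K z * g z)" by (rule holomorphic_on_mult[OF holT g])
      have holhg: "disc_holomorphic (\<lambda>z. h z * g z)" by (rule holomorphic_on_mult[OF h g])
      have "N (calc (\<lambda>z. T K z * g z) f - calc (\<lambda>z. h z * g z) f) \<le> (d * M) * calc_const * N f"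
      proof (rule calc_diff_bound[OF holTg holhg _ f])
        fix z :: complex assume z: "cmod z \<le> radius"
        have "cmod (T K z - h z) * cmod (g z) \<le> d * M"
          using K0[OF that z] M z \<open>0 < d\<close> by (intro mult_mono) auto
        then show "cmod (T K z * g z - h z * g z) \<le> d * M"
          by (simp add: norm_mult flip: left_diff_distrib)
      qed
      also have "\<dots> \<le> d * W"
        using \<open>0 < d\<close> by (simp add: W_def algebra_simps)
      also have "\<dots> = e / 2" using pos by (simp add: d_def)
      also have "\<dots> < e" using \<open>0 < e\<close> by simp
      finally show ?thesis
        using N_nonneg[OF diff_mem[OF calc_limit(1)[OF holTg f] calc_limit(1)[OF holhg f]]] by simp
    qed
    then show "\<exists>K0. \<forall>K\<ge>K0. norm (N (calc (\<lambda>z. T K z * g z) f - calc (\<lambda>z. h z * g z) f) - 0) < e" by blast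
  qed
  then have "(\<lambda>K. calc (\<lambda>z. T K z * g z) f) \<longlonglongrightarrow> calc (\<lambda>z. h z * g z) f"
    by (rule tendsto_of_N[OF calc_limit(1)[OF holomorphic_on_mult[OF holT g] f]
          calc_limit(1)[OF holomorphic_on_mult[OF h g] f]])
  then have "(\<lambda>K. partial_calc h K (calc g f)) \<longlonglongrightarrow> calc (\<lambda>z. h z * g z) f" by (simp only: poly)
  from LIMSEQ_unique[OF this partial_calc_tendsto[OF h calc_limit(1)[OF g f]]] show ?thesis .
qed

end

section \<open>Operator-valued curves\<close>

context normed_subspace
begin

lemma curve_vector_derivative:
  assumes bop: "\<And>s. s \<in> I \<Longrightarrow> bop (\<gamma> s)" and t: "t \<in> I" and f: "f \<in> S"
    and der: "op_has_derivative_within S N \<gamma> V t I"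
  shows "((\<lambda>s. \<gamma> s f) has_vector_derivative V f) (at t within I)"
  unfolding has_vector_derivative_iff_quotient
proof -
  let ?T = "\<lambda>s f. (\<gamma> s f - \<gamma> t f) /\<^sub>R (s - t) - V f"
  have V: "bop V" using der by (simp add: op_has_derivative_within_def bounded_ops_iff)
  have bopT: "bop (?T s)" if "s \<in> I" for s
    using bop_diff_op[OF bop_scaleC_op[OF bop_diff_op[OF bop[OF that] bop[OF t]], of "of_real (inverse (s - t))"] V]
    by (simp only: scaleC_l2_of_real)
  have ev: "\<forall>\<^sub>F s in at t within I. bop (?T s)"
    by (auto simp: eventually_at_filter intro!: always_eventually bopT)
  have "((\<lambda>s. N (?T s f)) \<longlongrightarrow> 0) (at t within I)"
    using op_norm_tendsto_0D[OF ev _ f] der by (simp add: op_has_derivative_within_def)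
  moreover have "\<forall>\<^sub>F s in at t within I. norm (?T s f) \<le> N (?T s f)"
    using ev by eventually_elim (rule norm_le_N[OF bop_mem[OF _ f]])
  ultimately have "((\<lambda>s. ?T s f) \<longlongrightarrow> 0) (at t within I)"
    by (rule Lim_null_comparison[rotated])
  then show "((\<lambda>s. (\<gamma> s f - \<gamma> t f) /\<^sub>R (s - t)) \<longlongrightarrow> V f) (at t within I)"
    by (simp add: LIM_zero_iff)
qed

text \<open>The product rule for \<open>\<langle>\<gamma>(s) f, \<gamma>(s) g\<rangle> = \<langle>f, g\<rangle>\<close>, carried out on difference quotients.\<close>

lemma isometric_curve_derivative:
  assumes bop: "\<And>s. s \<in> I \<Longrightarrow> bop (\<gamma> s)"
    and iso: "\<And>s f g. s \<in> I \<Longrightarrow> f \<in> S \<Longrightarrow> g \<in> S \<Longrightarrow> l2_inner (\<gamma> s f) (\<gamma> s g) = l2_inner f g"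
    and t: "t \<in> I" "at t within I \<noteq> bot"
    and der: "op_has_derivative_within S N \<gamma> V t I" and f: "f \<in> S" and g: "g \<in> S"
  shows "l2_inner (V f) (\<gamma> t g) = - l2_inner (\<gamma> t f) (V g)"
proof -
  have df: "((\<lambda>s. \<gamma> s f) has_vector_derivative V f) (at t within I)"
    and dg: "((\<lambda>s. \<gamma> s g) has_vector_derivative V g) (at t within I)"
    by (rule curve_vector_derivative[OF bop t(1) f der], simp, rule curve_vector_derivative[OF bop t(1) g der], simp)
  have cg: "((\<lambda>s. \<gamma> s g) \<longlongrightarrow> \<gamma> t g) (at t within I)"
    using has_vector_derivative_continuous[OF dg] by (simp add: continuous_within)
  let ?Q = "\<lambda>h s. (\<gamma> s h - \<gamma> t h) /\<^sub>R (s - t)"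
  have lim: "((\<lambda>s. l2_inner (?Q f s) (\<gamma> s g) + l2_inner (\<gamma> t f) (?Q g s)) \<longlongrightarrow>
      l2_inner (V f) (\<gamma> t g) + l2_inner (\<gamma> t f) (V g)) (at t within I)"
    using df dg unfolding has_vector_derivative_iff_quotient
    by (intro tendsto_add tendsto_l2_inner tendsto_const cg)
  have "l2_inner (?Q f s) (\<gamma> s g) + l2_inner (\<gamma> t f) (?Q g s) = 0" if "s \<in> I" for s
    using iso[OF that f g] iso[OF t(1) f g]
    by (simp add: l2_inner_scaleC_left l2_inner_scaleC_right l2_inner_diff_left l2_inner_diff_right
        distrib_left[symmetric] flip: scaleC_l2_of_real del: of_real_inverse of_real_diff)
  then have "((\<lambda>s. l2_inner (?Q f s) (\<gamma> s g) + l2_inner (\<gamma> t f) (?Q g s)) \<longlongrightarrow> 0) (at t within I)"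
    by (intro tendsto_eventually) (auto simp: eventually_at_filter intro!: always_eventually)
  from tendsto_unique[OF t(2) lim this] show ?thesis by (simp add: eq_neg_iff_add_eq_0)
qed

end

section \<open>Normal contractions\<close>

text \<open>
  The adjoint \<open>B'\<close> is taken for the inner product of \<open>L\<^sup>2\<close>, while \<open>B\<close> is a contraction for \<open>N\<close>. In the norm \<open>N\<close> the
  operator \<open>B'\<close> is only bounded, so \<open>h(B')\<close> may fail to converge. Therefore normality is proved for Taylor polynomials and
  passed to the limit.
\<close>

locale normal_contraction = contraction S N B q for S :: "'a::euclidean_space l2 set" and N B q +
  fixes B' :: "'a l2 \<Rightarrow> 'a l2"
  assumes B': "bop B'"
    and adj: "f \<in> S \<Longrightarrow> g \<in> S \<Longrightarrow> l2_inner (B f) g = l2_inner f (B' g)"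
    and comm: "f \<in> S \<Longrightarrow> B (B' f) = B' (B f)"
begin

definition partial_adj :: "(complex \<Rightarrow> complex) \<Rightarrow> nat \<Rightarrow> 'a l2 \<Rightarrow> 'a l2" where
  "partial_adj h K g = (\<Sum>n<K. scaleC_l2 (cnj (taylor h n)) ((B' ^^ n) g))"

lemma bop_partial_adj: "bop (partial_adj h K)"
  unfolding partial_adj_def by (intro bop_sum_op bop_scaleC_op bop_funpow B')

lemma B'_pow_mem: "f \<in> S \<Longrightarrow> (B' ^^ n) f \<in> S"
  by (rule bop_mem[OF bop_funpow[OF B']])

lemma adj_pow: "f \<in> S \<Longrightarrow> g \<in> S \<Longrightarrow> l2_inner ((B ^^ n) f) g = l2_inner f ((B' ^^ n) g)"
proof (induction n arbitrary: g)
  case (Suc n)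
  have "l2_inner ((B ^^ Suc n) f) g = l2_inner ((B ^^ n) f) (B' g)"
    using adj[OF B_pow_mem[OF Suc.prems(1)] Suc.prems(2), of n] by simp
  also have "\<dots> = l2_inner f ((B' ^^ Suc n) g)"
    using Suc.IH[OF Suc.prems(1) bop_mem[OF B' Suc.prems(2)]] by (simp add: funpow_swap1)
  finally show ?case .
qed simp

lemma partial_adj: "f \<in> S \<Longrightarrow> g \<in> S \<Longrightarrow> l2_inner (partial_calc h K f) g = l2_inner f (partial_adj h K g)"
  by (simp add: partial_calc_def partial_adj_def l2_inner_sum_left l2_inner_sum_right
      l2_inner_scaleC_left l2_inner_scaleC_right adj_pow)

lemma comm_pow: "f \<in> S \<Longrightarrow> (B ^^ m) ((B' ^^ n) f) = (B' ^^ n) ((B ^^ m) f)"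
proof (induction m)
  case (Suc m)
  have one: "B ((B' ^^ n) g) = (B' ^^ n) (B g)" if "g \<in> S" for g
    by (induction n) (simp_all add: comm[OF B'_pow_mem[OF that]])
  show ?case using Suc one[OF B_pow_mem[OF Suc.prems]] by simp
qed simp

lemma partial_comm:
  assumes f: "f \<in> S"
  shows "partial_calc h K (partial_adj h K f) = partial_adj h K (partial_calc h K f)"
proof -
  have "partial_calc h K (partial_adj h K f) =
      (\<Sum>m<K. \<Sum>n<K. scaleC_l2 (taylor h m * cnj (taylor h n)) ((B ^^ m) ((B' ^^ n) f)))"
    by (simp add: partial_calc_def partial_adj_def bop_sum[OF bop_funpow[OF B]] bop_scaleC[OF bop_funpow[OF B]]
        scaleC_mem B'_pow_mem f scaleC_l2_sum_right)
  also have "\<dots> = (\<Sum>n<K. \<Sum>m<K. scaleC_l2 (cnj (taylor h n) * taylor h m) ((B' ^^ n) ((B ^^ m) f)))"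
    by (subst sum.swap) (simp add: comm_pow f mult.commute)
  also have "\<dots> = partial_adj h K (partial_calc h K f)"
    by (simp add: partial_calc_def partial_adj_def bop_sum[OF bop_funpow[OF B']] bop_scaleC[OF bop_funpow[OF B']]
        scaleC_mem B_pow_mem f scaleC_l2_sum_right)
  finally show ?thesis .
qed

text \<open>For a polynomial \<open>P = p(B)\<close> with adjoint \<open>P'\<close>: \<open>\<parallel>P f\<parallel>\<^sup>2 = \<langle>f, P' P f\<rangle>\<close>, and \<open>\<parallel>P' g\<parallel> = \<parallel>P g\<parallel>\<close> for \<open>g = P f\<close> as they commute.\<close>

lemma partial_calc_normal:
  assumes f: "f \<in> S"
  shows "(norm (partial_calc h K f))\<^sup>2 \<le> norm (partial_calc h K (partial_calc h K f)) * norm f"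
proof -
  let ?P = "partial_calc h K" and ?P' = "partial_adj h K"
  have P: "?P g \<in> S" if "g \<in> S" for g by (rule bop_mem[OF bop_partial_calc that])
  have P': "?P' g \<in> S" if "g \<in> S" for g by (rule bop_mem[OF bop_partial_adj that])
  have eq: "norm (?P' g) = norm (?P g)" if g: "g \<in> S" for g
  proof -
    have "l2_inner (?P' g) (?P' g) = l2_inner (?P (?P' g)) g"
      by (rule partial_adj[OF P'[OF g] g, symmetric])
    also have "\<dots> = l2_inner (?P' (?P g)) g" by (simp only: partial_comm[OF g])
    also have "\<dots> = cnj (l2_inner g (?P' (?P g)))" by (rule l2_inner_commute)
    also have "\<dots> = cnj (l2_inner (?P g) (?P g))" by (simp only: partial_adj[OF g P[OF g]])
    finally have "complex_of_real ((norm (?P' g))\<^sup>2) = complex_of_real ((norm (?P g))\<^sup>2)"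
      by (simp add: l2_inner_self del: of_real_power)
    then have "(norm (?P' g))\<^sup>2 = (norm (?P g))\<^sup>2" by (simp only: of_real_eq_iff)
    then show ?thesis by (simp add: power2_eq_iff_nonneg)
  qed
  have "complex_of_real ((norm (?P f))\<^sup>2) = l2_inner f (?P' (?P f))"
    using partial_adj[OF f P[OF f], of h K] by (simp only: l2_inner_self)
  then have "(norm (?P f))\<^sup>2 = cmod (l2_inner f (?P' (?P f)))"
    by (metis norm_of_real abs_of_nonneg zero_le_power2)
  also have "\<dots> \<le> norm f * norm (?P' (?P f))" by (rule l2_Cauchy_Schwarz)
  finally show ?thesis by (simp add: eq[OF P[OF f]] mult.commute)
qed

lemma calc_normal:
  assumes h: "disc_holomorphic h" and f: "f \<in> S"
  shows "(norm (calc h f))\<^sup>2 \<le> norm (calc h (calc h f)) * norm f"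
proof -
  let ?P = "partial_calc h" and ?u = "calc h f"
  obtain M where M: "0 \<le> M" "\<And>z. cmod z \<le> radius \<Longrightarrow> cmod (h z) \<le> M"
    using disc_holomorphic_bounded[OF h radius(3)] by blast
  have P: "?P K g \<in> S" if "g \<in> S" for g K by (rule bop_mem[OF bop_partial_calc that])
  have u: "?u \<in> S" "calc h ?u \<in> S" using calc_limit(1)[OF h] f by auto
  have le: "N (?P K (?P K f) - calc h ?u) \<le> M * calc_const * N (?P K f - ?u) + N (?P K ?u - calc h ?u)" for K
  proof -
    have eq: "?P K (?P K f) - calc h ?u = ?P K (?P K f - ?u) + (?P K ?u - calc h ?u)"
      unfolding bop_diff[OF bop_partial_calc P[OF f] u(1)] by simp
    have "N (?P K (?P K f - ?u) + (?P K ?u - calc h ?u)) \<le> N (?P K (?P K f - ?u)) + N (?P K ?u - calc h ?u)"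
      by (rule N_add[OF P[OF diff_mem[OF P[OF f] u(1)]] diff_mem[OF P[OF u(1)] u(2)]])
    moreover have "N (?P K (?P K f - ?u)) \<le> M * calc_const * N (?P K f - ?u)"
      by (rule partial_calc_bound[OF h M(2) diff_mem[OF P[OF f] u(1)]])
    ultimately show ?thesis unfolding eq by linarith
  qed
  have bnd: "(\<lambda>K. M * calc_const * N (?P K f - ?u) + N (?P K ?u - calc h ?u)) \<longlonglongrightarrow> 0"
    using tendsto_add[OF tendsto_mult_right_zero[OF calc_limit(2)[OF h f], of "M * calc_const"] calc_limit(2)[OF h u(1)]]
    by simp
  have ge: "0 \<le> N (?P K (?P K f) - calc h ?u)" for K
    by (rule N_nonneg[OF diff_mem[OF P[OF P[OF f]] u(2)]])
  have "(\<lambda>K. N (?P K (?P K f) - calc h ?u)) \<longlonglongrightarrow> 0"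
    by (rule tendsto_sandwich[OF always_eventually[OF allI[OF ge]] always_eventually[OF allI[OF le]] tendsto_const bnd])
  then have lim2: "(\<lambda>K. ?P K (?P K f)) \<longlonglongrightarrow> calc h ?u"
    by (rule tendsto_of_N[OF P[OF P[OF f]] u(2)])
  have l: "(\<lambda>K. (norm (?P K f))\<^sup>2) \<longlonglongrightarrow> (norm ?u)\<^sup>2"
    by (intro tendsto_power tendsto_norm partial_calc_tendsto h f)
  have r: "(\<lambda>K. norm (?P K (?P K f)) * norm f) \<longlonglongrightarrow> norm (calc h ?u) * norm f"
    by (intro tendsto_mult tendsto_norm lim2 tendsto_const)
  show ?thesis
    by (rule LIMSEQ_le[OF l r]) (simp add: partial_calc_normal f)
qed

lemma calc_norm_bound:
  assumes h: "disc_holomorphic h" and M: "\<And>z. cmod z \<le> radius \<Longrightarrow> cmod (h z) \<le> M" and f: "f \<in> S"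
  shows "norm (calc h f) \<le> M * calc_const * norm f"
proof (rule norm_le_of_N_bound[OF _ _ _ _ f])
  have "0 \<le> M" by (rule order_trans[OF norm_ge_zero M[of 0]]) (use radius(2) in simp)
  then show "0 \<le> M * calc_const" by (intro mult_nonneg_nonneg calc_const_nonneg)
  show "calc h g \<in> S" if "g \<in> S" for g by (rule calc_limit(1)[OF h that])
  show "(norm (calc h g))\<^sup>2 \<le> norm (calc h (calc h g)) * norm g" if "g \<in> S" for g
    by (rule calc_normal[OF h that])
  show "N (calc h g) \<le> M * calc_const * N g" if "g \<in> S" for g
    by (rule calc_bound[OF h M that])
qed

end

section \<open>The logarithm of a unitary operator\<close>

text \<open>
  The unitary \<open>G = 2 (1 + B)\<close> has the logarithm \<open>Ln (2 + 2 z)\<close> evaluated at \<open>B\<close>. The functions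
  \<open>exp (t Ln (2 + 2 z))\<close> then give a one-parameter group through \<open>G\<close>.
\<close>

locale unitary_contraction = normal_contraction S N B q B' for S :: "'a::euclidean_space l2 set" and N B q B' +
  assumes unitary: "f \<in> S \<Longrightarrow> norm (2 *\<^sub>R (f + B f)) = norm f"
begin

definition log_symbol :: "complex \<Rightarrow> complex" where "log_symbol z = Ln (2 + 2 * z)"

definition generator :: "'a l2 \<Rightarrow> 'a l2" where "generator = calc log_symbol"

definition flow_symbol :: "real \<Rightarrow> complex \<Rightarrow> complex" where
  "flow_symbol t z = exp (complex_of_real t * log_symbol z)"

definition flow :: "real \<Rightarrow> 'a l2 \<Rightarrow> 'a l2" where "flow t = calc (flow_symbol t)"

lemma Re_two_plus_pos: "cmod z < 1 \<Longrightarrow> 0 < Re (2 + 2 * z)"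
  using abs_Re_le_cmod[of z] by (simp add: abs_le_iff)

lemma two_plus_nonzero: "cmod z < 1 \<Longrightarrow> 2 + 2 * z \<noteq> 0"
  using Re_two_plus_pos[of z] by (metis less_irrefl zero_complex.simps(1))

lemma hol_log: "disc_holomorphic log_symbol"
  unfolding log_symbol_def
proof (rule holomorphic_on_Ln')
  fix z :: complex assume "z \<in> ball 0 1"
  then have "0 < Re (2 + 2 * z)" using Re_two_plus_pos[of z] by simp
  then show "2 + 2 * z \<notin> \<real>\<^sub>\<le>\<^sub>0" by (simp add: complex_nonpos_Reals_iff)
next
  show "disc_holomorphic (\<lambda>z. 2 + 2 * z)"
    by (rule holomorphic_on_add[OF holomorphic_on_const holomorphic_on_mult[OF holomorphic_on_const holomorphic_on_ident]])
qed

lemma hol_flow: "disc_holomorphic (flow_symbol t)"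
proof -
  have "disc_holomorphic (\<lambda>z. complex_of_real t * log_symbol z)"
    by (rule holomorphic_on_mult[OF holomorphic_on_const hol_log])
  moreover have "flow_symbol t = (\<lambda>z. exp (complex_of_real t * log_symbol z))"
    by (simp add: fun_eq_iff flow_symbol_def)
  ultimately show ?thesis by (simp only: holomorphic_on_exp')
qed

lemma bop_generator: "bop generator"
  unfolding generator_def by (rule bop_calc[OF hol_log])

lemma bop_flow: "bop (flow t)"
  unfolding flow_def by (rule bop_calc[OF hol_flow])

lemma flow_bounded_ops: "flow t \<in> bounded_ops S N"
  unfolding flow_def by (rule calc_bounded_ops[OF hol_flow])

lemma generator_bounded_ops: "generator \<in> bounded_ops S N"
  unfolding generator_def by (rule calc_bounded_ops[OF hol_log])

lemma flow_add:
  assumes "f \<in> S"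
  shows "flow (s + t) f = flow s (flow t f)"
proof -
  have "flow_symbol (s + t) = (\<lambda>z. flow_symbol s z * flow_symbol t z)"
    by (simp add: fun_eq_iff flow_symbol_def distrib_right exp_add)
  then show ?thesis
    using calc_mult[OF hol_flow hol_flow assms, of s t] by (simp add: flow_def)
qed

lemma flow_0: "f \<in> S \<Longrightarrow> flow 0 f = f"
proof -
  assume "f \<in> S"
  moreover have "flow_symbol 0 = (\<lambda>z. 1)" by (simp add: fun_eq_iff flow_symbol_def)
  ultimately show ?thesis using calc_one by (simp add: flow_def)
qed

lemma flow_1: "f \<in> S \<Longrightarrow> flow 1 f = 2 *\<^sub>R (f + B f)"
proof -
  assume f: "f \<in> S"
  have hol3: "disc_holomorphic (\<lambda>z. z * 1)"
    by (rule holomorphic_on_mult[OF holomorphic_on_ident holomorphic_on_const])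
  have hol1: "disc_holomorphic (\<lambda>z. 1 + z * 1)"
    by (rule holomorphic_on_add[OF holomorphic_on_const hol3])
  have hol2: "disc_holomorphic (\<lambda>z. 2 * (1 + z * 1))"
    by (rule holomorphic_on_mult[OF holomorphic_on_const hol1])
  have "calc (flow_symbol 1) = calc (\<lambda>z. 2 * (1 + z * 1))"
    by (rule calc_cong[OF hol_flow hol2])
       (simp add: flow_symbol_def log_symbol_def two_plus_nonzero distrib_left)
  then have "flow 1 f = calc (\<lambda>z. 2 * (1 + z * 1)) f" by (simp add: flow_def)
  also have "\<dots> = scaleC_l2 2 (calc (\<lambda>z. 1 + z * 1) f)"
    by (rule calc_cmult[OF hol1 f])
  also have "calc (\<lambda>z. 1 + z * 1) f = f + B f"
    using calc_add[OF holomorphic_on_const hol3 f, of 1] calc_shift[OF holomorphic_on_const f, of 1] calc_one[OF f]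
    by simp
  finally show ?thesis using scaleC_l2_of_real[of 2] by simp
qed

lemma log_symbol_bounded:
  obtains M where "0 \<le> M" "\<And>z. cmod z \<le> radius \<Longrightarrow> cmod (log_symbol z) \<le> M"
  using disc_holomorphic_bounded[OF hol_log radius(3)] by blast

lemma flow_funpow:
  assumes "f \<in> S"
  shows "(flow t ^^ n) f = flow (real n * t) f"
proof (induction n)
  case 0
  then show ?case using flow_0[OF assms] by simp
next
  case (Suc n)
  have "flow (real (Suc n) * t) f = flow (t + real n * t) f" by (simp add: distrib_right)
  also have "\<dots> = flow t (flow (real n * t) f)" by (rule flow_add[OF assms])
  finally show ?case using Suc by simp
qed

lemma norm_flow_nat:
  assumes "f \<in> S"
  shows "norm (flow (real n) f) = norm f"
proof -
  have iso: "norm (flow 1 g) = norm g" if "g \<in> S" for g using flow_1[OF that] unitary[OF that] by simp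
  have mem: "(flow 1 ^^ n) f \<in> S" for n by (rule bop_mem[OF bop_funpow[OF bop_flow] assms])
  have "norm ((flow 1 ^^ n) f) = norm f"
    by (induction n) (simp_all add: iso[OF mem])
  then show ?thesis using flow_funpow[OF assms, of n 1] by simp
qed

text \<open>
  The flow is bounded in \<open>L\<^sup>2\<close> uniformly on \<open>[0, 1]\<close>, hence on \<open>[0, \<infinity>)\<close> since \<open>G\<close> is isometric. A bounded
  sequence has growth rate at most \<open>1\<close>, so normality makes the flow contractive; applied to times
  that add up to an integer this forces isometry.
\<close>

lemma norm_flow_le:
  assumes f: "f \<in> S" and t: "0 \<le> t"
  shows "norm (flow t f) \<le> norm f"
proof -
  obtain M where M: "0 \<le> M" "\<And>z. cmod z \<le> radius \<Longrightarrow> cmod (log_symbol z) \<le> M"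
    using log_symbol_bounded by blast
  have unit: "norm (flow r g) \<le> exp M * calc_const * norm g" if r: "0 \<le> r" "r \<le> 1" and g: "g \<in> S" for r g
    unfolding flow_def
  proof (rule calc_norm_bound[OF hol_flow _ g])
    fix z assume z: "cmod z \<le> radius"
    have "r * Re (log_symbol z) \<le> r * cmod (log_symbol z)"
      by (intro mult_left_mono complex_Re_le_cmod r)
    also have "\<dots> \<le> 1 * M" using r M z by (intro mult_mono) auto
    finally show "cmod (flow_symbol r z) \<le> exp M" by (simp add: flow_symbol_def)
  qed
  have "norm (flow t f) \<le> 1 * norm f"
  proof (rule norm_le_growth_rate[OF _ _ f])
    fix n
    define k where "k = nat \<lfloor>real n * t\<rfloor>"
    define r where "r = real n * t - real k"
    have k: "real k = of_int \<lfloor>real n * t\<rfloor>" using t by (simp add: k_def)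
    then have r: "0 \<le> r" "r \<le> 1" unfolding r_def by linarith+
    have "(flow t ^^ n) f = flow (r + real k) f" by (simp add: flow_funpow[OF f] r_def)
    also have "\<dots> = flow r (flow (real k) f)" by (rule flow_add[OF f])
    finally have "norm ((flow t ^^ n) f) \<le> exp M * calc_const * norm (flow (real k) f)"
      using unit[OF r bop_mem[OF bop_flow f]] by simp
    then show "norm ((flow t ^^ n) f) \<le> (exp M * calc_const * norm f) * 1 ^ n"
      by (simp add: norm_flow_nat[OF f])
  next
    show "g \<in> S \<Longrightarrow> (norm (flow t g))\<^sup>2 \<le> norm (flow t (flow t g)) * norm g" for g
      unfolding flow_def by (rule calc_normal[OF hol_flow])
  qed (simp_all add: bop_mem[OF bop_flow])
  then show ?thesis by simp
qed

lemma norm_flow: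
  assumes f: "f \<in> S"
  shows "norm (flow t f) = norm f"
proof -
  have nonneg: "norm (flow s g) = norm g" if s: "0 \<le> s" and g: "g \<in> S" for s g
  proof (rule antisym[OF norm_flow_le[OF g s]])
    define n where "n = nat \<lceil>s\<rceil>"
    have n: "0 \<le> real n - s" using s by (simp add: n_def)
    have "norm g = norm (flow ((real n - s) + s) g)" by (simp add: norm_flow_nat[OF g])
    also have "\<dots> = norm (flow (real n - s) (flow s g))" by (simp only: flow_add[OF g])
    also have "\<dots> \<le> norm (flow s g)" by (rule norm_flow_le[OF bop_mem[OF bop_flow g] n])
    finally show "norm g \<le> norm (flow s g)" .
  qed
  show ?thesis
  proof (cases "0 \<le> t")
    case False
    have "norm f = norm (flow (- t + t) f)" using flow_0[OF f] by simp
    also have "\<dots> = norm (flow (- t) (flow t f))" by (simp only: flow_add[OF f])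
    also have "\<dots> = norm (flow t f)" using False by (intro nonneg bop_mem[OF bop_flow] f) simp
    finally show ?thesis ..
  qed (rule nonneg[OF _ f])
qed

lemma l2_inner_flow: "f \<in> S \<Longrightarrow> g \<in> S \<Longrightarrow> l2_inner (flow t f) (flow t g) = l2_inner f g"
  by (rule l2_inner_isometry[OF bop_flow norm_flow])

text \<open>
  A second order Taylor bound for the exponential function. Uniform smallness on the disc of the calculus
  becomes smallness in operator norm.
\<close>

lemma flow_derivative_symbol_bound:
  assumes M: "0 \<le> M" "\<And>z. cmod z \<le> radius \<Longrightarrow> cmod (log_symbol z) \<le> M" and z: "cmod z \<le> radius"
    and s: "s \<noteq> t" "\<bar>s - t\<bar> \<le> 1"
  shows "cmod (complex_of_real (inverse (s - t)) * (flow_symbol s z - flow_symbol t z) - log_symbol z * flow_symbol t z)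
    \<le> exp (\<bar>t\<bar> * M) * exp M * M\<^sup>2 * \<bar>s - t\<bar>"
proof -
  define L where "L = log_symbol z"
  define w where "w = complex_of_real (s - t) * L"
  have L: "cmod L \<le> M" using M(2)[OF z] by (simp add: L_def)
  have w: "cmod w \<le> \<bar>s - t\<bar> * M" "cmod w \<le> M"
  proof -
    show 1: "cmod w \<le> \<bar>s - t\<bar> * M" unfolding w_def norm_mult norm_of_real by (intro mult_left_mono L) simp
    show "cmod w \<le> M" using 1 mult_right_mono[OF s(2) M(1)] by simp
  qed
  have "cmod (exp w - (\<Sum>k\<le>1. w ^ k / fact k)) \<le> exp \<bar>Re w\<bar> * cmod w ^ Suc 1 / fact 1"
    by (rule Taylor_exp)
  also have "(\<Sum>k\<le>1. w ^ k / fact k) = 1 + w" by (simp add: atMost_Suc)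
  finally have "cmod (exp w - (1 + w)) \<le> exp \<bar>Re w\<bar> * (cmod w)\<^sup>2" by (simp add: power2_eq_square)
  also have "\<dots> \<le> exp M * (\<bar>s - t\<bar> * M)\<^sup>2"
    using w abs_Re_le_cmod[of w] by (intro mult_mono power_mono) auto
  finally have tay: "cmod (exp w - (1 + w)) \<le> exp M * (\<bar>s - t\<bar> * M)\<^sup>2" .
  have t: "cmod (flow_symbol t z) \<le> exp (\<bar>t\<bar> * M)"
  proof -
    have "t * Re L \<le> \<bar>t\<bar> * \<bar>Re L\<bar>" by (metis abs_ge_self abs_mult)
    also have "\<dots> \<le> \<bar>t\<bar> * M" using abs_Re_le_cmod[of L] L by (intro mult_left_mono) auto
    finally show ?thesis by (simp add: flow_symbol_def L_def)
  qed
  have "flow_symbol s z = flow_symbol t z * exp w"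
    by (simp add: flow_symbol_def w_def L_def mult_exp_exp algebra_simps)
  then have "complex_of_real (inverse (s - t)) * (flow_symbol s z - flow_symbol t z) - log_symbol z * flow_symbol t z
      = complex_of_real (inverse (s - t)) * flow_symbol t z * (exp w - (1 + w))"
    using s(1) by (simp add: w_def L_def field_simps)
  also have "cmod \<dots> \<le> inverse \<bar>s - t\<bar> * exp (\<bar>t\<bar> * M) * (exp M * (\<bar>s - t\<bar> * M)\<^sup>2)"
    unfolding norm_mult using t tay by (intro mult_mono) (auto simp: norm_inverse simp del: of_real_diff)
  also have "\<dots> = exp (\<bar>t\<bar> * M) * exp M * M\<^sup>2 * \<bar>s - t\<bar>"
  proof -
    have "inverse d * A * (E * (d * M)\<^sup>2) = A * E * M\<^sup>2 * d" if "d \<noteq> 0" for A E d :: real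
      using that by (simp add: power2_eq_square field_simps)
    from this[of "\<bar>s - t\<bar>"] show ?thesis using s(1) by (simp only: abs_eq_0 right_minus_eq not_False_eq_True)
  qed
  finally show ?thesis .
qed

lemma flow_has_derivative: "op_has_derivative_within S N flow (\<lambda>f. generator (flow t f)) t I"
  unfolding op_has_derivative_within_def
proof
  have "bop (\<lambda>f. generator (flow t f))" by (rule bop_comp[OF bop_generator bop_flow])
  moreover have "flow t f = 0" if "f \<notin> S" for f using calc_outside[OF that] by (simp add: flow_def)
  ultimately show "(\<lambda>f. generator (flow t f)) \<in> bounded_ops S N"
    by (simp add: bounded_ops_iff bop_zero[OF bop_generator])
  obtain M where M: "0 \<le> M" "\<And>z. cmod z \<le> radius \<Longrightarrow> cmod (log_symbol z) \<le> M"
    using log_symbol_bounded by blast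
  define C where "C = exp (\<bar>t\<bar> * M) * exp M * M\<^sup>2"
  have C: "0 \<le> C" by (simp add: C_def)
  show "((\<lambda>s. op_norm S N (\<lambda>f. (flow s f - flow t f) /\<^sub>R (s - t) - generator (flow t f))) \<longlongrightarrow> 0) (at t within I)"
  proof (rule op_norm_tendsto_0I)
    show "bop (\<lambda>f. (flow s f - flow t f) /\<^sub>R (s - t) - generator (flow t f))" for s
      using bop_diff_op[OF bop_scaleC_op[OF bop_diff_op[OF bop_flow bop_flow], of "of_real (inverse (s - t))" s t]
          bop_comp[OF bop_generator bop_flow]] by (simp only: scaleC_l2_of_real)
    have "((\<lambda>s. C * calc_const * \<bar>s - t\<bar>) \<longlongrightarrow> C * calc_const * \<bar>t - t\<bar>) (at t within I)"
      by (intro tendsto_intros)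
    then show "((\<lambda>s. C * calc_const * \<bar>s - t\<bar>) \<longlongrightarrow> 0) (at t within I)" by simp
    have near: "N ((flow s f - flow t f) /\<^sub>R (s - t) - generator (flow t f)) \<le> C * calc_const * \<bar>s - t\<bar> * N f"
      if s: "s \<noteq> t" "\<bar>s - t\<bar> \<le> 1" and f: "f \<in> S" for s f
    proof -
      let ?h = "\<lambda>z. complex_of_real (inverse (s - t)) * (flow_symbol s z - flow_symbol t z)"
      have holh: "disc_holomorphic ?h"
        by (rule holomorphic_on_mult[OF holomorphic_on_const holomorphic_on_diff[OF hol_flow hol_flow]])
      have holg: "disc_holomorphic (\<lambda>z. log_symbol z * flow_symbol t z)"
        by (rule holomorphic_on_mult[OF hol_log hol_flow])
      have "calc ?h f = (flow s f - flow t f) /\<^sub>R (s - t)"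
        using calc_cmult[OF holomorphic_on_diff[OF hol_flow hol_flow] f, of "complex_of_real (inverse (s - t))" s t]
        by (simp only: calc_diff[OF hol_flow hol_flow f] flow_def scaleC_l2_of_real)
      moreover have "calc (\<lambda>z. log_symbol z * flow_symbol t z) f = generator (flow t f)"
        by (simp add: calc_mult[OF hol_log hol_flow f] flow_def generator_def)
      moreover have "N (calc ?h f - calc (\<lambda>z. log_symbol z * flow_symbol t z) f)
          \<le> (exp (\<bar>t\<bar> * M) * exp M * M\<^sup>2 * \<bar>s - t\<bar>) * calc_const * N f"
        by (rule calc_diff_bound[OF holh holg flow_derivative_symbol_bound[OF M _ s] f])
      ultimately show ?thesis by (simp add: C_def mult_ac)
    qed
    show "\<forall>\<^sub>F s in at t within I. 0 \<le> C * calc_const * \<bar>s - t\<bar> \<and>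
        (\<forall>f\<in>S. N ((flow s f - flow t f) /\<^sub>R (s - t) - generator (flow t f)) \<le> C * calc_const * \<bar>s - t\<bar> * N f)"
      unfolding eventually_at using near C calc_const_nonneg
      by (intro exI[of _ 1]) (auto simp: dist_real_def)
  qed
qed

lemma generator_antisymmetric:
  assumes f: "f \<in> S" and g: "g \<in> S"
  shows "l2_inner (generator f) g = - l2_inner f (generator g)"
  using isometric_curve_derivative[OF bop_flow l2_inner_flow UNIV_I _ flow_has_derivative f g, of 0]
  by (simp add: flow_0 f g)

lemma scaled_generator_funpow:
  assumes f: "f \<in> S"
  shows "((\<lambda>f. t *\<^sub>R generator f) ^^ k) f = calc (\<lambda>z. (complex_of_real t * log_symbol z) ^ k) f"
proof (induction k)
  case 0
  then show ?case using calc_one[OF f] by simp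
next
  case (Suc k)
  have hol: "disc_holomorphic (\<lambda>z. complex_of_real t * log_symbol z)"
    by (rule holomorphic_on_mult[OF holomorphic_on_const hol_log])
  have holk: "disc_holomorphic (\<lambda>z. (complex_of_real t * log_symbol z) ^ k)"
    by (rule holomorphic_on_power[OF hol])
  have "calc (\<lambda>z. (complex_of_real t * log_symbol z) ^ Suc k) f
      = calc (\<lambda>z. complex_of_real t * log_symbol z) (calc (\<lambda>z. (complex_of_real t * log_symbol z) ^ k) f)"
    using calc_mult[OF hol holk f] by simp
  also have "\<dots> = t *\<^sub>R generator (calc (\<lambda>z. (complex_of_real t * log_symbol z) ^ k) f)"
    by (simp only: calc_cmult[OF hol_log calc_limit(1)[OF holk f]] generator_def scaleC_l2_of_real)
  finally show ?case using Suc by simp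
qed

text \<open>The partial sums of the operator series are the values at \<open>B\<close> of those of the scalar series, which converge uniformly.\<close>

lemma flow_eq_exp: "op_exp S N (\<lambda>f. t *\<^sub>R generator f) = flow t"
proof -
  let ?X = "\<lambda>f. t *\<^sub>R generator f"
  let ?sum = "\<lambda>n f. \<Sum>k<n. (?X ^^ k) f /\<^sub>R fact k"
  have X: "bop ?X"
    using bop_scaleC_op[OF bop_generator, of "of_real t"] by (simp only: scaleC_l2_of_real)
  have bop_sum: "bop (?sum n)" for n
  proof (rule bop_sum_op)
    fix k show "bop (\<lambda>f. (?X ^^ k) f /\<^sub>R fact k)"
      using bop_scaleC_op[OF bop_funpow[OF X], of "of_real (inverse (fact k))" k] by (simp only: scaleC_l2_of_real)
  qed
  obtain M where M: "0 \<le> M" "\<And>z. cmod z \<le> radius \<Longrightarrow> cmod (log_symbol z) \<le> M"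
    using log_symbol_bounded by blast
  define R where "R = \<bar>t\<bar> * M"
  have R: "0 \<le> R" using M(1) by (simp add: R_def)
  define c where "c n = exp R * R * (inverse (fact n) * R ^ n) * calc_const" for n
  have c0: "0 \<le> c n" for n using R calc_const_nonneg by (simp add: c_def)
  have remainder: "N (flow t f - ?sum (Suc n) f) \<le> c n * N f" if f: "f \<in> S" for n f
  proof -
    let ?w = "\<lambda>z. complex_of_real t * log_symbol z"
    have hol: "disc_holomorphic ?w" by (rule holomorphic_on_mult[OF holomorphic_on_const hol_log])
    have holk: "disc_holomorphic (\<lambda>z. complex_of_real (inverse (fact k)) * ?w z ^ k)" for k
      by (rule holomorphic_on_mult[OF holomorphic_on_const holomorphic_on_power[OF hol]])
    have "calc (\<lambda>z. \<Sum>k<Suc n. complex_of_real (inverse (fact k)) * ?w z ^ k) f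
        = (\<Sum>k<Suc n. calc (\<lambda>z. complex_of_real (inverse (fact k)) * ?w z ^ k) f)"
      by (rule calc_sum[OF holk f])
    also have "\<dots> = ?sum (Suc n) f"
      by (simp only: calc_cmult[OF holomorphic_on_power[OF hol] f] scaled_generator_funpow[OF f] scaleC_l2_of_real)
    finally have eq: "?sum (Suc n) f = calc (\<lambda>z. \<Sum>k<Suc n. complex_of_real (inverse (fact k)) * ?w z ^ k) f" ..
    have "N (calc (flow_symbol t) f - calc (\<lambda>z. \<Sum>k<Suc n. complex_of_real (inverse (fact k)) * ?w z ^ k) f)
        \<le> (exp R * R ^ Suc n / fact n) * calc_const * N f"
    proof (rule calc_diff_bound[OF hol_flow holomorphic_on_sum[OF holk] _ f])
      fix z assume z: "cmod z \<le> radius"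
      have w: "cmod (?w z) \<le> R"
        unfolding R_def norm_mult norm_of_real by (intro mult_left_mono M(2)[OF z]) simp
      have "cmod (exp (?w z) - (\<Sum>k\<le>n. ?w z ^ k / fact k)) \<le> exp \<bar>Re (?w z)\<bar> * cmod (?w z) ^ Suc n / fact n"
        by (rule Taylor_exp)
      also have "\<dots> \<le> exp R * R ^ Suc n / fact n"
        using w abs_Re_le_cmod[of "?w z"] by (intro divide_right_mono mult_mono power_mono) auto
      finally show "cmod (flow_symbol t z - (\<Sum>k<Suc n. complex_of_real (inverse (fact k)) * ?w z ^ k))
          \<le> exp R * R ^ Suc n / fact n"
        by (simp add: flow_symbol_def lessThan_Suc_atMost divide_inverse mult.commute)
    qed
    then show ?thesis unfolding eq by (simp add: flow_def c_def divide_inverse mult_ac)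
  qed
  have "(\<lambda>n. op_norm S N (\<lambda>f. flow t f - ?sum (Suc n) f)) \<longlonglongrightarrow> 0"
  proof (rule op_norm_tendsto_0I)
    show "bop (\<lambda>f. flow t f - ?sum (Suc n) f)" for n by (rule bop_diff_op[OF bop_flow bop_sum])
    show "\<forall>\<^sub>F n in sequentially. 0 \<le> c n \<and> (\<forall>f\<in>S. N (flow t f - ?sum (Suc n) f) \<le> c n * N f)"
      by (intro always_eventually allI conjI ballI c0 remainder)
    have "(\<lambda>n. exp R * R * (inverse (fact n) * R ^ n) * calc_const) \<longlonglongrightarrow> exp R * R * 0 * calc_const"
      by (intro tendsto_mult tendsto_const summable_LIMSEQ_zero summable_exp)
    then show "c \<longlonglongrightarrow> 0" unfolding c_def[abs_def] by simp
  qed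
  then have lim: "(\<lambda>n. op_norm S N (\<lambda>f. flow t f - ?sum n f)) \<longlonglongrightarrow> 0"
    by (rule LIMSEQ_imp_Suc)
  show ?thesis
    unfolding op_exp_def
  proof (rule the_equality)
    show "flow t \<in> bounded_ops S N \<and> (\<lambda>n. op_norm S N (\<lambda>f. flow t f - ?sum n f)) \<longlonglongrightarrow> 0"
      using flow_bounded_ops lim by blast
    fix E assume E: "E \<in> bounded_ops S N \<and> (\<lambda>n. op_norm S N (\<lambda>f. E f - ?sum n f)) \<longlonglongrightarrow> 0"
    then have bopE: "bop E" and E0: "f \<notin> S \<Longrightarrow> E f = 0" for f by (auto simp: bounded_ops_iff)
    show "E = flow t"
    proof
      fix f
      show "E f = flow t f"
      proof (cases "f \<in> S")
        case f: True
        have mem: "?sum n f \<in> S" "E f - ?sum n f \<in> S" "flow t f - ?sum n f \<in> S" for n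
          using bop_mem[OF bop_sum f] bop_mem[OF bopE f] bop_mem[OF bop_flow f] diff_mem by simp_all
        have evE: "\<forall>\<^sub>F n in sequentially. bop (\<lambda>f. E f - ?sum n f)"
          and evF: "\<forall>\<^sub>F n in sequentially. bop (\<lambda>f. flow t f - ?sum n f)"
          by (intro always_eventually allI bop_diff_op bopE bop_flow bop_sum)+
        have "(\<lambda>n. N ((E f - ?sum n f))) \<longlonglongrightarrow> 0"
          by (rule op_norm_tendsto_0D[OF evE conjunct2[OF E] f])
        then have "(\<lambda>n. E f - ?sum n f) \<longlonglongrightarrow> 0"
          using tendsto_of_N[OF mem(2) zero_mem] by simp
        moreover have "(\<lambda>n. N ((flow t f - ?sum n f))) \<longlonglongrightarrow> 0"
          by (rule op_norm_tendsto_0D[OF evF lim f])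
        then have "(\<lambda>n. flow t f - ?sum n f) \<longlonglongrightarrow> 0"
          using tendsto_of_N[OF mem(3) zero_mem] by simp
        ultimately have "(\<lambda>n. (E f - ?sum n f) - (flow t f - ?sum n f)) \<longlonglongrightarrow> 0 - 0"
          by (rule tendsto_diff)
        then show ?thesis by (simp add: LIMSEQ_const_iff)
      next
        case False
        then show ?thesis using E0 calc_outside by (simp add: flow_def)
      qed
    qed
  qed
qed

text \<open>
  Spectral mapping for the approximate point spectrum: if \<open>a\<close> is not a value of the symbol \<open>h\<close>, then
  \<open>1 / (h - a)\<close> evaluated at \<open>B\<close> is a bounded left inverse of \<open>h(B) - a\<close>.
\<close>

lemma approximate_eigenvalue_in_range:
  assumes h: "disc_holomorphic h"
    and approx: "\<And>\<eta>. 0 < \<eta> \<Longrightarrow> \<exists>v\<in>S. norm v = 1 \<and> norm (calc h v - scaleC_l2 a v) \<le> \<eta>"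
  shows "\<exists>b. cmod b < 1 \<and> h b = a"
proof (rule ccontr)
  assume "\<not> ?thesis"
  then have nz: "h z - a \<noteq> 0" if "cmod z < 1" for z using that by auto
  have hola: "disc_holomorphic (\<lambda>z. h z - a)" by (rule holomorphic_on_diff[OF h holomorphic_on_const])
  have holi: "disc_holomorphic (\<lambda>z. 1 / (h z - a))"
    by (rule holomorphic_on_divide[OF holomorphic_on_const hola]) (use nz in auto)
  obtain M where M: "0 \<le> M" "\<And>z. cmod z \<le> radius \<Longrightarrow> cmod (1 / (h z - a)) \<le> M"
    using disc_holomorphic_bounded[OF holi radius(3)] by blast
  define C where "C = M * calc_const"
  have C: "0 \<le> C" using M(1) calc_const_nonneg by (simp add: C_def)
  obtain v where v: "v \<in> S" "norm v = 1" "norm (calc h v - scaleC_l2 a v) \<le> 1 / (2 * (C + 1))"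
    using approx[of "1 / (2 * (C + 1))"] C by auto
  have sub: "calc (\<lambda>z. h z - a) v = calc h v - scaleC_l2 a v"
    using calc_diff[OF h holomorphic_on_const v(1), of a] calc_cmult[OF holomorphic_on_const v(1), of a 1] calc_one[OF v(1)]
    by simp
  have "calc (\<lambda>z. 1 / (h z - a)) (calc (\<lambda>z. h z - a) v) = calc (\<lambda>z. 1 / (h z - a) * (h z - a)) v"
    by (rule calc_mult[OF holi hola v(1), symmetric])
  also have "calc (\<lambda>z. 1 / (h z - a) * (h z - a)) = calc (\<lambda>z. 1)"
    by (rule calc_cong[OF holomorphic_on_mult[OF holi hola] holomorphic_on_const]) (use nz in simp)
  finally have "norm v = norm (calc (\<lambda>z. 1 / (h z - a)) (calc h v - scaleC_l2 a v))"
    by (simp add: calc_one[OF v(1)] sub)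
  also have "\<dots> \<le> C * norm (calc h v - scaleC_l2 a v)"
    unfolding C_def
    by (rule calc_norm_bound[OF holi M(2) diff_mem[OF calc_limit(1)[OF h v(1)] scaleC_mem[OF v(1)]]])
  also have "\<dots> \<le> C * (1 / (2 * (C + 1)))" by (rule mult_left_mono[OF v(3) C])
  also have "\<dots> < 1" using C by (simp add: divide_less_eq)
  finally show False using v(2) by simp
qed

text \<open>
  The imaginary part of \<open>Ln (2 + 2 z)\<close> is smaller than \<open>\<pi>\<close>, which bounds the norm of the generator.
  As \<open>exp w - exp a\<close> is divisible by \<open>w - a\<close>, an approximate eigenvector of the generator is one of \<open>G\<close>.
\<close>

lemma generator_norm_attained:
  assumes \<theta>: "0 < \<theta>" and bound: "\<And>f. f \<in> S \<Longrightarrow> norm (generator f) \<le> \<theta> * norm f"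
    and least: "\<And>C. 0 \<le> C \<Longrightarrow> (\<And>f. f \<in> S \<Longrightarrow> norm (generator f) \<le> C * norm f) \<Longrightarrow> \<theta> \<le> C"
  shows "\<theta> < pi" and "\<And>\<eta>. 0 < \<eta> \<Longrightarrow> \<exists>v\<in>S. norm v = 1 \<and> inner (flow 1 v) v \<le> cos \<theta> + \<eta>"
proof -
  let ?approx = "\<lambda>a. \<forall>\<eta>>0. \<exists>v\<in>S. norm v = 1 \<and> norm (generator v - scaleC_l2 a v) \<le> \<eta>"
  have "?approx (\<i> * \<theta>) \<or> ?approx (- \<i> * \<theta>)"
  proof (rule ccontr)
    assume "\<not> ?thesis"
    then have "\<not> ?approx (\<i> * \<theta>)" "\<not> ?approx (- \<i> * \<theta>)" by blast+
    then obtain \<eta>1 \<eta>2 where \<eta>1: "0 < \<eta>1" "\<not> (\<exists>v\<in>S. norm v = 1 \<and> norm (generator v - scaleC_l2 (\<i> * \<theta>) v) \<le> \<eta>1)"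
      and \<eta>2: "0 < \<eta>2" "\<not> (\<exists>v\<in>S. norm v = 1 \<and> norm (generator v - scaleC_l2 (- \<i> * \<theta>) v) \<le> \<eta>2)"
      by blast
    have "0 < min \<eta>1 \<eta>2" using \<eta>1(1) \<eta>2(1) by simp
    from antisymmetric_approximate_eigenvector[OF bop_generator generator_antisymmetric \<theta> bound least this]
    obtain v where v: "v \<in> S" "norm v = 1" "norm (generator v - scaleC_l2 (\<i> * \<theta>) v) \<le> min \<eta>1 \<eta>2
        \<or> norm (generator v - scaleC_l2 (- \<i> * \<theta>) v) \<le> min \<eta>1 \<eta>2"
      by blast
    from v(3) have "norm (generator v - scaleC_l2 (\<i> * \<theta>) v) \<le> \<eta>1
        \<or> norm (generator v - scaleC_l2 (- \<i> * \<theta>) v) \<le> \<eta>2"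
      by linarith
    then show False using v(1,2) \<eta>1(2) \<eta>2(2) by blast
  qed
  then obtain a where a: "?approx a" "Re a = 0" "\<bar>Im a\<bar> = \<theta>"
    using \<theta> by (elim disjE) (force)+
  obtain b where b: "cmod b < 1" "log_symbol b = a"
    using approximate_eigenvalue_in_range[OF hol_log, of a] a(1) by (auto simp: generator_def)
  then have "\<bar>Im a\<bar> < pi / 2"
    using Re_Ln_pos_lt_imp[OF Re_two_plus_pos[OF b(1)]] by (simp add: log_symbol_def)
  then show "\<theta> < pi" using a(3) pi_gt_zero by linarith
  have Re_exp: "Re (exp a) = cos \<theta>"
    using a(2,3) by (auto simp: Re_exp abs_if split: if_splits)
  fix \<eta> :: real assume \<eta>: "0 < \<eta>"
  define \<kappa> where "\<kappa> w = (if w = a then deriv exp a else (exp w - exp a) / (w - a))" for w :: complex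
  have "\<kappa> holomorphic_on UNIV"
    unfolding \<kappa>_def by (rule pole_lemma) (auto intro: holomorphic_on_exp)
  then have hol\<kappa>: "disc_holomorphic (\<lambda>z. \<kappa> (log_symbol z))"
    using holomorphic_on_compose_gen[OF hol_log, of \<kappa> UNIV] by (simp add: o_def)
  have hola: "disc_holomorphic (\<lambda>z. log_symbol z - a)"
    by (rule holomorphic_on_diff[OF hol_log holomorphic_on_const])
  obtain M where M: "0 \<le> M" "\<And>z. cmod z \<le> radius \<Longrightarrow> cmod (\<kappa> (log_symbol z)) \<le> M"
    using disc_holomorphic_bounded[OF hol\<kappa> radius(3)] by blast
  define C where "C = M * calc_const"
  have C: "0 \<le> C" using M(1) calc_const_nonneg by (simp add: C_def)
  have "0 < \<eta> / (C + 1)" using \<eta> C by simp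
  then obtain v where v: "v \<in> S" "norm v = 1" "norm (generator v - scaleC_l2 a v) \<le> \<eta> / (C + 1)"
    using a(1) by blast
  have const: "calc (\<lambda>z. c) v = scaleC_l2 c v" for c
    using calc_cmult[OF holomorphic_on_const v(1), of c 1] calc_one[OF v(1)] by simp
  have "flow_symbol 1 z - exp a = \<kappa> (log_symbol z) * (log_symbol z - a)" for z
    by (simp add: flow_symbol_def \<kappa>_def)
  then have "flow 1 v - scaleC_l2 (exp a) v = calc (\<lambda>z. \<kappa> (log_symbol z) * (log_symbol z - a)) v"
    using calc_diff[OF hol_flow holomorphic_on_const v(1), of 1 "exp a"] by (simp add: flow_def const)
  also have "\<dots> = calc (\<lambda>z. \<kappa> (log_symbol z)) (generator v - scaleC_l2 a v)"
    using calc_diff[OF hol_log holomorphic_on_const v(1), of a]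
    by (simp add: calc_mult[OF hol\<kappa> hola v(1)] const generator_def)
  finally have "norm (flow 1 v - scaleC_l2 (exp a) v) \<le> C * norm (generator v - scaleC_l2 a v)"
    unfolding C_def
    using calc_norm_bound[OF hol\<kappa> M(2) diff_mem[OF bop_mem[OF bop_generator v(1)] scaleC_mem[OF v(1), of a]]] by simp
  also have "\<dots> \<le> C * (\<eta> / (C + 1))" by (rule mult_left_mono[OF v(3) C])
  also have "\<dots> \<le> \<eta>" using C \<eta> by (simp add: divide_le_eq algebra_simps)
  finally have close: "norm (flow 1 v - scaleC_l2 (exp a) v) \<le> \<eta>" .
  have "inner (scaleC_l2 (exp a) v) v = cos \<theta>"
    using v(2) Re_exp by (simp add: inner_l2_def l2_inner_scaleC_left l2_inner_self)
  moreover have "inner (flow 1 v - scaleC_l2 (exp a) v) v \<le> \<eta>"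
    using Cauchy_Schwarz_ineq2[of "flow 1 v - scaleC_l2 (exp a) v" v] close v(2) by simp
  ultimately have "inner (flow 1 v) v \<le> cos \<theta> + \<eta>" by (simp add: inner_diff_left)
  with v show "\<exists>v\<in>S. norm v = 1 \<and> inner (flow 1 v) v \<le> cos \<theta> + \<eta>" by blast
qed

end

section \<open>The isometry group of \<open>H\<^sup>1\<^sub>0\<close> and its curves\<close>

locale open_domain =
  fixes \<Omega> :: "'a::euclidean_space set"
  assumes open_domain: "open \<Omega>"

sublocale open_domain \<subseteq> H: complete_subspace "H10 \<Omega>" "H1_norm \<Omega>"
proof
  show "0 \<in> H10 \<Omega>" by (rule H10_zero[OF open_domain])
  show "f + g \<in> H10 \<Omega>" if "f \<in> H10 \<Omega>" "g \<in> H10 \<Omega>" for f g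
    by (rule H10_add[OF open_domain that])
  show "scaleC_l2 c f \<in> H10 \<Omega>" if "f \<in> H10 \<Omega>" for f c
    by (rule H10_scaleC[OF open_domain that])
  show "H1_norm \<Omega> (f + g) \<le> H1_norm \<Omega> f + H1_norm \<Omega> g" if "f \<in> H10 \<Omega>" "g \<in> H10 \<Omega>" for f g
    by (rule H1_norm_add[OF open_domain that[THEN subsetD[OF H10_subset_H1[OF open_domain]]]])
  show "H1_norm \<Omega> (scaleC_l2 c f) = cmod c * H1_norm \<Omega> f" if "f \<in> H10 \<Omega>" for f c
    by (rule H1_norm_scaleC[OF open_domain subsetD[OF H10_subset_H1[OF open_domain] that]])
  show "norm f \<le> H1_norm \<Omega> f" for f by (rule norm_le_H1_norm)
  show "\<exists>f\<in>H10 \<Omega>. (\<lambda>n. H1_norm \<Omega> (X n - f)) \<longlonglongrightarrow> 0"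
    if "\<And>n. X n \<in> H10 \<Omega>" "\<And>e. 0 < e \<Longrightarrow> \<exists>M. \<forall>m\<ge>M. \<forall>n\<ge>M. H1_norm \<Omega> (X m - X n) < e" for X
    by (rule H10_complete[OF open_domain that])
qed

sublocale open_domain \<subseteq> L: normed_subspace "l2_on \<Omega>" norm
  by unfold_locales (simp_all add: l2_on_zero l2_on_add l2_on_scaleC norm_triangle_ineq norm_scaleC_l2)

context open_domain
begin

lemma H10_in_l2_on: "f \<in> H10 \<Omega> \<Longrightarrow> f \<in> l2_on \<Omega>"
  by (rule subsetD[OF H10_subset_l2_on[OF open_domain]])

lemma closed_domain: "closed (l2_on \<Omega>)"
  using open_domain by (intro closed_l2_on) simp

lemma H10_approx:
  assumes "f \<in> l2_on \<Omega>"
  obtains x where "\<And>n. x n \<in> H10 \<Omega>" "x \<longlonglongrightarrow> f"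
proof -
  have "f \<in> closure (H10 \<Omega>)" by (rule subsetD[OF H10_dense[OF open_domain] assms])
  then show thesis using that unfolding closure_sequential by blast
qed

lemma L_bop_limit:
  assumes W: "L.bop W" and x: "\<And>n. x n \<in> l2_on \<Omega>" "x \<longlonglongrightarrow> f" and f: "f \<in> l2_on \<Omega>"
  shows "(\<lambda>n. W (x n)) \<longlonglongrightarrow> W f"
proof -
  obtain C where C: "0 \<le> C" "\<And>f. f \<in> l2_on \<Omega> \<Longrightarrow> norm (W f) \<le> C * norm f" using L.bop_bound[OF W] by blast
  have "(\<lambda>n. C * norm (x n - f)) \<longlonglongrightarrow> 0"
    using tendsto_mult_right_zero[OF tendsto_norm_zero[OF LIM_zero[OF x(2)]]] .
  moreover have "norm (W (x n) - W f) \<le> C * norm (x n - f)" for n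
    using C(2)[OF L.diff_mem[OF x(1)[of n] f]] by (simp add: L.bop_diff[OF W x(1) f])
  ultimately have "(\<lambda>n. W (x n) - W f) \<longlonglongrightarrow> 0"
    by (rule Lim_null_comparison[OF always_eventually[OF allI], rotated])
  then show ?thesis by (simp add: LIM_zero_iff)
qed

text \<open>Extension by uniform continuity. Linearity and the bound are inherited through approximating sequences.\<close>

lemma l2_extension_ex:
  assumes V: "H.bop V" and C: "0 \<le> C" "\<And>f. f \<in> H10 \<Omega> \<Longrightarrow> norm (V f) \<le> C * norm f"
  shows "\<exists>W\<in>bounded_ops (l2_on \<Omega>) norm. (\<forall>f\<in>H10 \<Omega>. W f = V f) \<and> (\<forall>f\<in>l2_on \<Omega>. norm (W f) \<le> C * norm f)"
proof -
  have "uniformly_continuous_on (H10 \<Omega>) V"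
    unfolding uniformly_continuous_on_def
  proof (intro allI impI)
    fix e :: real assume e: "0 < e"
    have "dist (V g) (V f) < e" if "f \<in> H10 \<Omega>" "g \<in> H10 \<Omega>" "dist g f < e / (C + 1)" for f g
    proof -
      have "dist (V g) (V f) \<le> C * dist g f"
        using C(2)[OF H.diff_mem[OF that(2,1)]] by (simp add: dist_norm H.bop_diff[OF V that(2,1)])
      also have "\<dots> \<le> C * (e / (C + 1))" using that(3) C(1) by (intro mult_left_mono) auto
      also have "\<dots> < e" using C(1) e by (simp add: divide_less_eq algebra_simps)
      finally show ?thesis .
    qed
    then show "\<exists>d>0. \<forall>x\<in>H10 \<Omega>. \<forall>x'\<in>H10 \<Omega>. dist x' x < d \<longrightarrow> dist (V x') (V x) < e"
      using e C(1) by (intro exI[of _ "e / (C + 1)"]) auto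
  qed
  from uniformly_continuous_on_extension_on_closure[OF this]
  obtain g where g: "uniformly_continuous_on (closure (H10 \<Omega>)) g" "\<And>x. x \<in> H10 \<Omega> \<Longrightarrow> V x = g x"
    by metis
  define W where "W f = (if f \<in> l2_on \<Omega> then g f else 0)" for f
  have agree: "W f = V f" if "f \<in> H10 \<Omega>" for f
    using g(2)[OF that] H10_in_l2_on[OF that] by (simp add: W_def)
  have lim: "(\<lambda>n. V (x n)) \<longlonglongrightarrow> W f" if x: "\<And>n. x n \<in> H10 \<Omega>" "x \<longlonglongrightarrow> f" and f: "f \<in> l2_on \<Omega>" for x f
  proof -
    have "(\<lambda>n. g (x n)) \<longlonglongrightarrow> g f"
      by (rule continuous_on_tendsto_compose[OF uniformly_continuous_imp_continuous[OF g(1)] x(2)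
            subsetD[OF H10_dense[OF open_domain] f]])
         (intro always_eventually allI subsetD[OF closure_subset] x(1))
    then show ?thesis using f by (simp add: W_def g(2)[OF x(1)])
  qed
  have mem: "W f \<in> l2_on \<Omega>" if f: "f \<in> l2_on \<Omega>" for f
  proof -
    obtain x where x: "\<And>n. x n \<in> H10 \<Omega>" "x \<longlonglongrightarrow> f" using H10_approx[OF f] by blast
    show ?thesis
      by (rule closed_sequentially[OF closed_domain H10_in_l2_on[OF H.bop_mem[OF V x(1)]] lim[OF x f]])
  qed
  have add: "W (f + h) = W f + W h" if f: "f \<in> l2_on \<Omega>" and h: "h \<in> l2_on \<Omega>" for f h
  proof -
    obtain x where x: "\<And>n. x n \<in> H10 \<Omega>" "x \<longlonglongrightarrow> f" using H10_approx[OF f] by blast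
    obtain y where y: "\<And>n. y n \<in> H10 \<Omega>" "y \<longlonglongrightarrow> h" using H10_approx[OF h] by blast
    have "(\<lambda>n. V (x n + y n)) \<longlonglongrightarrow> W (f + h)"
      by (rule lim[OF H.add_mem[OF x(1) y(1)] tendsto_add[OF x(2) y(2)] l2_on_add[OF f h]])
    moreover have "(\<lambda>n. V (x n + y n)) \<longlonglongrightarrow> W f + W h"
      unfolding H.bop_add[OF V x(1) y(1)] by (rule tendsto_add[OF lim[OF x f] lim[OF y h]])
    ultimately show ?thesis by (rule LIMSEQ_unique)
  qed
  have scale: "W (scaleC_l2 c f) = scaleC_l2 c (W f)" if f: "f \<in> l2_on \<Omega>" for f c
  proof -
    obtain x where x: "\<And>n. x n \<in> H10 \<Omega>" "x \<longlonglongrightarrow> f" using H10_approx[OF f] by blast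
    have "(\<lambda>n. V (scaleC_l2 c (x n))) \<longlonglongrightarrow> W (scaleC_l2 c f)"
      by (rule lim[OF H.scaleC_mem[OF x(1)] bounded_linear.tendsto[OF bounded_linear_scaleC_l2 x(2)] l2_on_scaleC[OF f]])
    moreover have "(\<lambda>n. V (scaleC_l2 c (x n))) \<longlonglongrightarrow> scaleC_l2 c (W f)"
      unfolding H.bop_scaleC[OF V x(1)] by (rule bounded_linear.tendsto[OF bounded_linear_scaleC_l2 lim[OF x f]])
    ultimately show ?thesis by (rule LIMSEQ_unique)
  qed
  have bound: "norm (W f) \<le> C * norm f" if f: "f \<in> l2_on \<Omega>" for f
  proof -
    obtain x where x: "\<And>n. x n \<in> H10 \<Omega>" "x \<longlonglongrightarrow> f" using H10_approx[OF f] by blast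
    show ?thesis
      by (rule LIMSEQ_le[OF tendsto_norm[OF lim[OF x f]] tendsto_mult[OF tendsto_const tendsto_norm[OF x(2)]]])
         (intro exI allI impI C(2) x(1))
  qed
  have "L.bop W" by (rule L.bopI[OF mem add scale bound])
  then have "W \<in> bounded_ops (l2_on \<Omega>) norm" by (simp add: L.bounded_ops_iff W_def)
  with agree bound show ?thesis by blast
qed

text \<open>The norm of the extension is the least bound of \<open>V\<close> on \<open>H\<^sup>1\<^sub>0\<close> in the norm of \<open>L\<^sup>2\<close>.\<close>

lemma l2_op_norm_properties:
  assumes V: "H.bop V" and C: "0 \<le> C" "\<And>f. f \<in> H10 \<Omega> \<Longrightarrow> norm (V f) \<le> C * norm f"
  shows "l2_op_norm \<Omega> V \<le> C" "0 \<le> l2_op_norm \<Omega> V"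
    and "\<And>f. f \<in> H10 \<Omega> \<Longrightarrow> norm (V f) \<le> l2_op_norm \<Omega> V * norm f"
proof -
  obtain W where W: "W \<in> bounded_ops (l2_on \<Omega>) norm" "\<And>f. f \<in> H10 \<Omega> \<Longrightarrow> W f = V f"
    "\<And>f. f \<in> l2_on \<Omega> \<Longrightarrow> norm (W f) \<le> C * norm f"
    using l2_extension_ex[OF V C] by blast
  have bopW: "L.bop W" using W(1) by (simp add: L.bounded_ops_iff)
  have ext: "l2_extension \<Omega> V = W"
    unfolding l2_extension_def
  proof (rule the_equality)
    show "W \<in> bounded_ops (l2_on \<Omega>) norm \<and> (\<forall>f\<in>H10 \<Omega>. W f = V f)" using W(1,2) by blast
    fix U assume U: "U \<in> bounded_ops (l2_on \<Omega>) norm \<and> (\<forall>f\<in>H10 \<Omega>. U f = V f)"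
    then have bopU: "L.bop U" and U0: "\<And>f. f \<notin> l2_on \<Omega> \<Longrightarrow> U f = 0" by (auto simp: L.bounded_ops_iff)
    show "U = W"
    proof
      fix f show "U f = W f"
      proof (cases "f \<in> l2_on \<Omega>")
        case f: True
        obtain x where x: "\<And>n. x n \<in> H10 \<Omega>" "x \<longlonglongrightarrow> f" using H10_approx[OF f] by blast
        have "U (x n) = W (x n)" for n using U W(2)[OF x(1)] x(1) by simp
        then have "(\<lambda>n. W (x n)) \<longlonglongrightarrow> U f"
          using L_bop_limit[OF bopU H10_in_l2_on[OF x(1)] x(2) f] by simp
        from LIMSEQ_unique[OF this L_bop_limit[OF bopW H10_in_l2_on[OF x(1)] x(2) f]] show ?thesis .
      next
        case False
        then show ?thesis using U0 W(1) by (simp add: L.bounded_ops_iff)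
      qed
    qed
  qed
  show "l2_op_norm \<Omega> V \<le> C" unfolding l2_op_norm_def ext by (rule L.op_norm_le[OF C(1) W(3)])
  show "0 \<le> l2_op_norm \<Omega> V" unfolding l2_op_norm_def ext by (rule L.op_norm_nonneg[OF bopW])
  show "norm (V f) \<le> l2_op_norm \<Omega> V * norm f" if "f \<in> H10 \<Omega>" for f
    using L.op_norm_bound[OF bopW H10_in_l2_on[OF that]] by (simp add: l2_op_norm_def ext W(2)[OF that])
qed

lemma isom_groupD:
  assumes "G \<in> isom_group \<Omega>"
  shows "H.bop G" "f \<notin> H10 \<Omega> \<Longrightarrow> G f = 0"
    and "f \<in> H10 \<Omega> \<Longrightarrow> g \<in> H10 \<Omega> \<Longrightarrow> l2_inner (G f) (G g) = l2_inner f g"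
    and "f \<in> H10 \<Omega> \<Longrightarrow> norm (G f) = norm f"
proof -
  show bop: "H.bop G" and "f \<notin> H10 \<Omega> \<Longrightarrow> G f = 0"
    using assms by (auto simp: isom_group_def H10_Gl_def H.bounded_ops_iff)
  show iso: "l2_inner (G f) (G g) = l2_inner f g" if "f \<in> H10 \<Omega>" "g \<in> H10 \<Omega>" for f g
    using assms that by (simp add: isom_group_def)
  assume f: "f \<in> H10 \<Omega>"
  have "(norm (G f))\<^sup>2 = (norm f)\<^sup>2"
    using iso[OF f f] by (simp add: l2_inner_self del: of_real_power)
  then show "norm (G f) = norm f" by (simp add: power2_eq_iff_nonneg)
qed

lemma isom_group_inverse:
  assumes "G \<in> isom_group \<Omega>"
  obtains G' where "H.bop G'" "\<And>f. f \<in> H10 \<Omega> \<Longrightarrow> G (G' f) = f" "\<And>f. f \<in> H10 \<Omega> \<Longrightarrow> G' (G f) = f"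
proof -
  obtain G' where G': "G' \<in> H10_ops \<Omega>" "G \<circ> G' = id_op (H10 \<Omega>)" "G' \<circ> G = id_op (H10 \<Omega>)"
    using assms unfolding isom_group_def H10_Gl_def by blast
  have "G (G' f) = f" "G' (G f) = f" if "f \<in> H10 \<Omega>" for f
    using fun_cong[OF G'(2), of f] fun_cong[OF G'(3), of f] that by (simp_all add: id_op_def)
  with G'(1) show thesis using that[of G'] by (simp add: H.bounded_ops_iff)
qed

lemma derivative_unique:
  assumes bop: "\<And>s. s \<in> {a..b} \<Longrightarrow> H.bop (\<gamma> s)" and t: "a < b" "t \<in> {a..b}"
    and V: "op_has_derivative_within (H10 \<Omega>) (H1_norm \<Omega>) \<gamma> V t {a..b}"
  shows "velocity \<Omega> a b \<gamma> t = V"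
  unfolding velocity_def
proof (rule the_equality[where P = "\<lambda>V. op_has_derivative_within (H10 \<Omega>) (H1_norm \<Omega>) \<gamma> V t {a..b}", OF V])
  fix U assume U: "op_has_derivative_within (H10 \<Omega>) (H1_norm \<Omega>) \<gamma> U t {a..b}"
  have nt: "at t within {a..b} \<noteq> bot" using t by (simp add: trivial_limit_within)
  show "U = V"
  proof
    fix f show "U f = V f"
    proof (cases "f \<in> H10 \<Omega>")
      case f: True
      show ?thesis
        using H.curve_vector_derivative[OF bop t(2) f U] H.curve_vector_derivative[OF bop t(2) f V]
        unfolding has_vector_derivative_iff_quotient by (rule tendsto_unique[OF nt])
    next
      case False
      then show ?thesis
        using U V by (simp add: op_has_derivative_within_def H.bounded_ops_iff)
    qed
  qed
qed

text \<open>
  Velocities are bounded in \<open>L\<^sup>2\<close>: \<open>\<gamma>(t)\<^sup>-\<^sup>1 \<gamma>'(t)\<close> is bounded on \<open>H\<^sup>1\<^sub>0\<close> and antisymmetric for the inner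
  product of \<open>L\<^sup>2\<close>.
\<close>

lemma velocity_properties:
  assumes \<gamma>: "\<gamma> \<in> curves_joining \<Omega> a b G1 G2" and t: "a < b" "t \<in> {a..b}" and f: "f \<in> H10 \<Omega>"
  shows "((\<lambda>s. \<gamma> s f) has_vector_derivative velocity \<Omega> a b \<gamma> t f) (at t within {a..b})"
    and "norm (velocity \<Omega> a b \<gamma> t f) \<le> l2_op_norm \<Omega> (velocity \<Omega> a b \<gamma> t) * norm f"
    and "inner (velocity \<Omega> a b \<gamma> t f) (\<gamma> t f) = 0"
proof -
  have group: "\<gamma> s \<in> isom_group \<Omega>" if "s \<in> {a..b}" for s using \<gamma> that by (auto simp: curves_joining_def)
  have bop: "H.bop (\<gamma> s)" if "s \<in> {a..b}" for s by (rule isom_groupD(1)[OF group[OF that]])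
  have "\<exists>V. op_has_derivative_within (H10 \<Omega>) (H1_norm \<Omega>) \<gamma> V t {a..b}"
    using \<gamma> t(2) by (simp add: curves_joining_def)
  then obtain V where V: "op_has_derivative_within (H10 \<Omega>) (H1_norm \<Omega>) \<gamma> V t {a..b}" ..
  have eq: "velocity \<Omega> a b \<gamma> t = V" by (rule derivative_unique[OF bop t V])
  have bopV: "H.bop V" using V by (simp add: op_has_derivative_within_def H.bounded_ops_iff)
  have nt: "at t within {a..b} \<noteq> bot" using t by (simp add: trivial_limit_within)
  have iso: "l2_inner (\<gamma> s f) (\<gamma> s g) = l2_inner f g" if "s \<in> {a..b}" "f \<in> H10 \<Omega>" "g \<in> H10 \<Omega>" for s f g
    by (rule isom_groupD(3)[OF group[OF that(1)] that(2,3)])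
  have der: "l2_inner (V g) (\<gamma> t h) = - l2_inner (\<gamma> t g) (V h)" if "g \<in> H10 \<Omega>" "h \<in> H10 \<Omega>" for g h
    by (rule H.isometric_curve_derivative[OF bop iso t(2) nt V that])
  show "((\<lambda>s. \<gamma> s f) has_vector_derivative velocity \<Omega> a b \<gamma> t f) (at t within {a..b})"
    unfolding eq by (rule H.curve_vector_derivative[OF bop t(2) f V])
  obtain G' where G': "H.bop G'" "\<And>f. f \<in> H10 \<Omega> \<Longrightarrow> \<gamma> t (G' f) = f" "\<And>f. f \<in> H10 \<Omega> \<Longrightarrow> G' (\<gamma> t f) = f"
    using isom_group_inverse[OF group[OF t(2)]] by blast
  let ?T = "\<lambda>f. G' (V f)"
  have bopT: "H.bop ?T" by (rule H.bop_comp[OF G'(1) bopV])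
  have T: "\<gamma> t (?T g) = V g" if "g \<in> H10 \<Omega>" for g by (rule G'(2)[OF H.bop_mem[OF bopV that]])
  have anti: "l2_inner (?T g) h = - l2_inner g (?T h)" if g: "g \<in> H10 \<Omega>" and h: "h \<in> H10 \<Omega>" for g h
    using iso[OF t(2) H.bop_mem[OF bopT g] h] iso[OF t(2) g H.bop_mem[OF bopT h]] der[OF g h]
    by (simp add: T[OF g] T[OF h])
  obtain C where C: "0 \<le> C" "\<And>f. f \<in> H10 \<Omega> \<Longrightarrow> H1_norm \<Omega> (?T f) \<le> C * H1_norm \<Omega> f"
    using H.bop_bound[OF bopT] by blast
  have bound: "norm (V g) \<le> C * norm g" if g: "g \<in> H10 \<Omega>" for g
  proof -
    have "norm (V g) = norm (?T g)"
      using isom_groupD(4)[OF group[OF t(2)] H.bop_mem[OF bopT g]] by (simp add: T[OF g])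
    also have "\<dots> \<le> C * norm g"
      by (rule H.norm_le_of_N_bound[OF H.bop_mem[OF bopT] H.antisymmetric_norm_convex[OF H.bop_mem[OF bopT] anti] C g])
    finally show ?thesis .
  qed
  show "norm (velocity \<Omega> a b \<gamma> t f) \<le> l2_op_norm \<Omega> (velocity \<Omega> a b \<gamma> t) * norm f"
    unfolding eq by (rule l2_op_norm_properties(3)[OF bopV C(1) bound f])
  have "Re (l2_inner (V f) (\<gamma> t f)) = - Re (l2_inner (\<gamma> t f) (V f))" using der[OF f f] by simp
  then show "inner (velocity \<Omega> a b \<gamma> t f) (\<gamma> t f) = 0"
    unfolding eq by (simp add: inner_commute[of "\<gamma> t f"] flip: inner_l2_def)
qed

end

section \<open>A lower bound for the length\<close>

text \<open>
  The Henstock-Kurzweil integral recovers \<open>F\<close> from a derivative that exists at every point. Its integrand \<open>h\<close> is measurable,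
  and comparison with \<open>s\<close> makes it Lebesgue integrable. The comparison is legitimate for any \<open>s\<close>, since the
  integral on the right is a supremum over simple functions.
\<close>

lemma increment_le_nn_integral:
  fixes F h s :: "real \<Rightarrow> real"
  assumes ab: "a \<le> b" and der: "\<And>t. t \<in> {a..b} \<Longrightarrow> (F has_vector_derivative h t) (at t within {a..b})"
    and le: "\<And>t. t \<in> {a..b} \<Longrightarrow> \<bar>h t\<bar> \<le> s t"
  shows "ennreal \<bar>F b - F a\<bar> \<le> (\<integral>\<^sup>+t\<in>{a..b}. ennreal (s t) \<partial>lborel)" (is "_ \<le> ?I")
proof (cases "?I = \<infinity>")
  case False
  let ?h = "\<lambda>t. indicator {a..b} t *\<^sub>R h t"
  have FTC: "(h has_integral (F b - F a)) {a..b}"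
    by (rule fundamental_theorem_of_calculus[OF ab der])
  have meas: "?h \<in> borel_measurable lebesgue"
    by (rule has_integral_implies_lebesgue_measurable[OF FTC])
  have "(\<integral>\<^sup>+t. norm (?h t) \<partial>lebesgue) = (\<integral>\<^sup>+t. norm (?h t) \<partial>lborel)"
    by (rule nn_integral_completion)
  also have "\<dots> \<le> ?I"
    by (rule nn_integral_mono) (use le in \<open>auto simp: indicator_def intro!: ennreal_leI\<close>)
  finally have bound: "(\<integral>\<^sup>+t. norm (?h t) \<partial>lebesgue) \<le> ?I" .
  then have int: "integrable lebesgue ?h"
    using False by (intro integrableI_bounded meas) (auto simp: less_top[symmetric] top_unique)
  have "(?h has_integral (integral\<^sup>L lebesgue ?h)) UNIV"
    by (rule has_integral_integral_lebesgue[OF int])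
  moreover have "(?h has_integral (F b - F a)) UNIV"
  proof -
    have "((\<lambda>t. if t \<in> {a..b} then h t else 0) has_integral (F b - F a)) UNIV"
      using FTC by (simp only: has_integral_restrict_UNIV)
    moreover have "(\<lambda>t. if t \<in> {a..b} then h t else 0) = ?h" by (auto simp: fun_eq_iff indicator_def)
    ultimately show ?thesis by simp
  qed
  ultimately have "integral\<^sup>L lebesgue ?h = F b - F a" by (rule has_integral_unique)
  then show ?thesis
    using integral_norm_bound_ennreal[OF int] bound by simp
qed simp

text \<open>
  The orbit \<open>\<gamma>(t) v\<close> of a unit vector runs on the unit sphere, so the length of \<open>\<gamma>\<close> is at least the angle
  between \<open>v\<close> and its image. With \<open>p\<close> the inner product of \<open>\<gamma>(t) v\<close> and \<open>v\<close> one has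
  \<open>|p'| \<le> \<parallel>\<gamma>'\<parallel> sqrt (1 - p\<^sup>2)\<close>. A factor \<open>r < 1\<close> keeps the derivative of \<open>arcsin (r p)\<close> finite where
  \<open>p = \<plusminus>1\<close>.
\<close>

lemma (in open_domain) angle_le_length:
  assumes \<gamma>: "\<gamma> \<in> curves_joining \<Omega> a b (id_op (H10 \<Omega>)) G" and ab: "a < b"
    and v: "v \<in> H10 \<Omega>" "norm v = 1"
  shows "ennreal (pi / 2 - arcsin (inner (G v) v)) \<le> length2 \<Omega> a b \<gamma>"
proof -
  define p where "p t = inner (\<gamma> t v) v" for t
  define s where "s t = l2_op_norm \<Omega> (velocity \<Omega> a b \<gamma> t)" for t
  have norm1: "norm (\<gamma> t v) = 1" if "t \<in> {a..b}" for t
  proof -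
    have "\<gamma> t \<in> isom_group \<Omega>" using \<gamma> that by (auto simp: curves_joining_def)
    from isom_groupD(4)[OF this v(1)] show ?thesis using v(2) by simp
  qed
  have p_le: "\<bar>p t\<bar> \<le> 1" if "t \<in> {a..b}" for t
    using Cauchy_Schwarz_ineq2[of "\<gamma> t v" v] norm1[OF that] v(2) by (simp add: p_def)
  have endpoints: "p a = 1" "p b = inner (G v) v"
    using \<gamma> v by (auto simp: curves_joining_def p_def id_op_def norm_eq_1)
  have step: "ennreal \<bar>arcsin (r * p b) - arcsin (r * p a)\<bar> \<le> length2 \<Omega> a b \<gamma>" if r: "0 < r" "r < 1" for r
    unfolding length2_def s_def[symmetric]
  proof (rule increment_le_nn_integral)
    fix t assume t: "t \<in> {a..b}"
    define p' where "p' = inner (velocity \<Omega> a b \<gamma> t v) v"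
    note vel = velocity_properties[OF \<gamma> ab t v(1)]
    have "((\<lambda>t. inner (\<gamma> t v) v) has_vector_derivative p') (at t within {a..b})"
      unfolding p'_def by (rule bounded_linear.has_vector_derivative[OF bounded_linear_inner_left vel(1)])
    then have "(p has_field_derivative p') (at t within {a..b})"
      by (simp add: p_def[abs_def] has_real_derivative_iff_has_vector_derivative)
    then have rp: "((\<lambda>t. r * p t) has_field_derivative r * p') (at t within {a..b})"
      by (rule DERIV_cmult)
    have lt: "\<bar>r * p t\<bar> < 1"
    proof -
      have "r * \<bar>p t\<bar> \<le> r * 1" by (rule mult_left_mono[OF p_le[OF t]]) (use r in simp)
      moreover have "\<bar>r * p t\<bar> = r * \<bar>p t\<bar>" using r by (simp add: abs_mult)
      ultimately show ?thesis using r by linarith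
    qed
    then have "((\<lambda>t. arcsin (r * p t)) has_field_derivative inverse (sqrt (1 - (r * p t)\<^sup>2)) * (r * p')) (at t within {a..b})"
      by (intro DERIV_chain2[OF DERIV_arcsin rp]) auto
    then show "((\<lambda>t. arcsin (r * p t)) has_vector_derivative inverse (sqrt (1 - (r * p t)\<^sup>2)) * (r * inner (velocity \<Omega> a b \<gamma> t v) v))
        (at t within {a..b})"
      by (simp add: p'_def has_real_derivative_iff_has_vector_derivative)
    have orth: "p' = inner (velocity \<Omega> a b \<gamma> t v) (v - p t *\<^sub>R \<gamma> t v)"
      using vel(3) by (simp add: p'_def inner_diff_right)
    have normal: "norm (v - p t *\<^sub>R \<gamma> t v) = sqrt (1 - (p t)\<^sup>2)"
    proof -
      have "inner v v = 1" "inner (\<gamma> t v) (\<gamma> t v) = 1" using v(2) norm1[OF t] by (simp_all add: norm_eq_1)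
      then have "inner (v - p t *\<^sub>R \<gamma> t v) (v - p t *\<^sub>R \<gamma> t v) = 1 - (p t)\<^sup>2"
        by (simp add: inner_diff_left inner_diff_right p_def inner_commute[of v "\<gamma> t v"] power2_eq_square)
      then show ?thesis by (simp add: norm_eq_sqrt_inner)
    qed
    have "\<bar>p'\<bar> \<le> norm (velocity \<Omega> a b \<gamma> t v) * norm (v - p t *\<^sub>R \<gamma> t v)"
      unfolding orth by (rule Cauchy_Schwarz_ineq2)
    also have "\<dots> \<le> s t * sqrt (1 - (p t)\<^sup>2)"
      unfolding normal using vel(2) v(2) p_le[OF t] by (intro mult_right_mono) (auto simp: s_def abs_square_le_1)
    finally have p'_le: "\<bar>p'\<bar> \<le> s t * sqrt (1 - (p t)\<^sup>2)" .
    have s0: "0 \<le> s t" using order_trans[OF norm_ge_zero vel(2)] v(2) by (simp add: s_def)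
    have pos: "0 < sqrt (1 - (r * p t)\<^sup>2)" using lt by (simp add: abs_square_less_1)
    have "r * sqrt (1 - (p t)\<^sup>2) = sqrt (r\<^sup>2 * (1 - (p t)\<^sup>2))" using r by (simp add: real_sqrt_mult)
    also have "\<dots> \<le> sqrt (1 - (r * p t)\<^sup>2)"
    proof -
      have "r\<^sup>2 \<le> 1" using r by (simp add: power_le_one)
      then show ?thesis by (simp add: power_mult_distrib algebra_simps)
    qed
    finally have shrink: "r * sqrt (1 - (p t)\<^sup>2) \<le> sqrt (1 - (r * p t)\<^sup>2)" .
    have "r * \<bar>p'\<bar> \<le> r * (s t * sqrt (1 - (p t)\<^sup>2))"
      by (rule mult_left_mono[OF p'_le]) (use r in simp)
    also have "\<dots> = s t * (r * sqrt (1 - (p t)\<^sup>2))" by simp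
    also have "\<dots> \<le> s t * sqrt (1 - (r * p t)\<^sup>2)" by (rule mult_left_mono[OF shrink s0])
    finally have "r * \<bar>p'\<bar> \<le> s t * sqrt (1 - (r * p t)\<^sup>2)" .
    then have "inverse (sqrt (1 - (r * p t)\<^sup>2)) * (r * \<bar>p'\<bar>) \<le> s t"
      using pos by (simp add: divide_le_eq flip: divide_inverse_commute)
    then show "\<bar>inverse (sqrt (1 - (r * p t)\<^sup>2)) * (r * inner (velocity \<Omega> a b \<gamma> t v) v)\<bar> \<le> s t"
      using pos r by (simp add: abs_mult p'_def)
  qed (use ab in simp)
  define r where "r n = 1 - inverse (real (Suc (Suc n)))" for n
  have r: "0 < r n" "r n < 1" for n by (auto simp: r_def inverse_eq_divide field_simps)
  have "(\<lambda>n. inverse (real (Suc (Suc n)))) \<longlonglongrightarrow> 0" by (rule LIMSEQ_Suc[OF LIMSEQ_inverse_real_of_nat])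
  from tendsto_diff[OF tendsto_const this, of 1] have r_lim: "r \<longlonglongrightarrow> 1" by (simp add: r_def[abs_def])
  have pb: "\<bar>p b\<bar> \<le> 1" using p_le ab by simp
  have "r n * \<bar>p b\<bar> \<le> 1" for n
    using mult_mono[of "r n" 1 "\<bar>p b\<bar>" 1] r[of n] pb by simp
  then have rpb: "\<bar>r n * p b\<bar> \<le> 1" for n using r[of n] by (simp add: abs_mult)
  have "(\<lambda>n. r n * p b) \<longlonglongrightarrow> 1 * p b" by (intro tendsto_mult r_lim tendsto_const)
  then have "(\<lambda>n. arcsin (r n * p b)) \<longlonglongrightarrow> arcsin (1 * p b)"
    using pb rpb by (intro continuous_on_tendsto_compose[OF continuous_on_arcsin']) (auto simp: abs_le_iff minus_le_iff)
  moreover have "(\<lambda>n. arcsin (r n * p a)) \<longlonglongrightarrow> arcsin 1"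
  proof (rule continuous_on_tendsto_compose[OF continuous_on_arcsin'])
    show "(\<lambda>n. r n * p a) \<longlonglongrightarrow> 1" using r_lim by (simp add: endpoints)
    show "\<forall>\<^sub>F n in sequentially. r n * p a \<in> {- 1..1}"
    proof (rule always_eventually, rule allI)
      fix n show "r n * p a \<in> {- 1..1}" using r[of n] by (simp add: endpoints)
    qed
  qed simp
  ultimately have "(\<lambda>n. \<bar>arcsin (r n * p b) - arcsin (r n * p a)\<bar>) \<longlonglongrightarrow> \<bar>arcsin (1 * p b) - arcsin 1\<bar>"
    by (intro tendsto_rabs tendsto_diff)
  then have "(\<lambda>n. ennreal \<bar>arcsin (r n * p b) - arcsin (r n * p a)\<bar>) \<longlonglongrightarrow> ennreal \<bar>arcsin (1 * p b) - arcsin 1\<bar>"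
    by (rule tendsto_ennrealI)
  then have "ennreal \<bar>arcsin (1 * p b) - arcsin 1\<bar> \<le> length2 \<Omega> a b \<gamma>"
    by (rule LIMSEQ_le_const2[OF _ exI, OF _ allI[OF impI]]) (rule step[OF r])
  moreover have "arcsin (p b) \<le> pi / 2" using arcsin_bounded[of "p b"] pb by (simp add: abs_le_iff)
  ultimately show ?thesis by (simp add: endpoints)
qed

section \<open>Minimality of the one-parameter group\<close>

text \<open>
  With \<open>A = G - 1\<close> a contraction and \<open>m \<parallel>f\<parallel> \<le> \<parallel>G f\<parallel>\<close>, the parallelogram law for \<open>A f\<close> and \<open>f\<close> gives
  \<open>\<parallel>G f - 2 f\<parallel>\<^sup>2 \<le> 4 \<parallel>f\<parallel>\<^sup>2 - \<parallel>G f\<parallel>\<^sup>2 \<le> (4 - m\<^sup>2) \<parallel>f\<parallel>\<^sup>2\<close>. So although the logarithmic series around \<open>1\<close> is at the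
  edge of convergence, the one around \<open>2\<close> converges.
\<close>

lemma (in open_domain) half_minus_one_contraction:
  assumes G: "G \<in> isom_group \<Omega>" and near: "H10_op_norm \<Omega> (\<lambda>f. G f - id_op (H10 \<Omega>) f) \<le> 1"
  obtains q where "0 \<le> q" "q < 1"
    "\<And>f. f \<in> H10 \<Omega> \<Longrightarrow> H1_norm \<Omega> ((1/2) *\<^sub>R G f - f) \<le> q * H1_norm \<Omega> f"
proof -
  let ?N = "H1_norm \<Omega>"
  have bopG: "H.bop G" by (rule isom_groupD(1)[OF G])
  obtain G' where G': "H.bop G'" "\<And>f. f \<in> H10 \<Omega> \<Longrightarrow> G (G' f) = f" "\<And>f. f \<in> H10 \<Omega> \<Longrightarrow> G' (G f) = f"
    using isom_group_inverse[OF G] by blast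
  obtain C0 where C0: "0 \<le> C0" "\<And>f. f \<in> H10 \<Omega> \<Longrightarrow> ?N (G' f) \<le> C0 * ?N f"
    using H.bop_bound[OF G'(1)] by blast
  define C where "C = max C0 1"
  have C: "1 \<le> C" by (simp add: C_def)
  have lower: "?N f \<le> C * ?N (G f)" if f: "f \<in> H10 \<Omega>" for f
  proof -
    have "?N f \<le> C0 * ?N (G f)" using C0(2)[OF H.bop_mem[OF bopG f]] by (simp add: G'(3)[OF f])
    also have "\<dots> \<le> C * ?N (G f)" by (rule mult_right_mono) (simp_all add: C_def H1_norm_nonneg)
    finally show ?thesis .
  qed
  define q where "q = sqrt (1 - inverse (4 * C\<^sup>2))"
  have "1 \<le> C\<^sup>2" using C by (simp add: one_le_power)
  then have "1 \<le> 4 * C\<^sup>2" by linarith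
  then have "0 < 4 * C\<^sup>2" "inverse (4 * C\<^sup>2) \<le> 1"
    by (linarith, simp only: inverse_le_1_iff simp_thms)
  then have "0 < inverse (4 * C\<^sup>2)" "inverse (4 * C\<^sup>2) \<le> 1"
    by (simp_all only: positive_imp_inverse_positive)
  then have q: "0 \<le> q" "q < 1" and q2: "q\<^sup>2 = 1 - inverse (4 * C\<^sup>2)" by (simp_all add: q_def)
  have "?N ((1/2) *\<^sub>R G f - f) \<le> q * ?N f" if f: "f \<in> H10 \<Omega>" for f
  proof (rule power2_le_imp_le)
    have Gf: "G f \<in> H10 \<Omega>" by (rule H.bop_mem[OF bopG f])
    have A: "G f - f \<in> H10 \<Omega>" by (rule H.diff_mem[OF Gf f])
    have H1: "G f - f \<in> H1 \<Omega>" "f \<in> H1 \<Omega>"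
      using subsetD[OF H10_subset_H1[OF open_domain]] A f by auto
    have id: "H.bop (id_op (H10 \<Omega>))"
      by (rule H.bopI[where C = 1]) (simp_all add: id_op_def H.add_mem H.scaleC_mem)
    have "?N (G f - f) \<le> H10_op_norm \<Omega> (\<lambda>f. G f - id_op (H10 \<Omega>) f) * ?N f"
      using H.op_norm_bound[OF H.bop_diff_op[OF bopG id] f] f by (simp add: id_op_def)
    also have "\<dots> \<le> 1 * ?N f" by (rule mult_right_mono[OF near H1_norm_nonneg])
    finally have "(?N (G f - f))\<^sup>2 \<le> (?N f)\<^sup>2" by (intro power_mono) (simp_all add: H1_norm_nonneg)
    moreover have "(?N (G f))\<^sup>2 + (?N (G f - f - f))\<^sup>2 = 2 * (?N (G f - f))\<^sup>2 + 2 * (?N f)\<^sup>2"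
      using H1_norm_parallelogram[OF open_domain H1] by simp
    moreover have "(?N f)\<^sup>2 \<le> C\<^sup>2 * (?N (G f))\<^sup>2"
      using power_mono[OF lower[OF f] H1_norm_nonneg, of 2] by (simp add: power_mult_distrib)
    then have "inverse (C\<^sup>2) * (?N f)\<^sup>2 \<le> (?N (G f))\<^sup>2"
      using C by (simp add: divide_le_eq mult.commute flip: divide_inverse_commute)
    ultimately have le: "(?N (G f - f - f))\<^sup>2 \<le> 4 * (?N f)\<^sup>2 - inverse (C\<^sup>2) * (?N f)\<^sup>2" by linarith
    have "?N ((1/2) *\<^sub>R G f - f) = ?N (G f - f - f) / 2"
    proof -
      have "(1/2) *\<^sub>R G f - f = (1/2) *\<^sub>R (G f - f - f)"
        by (simp add: scaleR_diff_right diff_diff_eq flip: scaleR_add_left)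
      then show ?thesis using H.N_scaleR[OF H.diff_mem[OF A f], of "1/2"] by simp
    qed
    then have "(?N ((1/2) *\<^sub>R G f - f))\<^sup>2 = (?N (G f - f - f))\<^sup>2 / 4"
      by (simp only: power_divide) simp
    moreover have "(q * ?N f)\<^sup>2 = (?N f)\<^sup>2 - inverse (C\<^sup>2) * (?N f)\<^sup>2 / 4"
      by (simp add: power_mult_distrib q2 left_diff_distrib)
    ultimately show "(?N ((1/2) *\<^sub>R G f - f))\<^sup>2 \<le> (q * ?N f)\<^sup>2"
      using le by linarith
    show "0 \<le> q * ?N f" using q by (simp add: H1_norm_nonneg)
  qed
  with q show thesis by (rule that)
qed

theorem proposition6p1:
  fixes \<Omega> :: "(real ^ 'n) set" and G :: "(real ^ 'n) l2 \<Rightarrow> (real ^ 'n) l2"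
  assumes "open \<Omega>"
    and "G \<in> isom_group \<Omega>"
    and "H10_op_norm \<Omega> (\<lambda>f. G f - id_op (H10 \<Omega>) f) \<le> 1"
  shows "\<exists>X\<in>isom_algebra \<Omega>. \<exists>\<delta>.
    (\<forall>t\<in>{0..1}. \<delta> t = H10_exp \<Omega> (\<lambda>f. t *\<^sub>R X f)) \<and>
    \<delta> 1 = G \<and>
    \<delta> \<in> curves_joining \<Omega> 0 1 (id_op (H10 \<Omega>)) G \<and>
    (\<forall>a b \<gamma>. a < b \<longrightarrow> \<gamma> \<in> curves_joining \<Omega> a b (id_op (H10 \<Omega>)) G \<longrightarrow>
       length2 \<Omega> 0 1 \<delta> \<le> length2 \<Omega> a b \<gamma>) \<and>
    dist2 \<Omega> (id_op (H10 \<Omega>)) G = ennreal (l2_op_norm \<Omega> X)"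
proof -
  interpret open_domain \<Omega> by unfold_locales (rule assms(1))
  note G = isom_groupD[OF assms(2)]
  obtain G' where G': "H.bop G'" "\<And>f. f \<in> H10 \<Omega> \<Longrightarrow> G (G' f) = f" "\<And>f. f \<in> H10 \<Omega> \<Longrightarrow> G' (G f) = f"
    using isom_group_inverse[OF assms(2)] by blast
  obtain q where q: "0 \<le> q" "q < 1"
    "\<And>f. f \<in> H10 \<Omega> \<Longrightarrow> H1_norm \<Omega> ((1/2) *\<^sub>R G f - f) \<le> q * H1_norm \<Omega> f"
    using half_minus_one_contraction[OF assms(2,3)] by blast
  define B where "B f = (1/2) *\<^sub>R G f - f" for f
  define B' where "B' f = (1/2) *\<^sub>R G' f - f" for f
  have half: "H.bop (\<lambda>f. (1/2) *\<^sub>R T f - f)" if "H.bop T" for T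
    using H.bop_diff_op[OF H.bop_scaleC_op[OF that, of "of_real (1/2)"] H.bop_id] by (simp only: scaleC_l2_of_real)
  have adjG: "l2_inner (G f) g = l2_inner f (G' g)" if "f \<in> H10 \<Omega>" "g \<in> H10 \<Omega>" for f g
    using G(3)[OF that(1) H.bop_mem[OF G'(1) that(2)]] by (simp add: G'(2)[OF that(2)])
  interpret unitary_contraction "H10 \<Omega>" "H1_norm \<Omega>" B q B'
  proof
    show "H.bop B" unfolding B_def[abs_def] by (rule half[OF G(1)])
    show "H.bop B'" unfolding B'_def[abs_def] by (rule half[OF G'(1)])
    show "0 \<le> q" "q < 1" by (rule q)+
    show "H1_norm \<Omega> (B f) \<le> q * H1_norm \<Omega> f" if "f \<in> H10 \<Omega>" for f unfolding B_def by (rule q(3)[OF that])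
    show "l2_inner (B f) g = l2_inner f (B' g)" if "f \<in> H10 \<Omega>" "g \<in> H10 \<Omega>" for f g
      using adjG[OF that]
      by (simp add: B_def B'_def l2_inner_diff_left l2_inner_diff_right l2_inner_scaleC_left l2_inner_scaleC_right
          flip: scaleC_l2_of_real)
    show "B (B' f) = B' (B f)" if f: "f \<in> H10 \<Omega>" for f
      by (simp add: B_def B'_def H.bop_diff[OF G(1)] H.bop_diff[OF G'(1)] H.bop_scaleR[OF G(1)] H.bop_scaleR[OF G'(1)]
          H.scaleR_mem H.bop_mem[OF G(1)] H.bop_mem[OF G'(1)] f G'(2,3) algebra_simps)
    show "norm (2 *\<^sub>R (f + B f)) = norm f" if "f \<in> H10 \<Omega>" for f using G(4)[OF that] by (simp add: B_def)
  qed
  have flow1: "flow 1 = G"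
  proof
    fix f show "flow 1 f = G f"
      using flow_1[of f] G(2)[of f] calc_outside[of f] by (cases "f \<in> H10 \<Omega>") (simp_all add: B_def flow_def)
  qed
  have flow_out: "flow t f = 0" if "f \<notin> H10 \<Omega>" for t f using calc_outside[OF that] by (simp add: flow_def)
  have flow_inv: "flow s \<circ> flow t = id_op (H10 \<Omega>)" if "s + t = 0" for s t
  proof
    fix f show "(flow s \<circ> flow t) f = id_op (H10 \<Omega>) f"
    proof (cases "f \<in> H10 \<Omega>")
      case True
      then show ?thesis using flow_add[OF True, of s t] flow_0[OF True] that by (simp add: id_op_def)
    next
      case False
      then show ?thesis by (simp add: flow_out id_op_def H.bop_zero[OF bop_flow])
    qed
  qed
  have flow_group: "flow t \<in> isom_group \<Omega>" for t
    unfolding isom_group_def H10_Gl_def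
  proof (intro CollectI conjI ballI bexI)
    show "flow t \<circ> flow (- t) = id_op (H10 \<Omega>)" "flow (- t) \<circ> flow t = id_op (H10 \<Omega>)"
      by (intro flow_inv; simp)+
  qed (rule flow_bounded_ops l2_inner_flow; assumption?)+
  have X: "generator \<in> isom_algebra \<Omega>"
    unfolding isom_algebra_def
    by (intro CollectI conjI ballI generator_bounded_ops generator_antisymmetric)
  have flow_curve: "flow \<in> curves_joining \<Omega> 0 1 (id_op (H10 \<Omega>)) G"
  proof -
    have "flow 0 = id_op (H10 \<Omega>)"
      using flow_0 flow_out by (auto simp: fun_eq_iff id_op_def)
    then show ?thesis
      unfolding curves_joining_def using flow_group flow_has_derivative flow1 by blast
  qed
  define \<theta> where "\<theta> = l2_op_norm \<Omega> generator"
  obtain M where M: "0 \<le> M" "\<And>z. cmod z \<le> radius \<Longrightarrow> cmod (log_symbol z) \<le> M"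
    using log_symbol_bounded by blast
  have bound0: "norm (generator f) \<le> M * calc_const * norm f" if "f \<in> H10 \<Omega>" for f
    unfolding generator_def by (rule calc_norm_bound[OF hol_log M(2) that])
  have const0: "0 \<le> M * calc_const" by (rule mult_nonneg_nonneg[OF M(1) calc_const_nonneg])
  have \<theta>_nonneg: "0 \<le> \<theta>"
    unfolding \<theta>_def by (rule l2_op_norm_properties(2)[OF bop_generator const0 bound0])
  have \<theta>_bound: "norm (generator f) \<le> \<theta> * norm f" if "f \<in> H10 \<Omega>" for f
    unfolding \<theta>_def by (rule l2_op_norm_properties(3)[OF bop_generator const0 bound0 that])
  \<comment> \<open>The velocity is the composition of \<open>X\<close> with a surjective isometry of \<open>H\<^sup>1\<^sub>0\<close>, so it has the norm of \<open>X\<close>.\<close>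
  have speed: "l2_op_norm \<Omega> (velocity \<Omega> 0 1 flow t) = \<theta>" if t: "t \<in> {0..1}" for t
  proof -
    have vel: "velocity \<Omega> 0 1 flow t = (\<lambda>f. generator (flow t f))"
      by (rule derivative_unique[OF bop_flow _ t flow_has_derivative]) simp
    have bopV: "H.bop (\<lambda>f. generator (flow t f))" by (rule H.bop_comp[OF bop_generator bop_flow])
    have le: "norm (generator (flow t f)) \<le> \<theta> * norm f" if f: "f \<in> H10 \<Omega>" for f
      using \<theta>_bound[OF H.bop_mem[OF bop_flow f]] by (simp add: norm_flow[OF f])
    have V_le: "l2_op_norm \<Omega> (\<lambda>f. generator (flow t f)) \<le> \<theta>"
      by (rule l2_op_norm_properties(1)[OF bopV \<theta>_nonneg le])
    have V_nonneg: "0 \<le> l2_op_norm \<Omega> (\<lambda>f. generator (flow t f))"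
      by (rule l2_op_norm_properties(2)[OF bopV \<theta>_nonneg le])
    have V_bound: "norm (generator (flow t f)) \<le> l2_op_norm \<Omega> (\<lambda>f. generator (flow t f)) * norm f"
      if "f \<in> H10 \<Omega>" for f
      by (rule l2_op_norm_properties(3)[OF bopV \<theta>_nonneg le that])
    have "norm (generator f) \<le> l2_op_norm \<Omega> (\<lambda>f. generator (flow t f)) * norm f" if f: "f \<in> H10 \<Omega>" for f
    proof -
      have "flow t (flow (- t) f) = f" using fun_cong[OF flow_inv[of t "- t"], of f] f by (simp add: id_op_def)
      then show ?thesis
        using V_bound[OF H.bop_mem[OF bop_flow f, of "- t"]] by (simp add: norm_flow[OF f])
    qed
    then have "\<theta> \<le> l2_op_norm \<Omega> (\<lambda>f. generator (flow t f))"
      unfolding \<theta>_def by (rule l2_op_norm_properties(1)[OF bop_generator V_nonneg])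
    with V_le show ?thesis by (simp add: vel)
  qed
  have length: "length2 \<Omega> 0 1 flow = ennreal \<theta>"
  proof -
    have "length2 \<Omega> 0 1 flow = (\<integral>\<^sup>+t. ennreal \<theta> * indicator {0..1::real} t \<partial>lborel)"
      unfolding length2_def
      by (rule nn_integral_cong) (auto simp: indicator_def speed)
    also have "\<dots> = ennreal \<theta>" by (subst nn_integral_cmult_indicator) auto
    finally show ?thesis .
  qed
  \<comment> \<open>The angle between \<open>v\<close> and \<open>G v\<close> tends to \<open>\<theta>\<close> along approximate eigenvectors \<open>v\<close> of \<open>X\<close>.\<close>
  have minimal: "ennreal \<theta> \<le> length2 \<Omega> a b \<gamma>"
    if \<gamma>: "a < b" "\<gamma> \<in> curves_joining \<Omega> a b (id_op (H10 \<Omega>)) G" for a b \<gamma>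
  proof (cases "\<theta> = 0")
    case False
    then have \<theta>: "0 < \<theta>" using \<theta>_nonneg by simp
    have least: "\<theta> \<le> C" if "0 \<le> C" "\<And>f. f \<in> H10 \<Omega> \<Longrightarrow> norm (generator f) \<le> C * norm f" for C
      unfolding \<theta>_def by (rule l2_op_norm_properties(1)[OF bop_generator that])
    have less_pi: "\<theta> < pi" by (rule generator_norm_attained(1)[OF \<theta> \<theta>_bound least])
    \<comment> \<open>Bounds for the inner product of \<open>v\<close> and \<open>G v\<close>, kept in the domain of the inverse sine.\<close>
    define x where "x n = min 1 (cos \<theta> + inverse (real (Suc n)))" for n
    have x: "x n \<in> {-1..1}" for n using cos_ge_minus_one[of \<theta>] by (simp add: x_def min_def add_increasing2)
    have "ennreal (pi / 2 - arcsin (x n)) \<le> length2 \<Omega> a b \<gamma>" for n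
    proof -
      have "0 < inverse (real (Suc n))" by simp
      then obtain v where v: "v \<in> H10 \<Omega>" "norm v = 1" "inner (flow 1 v) v \<le> cos \<theta> + inverse (real (Suc n))"
        using generator_norm_attained(2)[OF \<theta> \<theta>_bound least] by blast
      have "\<bar>inner (G v) v\<bar> \<le> 1" using Cauchy_Schwarz_ineq2[of "G v" v] G(4)[OF v(1)] v(2) by simp
      then have "arcsin (inner (G v) v) \<le> arcsin (x n)"
        using v(3) x[of n] by (intro arcsin_le_arcsin) (auto simp: x_def flow1)
      then have "ennreal (pi / 2 - arcsin (x n)) \<le> ennreal (pi / 2 - arcsin (inner (G v) v))"
        by (intro ennreal_leI) simp
      also have "\<dots> \<le> length2 \<Omega> a b \<gamma>" by (rule angle_le_length[OF \<gamma>(2,1) v(1,2)])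
      finally show ?thesis .
    qed
    moreover have "(\<lambda>n. ennreal (pi / 2 - arcsin (x n))) \<longlonglongrightarrow> ennreal \<theta>"
    proof -
      have "x \<longlonglongrightarrow> min 1 (cos \<theta> + 0)"
        unfolding x_def[abs_def] by (intro tendsto_min tendsto_add tendsto_const LIMSEQ_inverse_real_of_nat)
      then have "x \<longlonglongrightarrow> cos \<theta>" by (simp add: min_absorb2)
      then have "(\<lambda>n. arcsin (x n)) \<longlonglongrightarrow> arcsin (cos \<theta>)"
        by (rule continuous_on_tendsto_compose[OF continuous_on_arcsin']) (use x in \<open>simp_all add: cos_ge_minus_one\<close>)
      moreover have "arcsin (cos \<theta>) = pi / 2 - \<theta>"
        using arcsin_sin[of "pi / 2 - \<theta>"] \<theta> less_pi by (simp add: cos_sin_eq)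
      ultimately have "(\<lambda>n. pi / 2 - arcsin (x n)) \<longlonglongrightarrow> pi / 2 - (pi / 2 - \<theta>)"
        by (intro tendsto_diff tendsto_const) simp
      then show ?thesis by (intro tendsto_ennrealI) simp
    qed
    ultimately show ?thesis by (intro LIMSEQ_le_const2) auto
  qed simp
  have "dist2 \<Omega> (id_op (H10 \<Omega>)) G = ennreal \<theta>"
    unfolding dist2_def
  proof (rule antisym)
    show "Inf {length2 \<Omega> a b \<gamma> | a b \<gamma>. a < b \<and> \<gamma> \<in> curves_joining \<Omega> a b (id_op (H10 \<Omega>)) G} \<le> ennreal \<theta>"
    proof (rule Inf_lower)
      show "ennreal \<theta> \<in> {length2 \<Omega> a b \<gamma> | a b \<gamma>. a < b \<and> \<gamma> \<in> curves_joining \<Omega> a b (id_op (H10 \<Omega>)) G}"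
        using flow_curve length by (intro CollectI exI[of _ 0] exI[of _ 1] exI[of _ flow]) simp
    qed
    show "ennreal \<theta> \<le> Inf {length2 \<Omega> a b \<gamma> | a b \<gamma>. a < b \<and> \<gamma> \<in> curves_joining \<Omega> a b (id_op (H10 \<Omega>)) G}"
      by (rule Inf_greatest) (use minimal in blast)
  qed
  then show ?thesis
    using X flow1 flow_curve minimal unfolding \<theta>_def[symmetric]
    by (intro bexI[of _ generator] exI[of _ flow]) (simp_all add: flow_eq_exp length \<theta>_def)
qed

end
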